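(* If $r\le4$, then $\mathcal{C}(2^r)=0$. Suppose that $r\ge5$. Then $$\mathcal{C}(2^r)\simeq\bigoplus_{f=3}^r\big\langle\overline{B^2(r,f)}\big\rangle .$$ Moreover, for $3\le f\le r$, with $j=\left\lfloor\frac{r+1-f}{2}\right\rfloor$, the order of $B^2(r,f)$ is $$\begin{cases}2^{r-3-j}&\text{if }f=r+1-\gcd(2,r),\\2^{r-4-j}&\text{otherwise.}\end{cases}$$
   Context: $X_0(2^r)$ is the canonical model over $\mathbf{Q}$ of the modular curve of $\Gamma_0(2^r)$, $J_0(2^r)$ its Jacobian. For $0\le k\le r$, a cusp is of level $2^k$ if represented by $x/2^k$ with $\gcd(x,2^k)=1$; $(P_{2^k})$ is the sum of all cusps of level $2^k$, each with multiplicity one. Rational cuspidal divisors are exactly the integral combinations $\sum_ka_k(P_{2^k})$, written as vectors $(a_0,\dots,a_r)$. $\overline{D}$ is the class of $D$ in $J_0(2^r)$; the order of $D$ is the order of $\overline{D}$. $\mathcal{C}(2^r)$ is the subgroup of $J_0(2^r)(\mathbf{Q})$ generated by the classes of all degree $0$ rational cuspidal divisors. Let $r\ge5$. For $3\le g\le r-2$ let $\mu=\min(g,r-g)$ and let $\mathbf{E}_g=(a_0,\dots,a_r)$ with $a_g=-1$, $(a_0,a_1)=(0,2^{\mu-1})$ if $g$ is odd, $(a_0,a_1)=(3\cdot2^{\mu-2},-2^{\mu-2})$ if $g$ is even, and all other entries $0$. For $3\le f\le r$, $B^2(r,f)$ is the divisor with vector: $\mathbf{E}_{(r+f-2)/2}$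 if $f\le r-2$ and $r-f$ is even; $\mathbf{E}_{(r-f+3)/2}$ if $f\le r-2$ and $r-f$ is odd; $(1,-1,0,\dots,0)$ if $f=r-1$ and $r$ is even; $(-1,-1,0,\dots,0,2)$ if $f=r-1$ and $r$ is odd; $(1,0,\dots,0,-1)$ if $f=r$. *)

theory Defs
  imports
    "HOL-Analysis.Analysis"
    "HOL-Complex_Analysis.Complex_Analysis"
    "HOL-Algebra.Algebra"
begin

section \<open>The modular curve $X_0(N)$\<close>

definition SL2Z :: "(int ^ 2 ^ 2) set" where
  "SL2Z = {A. det A = 1}"

definition Gamma0 :: "nat \<Rightarrow> (int ^ 2 ^ 2) set" where
  "Gamma0 N = {A \<in> SL2Z. int N dvd A $ 2 $ 1}"

definition upper_half_plane :: "complex set" where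
  "upper_half_plane = {z. Im z > 0}"

definition mobius :: "int ^ 2 ^ 2 \<Rightarrow> complex \<Rightarrow> complex" where
  "mobius A z = (of_int (A $ 1 $ 1) * z + of_int (A $ 1 $ 2)) /
                (of_int (A $ 2 $ 1) * z + of_int (A $ 2 $ 2))"

text \<open>Points of the extended upper half-plane, i.e. of the union of the upper half-plane with
  the projective line over the rationals (\<open>Inner z\<close> is meaningful only for \<open>Im z > 0\<close>).\<close>

datatype ext_point = Inner complex | Rational rat | Infty

definition ext_upper_half_plane :: "ext_point set" where
  "ext_upper_half_plane = Inner ` upper_half_plane \<union> range Rational \<union> {Infty}"

fun act :: "int ^ 2 ^ 2 \<Rightarrow> ext_point \<Rightarrow> ext_point" where
  "act A (Inner z) = Inner (mobius A z)"
| "act A (Rational q) =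
     (if of_int (A $ 2 $ 1) * q + of_int (A $ 2 $ 2) = 0 then Infty
      else Rational ((of_int (A $ 1 $ 1) * q + of_int (A $ 1 $ 2)) /
                     (of_int (A $ 2 $ 1) * q + of_int (A $ 2 $ 2))))"
| "act A Infty =
     (if A $ 2 $ 1 = 0 then Infty
      else Rational (of_int (A $ 1 $ 1) / of_int (A $ 2 $ 1)))"

definition orbit0 :: "nat \<Rightarrow> ext_point \<Rightarrow> ext_point set" where
  "orbit0 N p = {act A p | A. A \<in> Gamma0 N}"

definition X0 :: "nat \<Rightarrow> ext_point set set" where
  "X0 N = orbit0 N ` ext_upper_half_plane"


section \<open>Modular functions and their divisors\<close>

text \<open>The ramification index over $X_0(N)$ of a point of the upper half-plane. Since $-1$ acts
  trivially, it is half the order of the stabiliser.\<close>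

definition ram_index :: "nat \<Rightarrow> complex \<Rightarrow> nat" where
  "ram_index N z = card {A \<in> Gamma0 N. mobius A z = z} div 2"

text \<open>The width of the cusp \<open>act A Infty\<close>: the least $h > 0$ such that $A T^h A^{-1}$
  lies in $\Gamma_0(N)$, where $T$ is the translation by $1$.\<close>

definition cusp_width :: "nat \<Rightarrow> int ^ 2 ^ 2 \<Rightarrow> nat" where
  "cusp_width N A = (LEAST h. h > 0 \<and>
     (\<exists>B \<in> Gamma0 N. B ** A = A ** vector [vector [1, int h], vector [0, 1]]))"

text \<open>The function $f$ in the local coordinate $q = e^{2 \pi i \tau / h}$ at the cusp
  \<open>act A Infty\<close>, i.e. $f(A \tau)$. For \<open>0 < norm q < 1\<close> and $f$ invariant under
  $\Gamma_0(N)$ the choice of the logarithm is irrelevant; the value at $0$ is junk, but is ignored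
  by \<open>meromorphic_on\<close> and \<open>zorder\<close>.\<close>

definition cusp_expansion :: "nat \<Rightarrow> (complex \<Rightarrow> complex) \<Rightarrow> int ^ 2 ^ 2 \<Rightarrow> complex \<Rightarrow> complex" where
  "cusp_expansion N f A q =
     f (mobius A (of_nat (cusp_width N A) * Ln q / (2 * of_real pi * \<i>)))"

text \<open>Nonzero meromorphic functions on $X_0(N)$. In accordance with \<open>meromorphic_on\<close>, values on
  a sparse set (in particular at poles) are immaterial for the divisor; being nonzero therefore
  means not vanishing off a sparse set.\<close>

definition modular_functions :: "nat \<Rightarrow> (complex \<Rightarrow> complex) set" where
  "modular_functions N = {f.
     f meromorphic_on upper_half_plane \<and>
     (\<forall>A \<in> Gamma0 N. \<forall>z \<in> upper_half_plane. f (mobius A z) = f z) \<and>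
     (\<forall>A \<in> SL2Z. cusp_expansion N f A meromorphic_on {0}) \<and>
     \<not> (\<forall>\<^sub>\<approx>z\<in>upper_half_plane. f z = 0)}"

type_synonym divisor = "ext_point set \<Rightarrow>\<^sub>0 int"

definition deg :: "divisor \<Rightarrow> int" where
  "deg D = (\<Sum>p \<in> Poly_Mapping.keys D. Poly_Mapping.lookup D p)"

text \<open>\<open>D\<close> is the divisor of \<open>f\<close>. As $z$ varies and \<open>A\<close> varies over $SL_2(\mathbf{Z})$, all points
  of $X_0(N)$ are covered.\<close>

definition is_divisor_of :: "nat \<Rightarrow> divisor \<Rightarrow> (complex \<Rightarrow> complex) \<Rightarrow> bool" where
  "is_divisor_of N D f \<longleftrightarrow>
     Poly_Mapping.keys D \<subseteq> X0 N \<and>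
     (\<forall>z \<in> upper_half_plane.
        int (ram_index N z) * Poly_Mapping.lookup D (orbit0 N (Inner z)) = zorder f z) \<and>
     (\<forall>A \<in> SL2Z.
        Poly_Mapping.lookup D (orbit0 N (act A Infty)) = zorder (cusp_expansion N f A) 0)"


section \<open>The Jacobian\<close>

definition Div0 :: "nat \<Rightarrow> divisor monoid" where
  "Div0 N = (free_Abelian_group (X0 N))
     \<lparr>carrier := {D \<in> carrier (free_Abelian_group (X0 N)). deg D = 0}\<rparr>"

text \<open>Divisors of nonzero meromorphic functions have degree $0$ anyway; the restriction to
  \<open>Div0\<close> excludes nothing and makes this a subset of its carrier by definition.\<close>

definition principal_divisors :: "nat \<Rightarrow> divisor set" where
  "principal_divisors N =
     {D \<in> carrier (Div0 N). \<exists>f \<in> modular_functions N. is_divisor_of N D f}"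

text \<open>The group of complex points of the Jacobian of $X_0(N)$, as $\mathrm{Pic}^0$. The group
  of its rational points is a subgroup.\<close>

definition J0 :: "nat \<Rightarrow> divisor set monoid" where
  "J0 N = Div0 N Mod principal_divisors N"

definition divisor_class :: "nat \<Rightarrow> divisor \<Rightarrow> divisor set" where
  "divisor_class N D = principal_divisors N #>\<^bsub>Div0 N\<^esub> D"


section \<open>Rational cuspidal divisors on $X_0(2^r)$\<close>

definition cusps_of_level :: "nat \<Rightarrow> nat \<Rightarrow> ext_point set set" where
  "cusps_of_level r k =
     {orbit0 (2 ^ r) (Rational (of_int x / 2 ^ k)) | x :: int. coprime x (2 ^ k)}"

definition level_divisor :: "nat \<Rightarrow> nat \<Rightarrow> divisor" where
  "level_divisor r k = (\<Sum>p \<in> cusps_of_level r k. frag_of p)"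

text \<open>The divisor with vector $(a_0, \dots, a_r)$.\<close>

definition cuspidal_divisor :: "nat \<Rightarrow> (nat \<Rightarrow> int) \<Rightarrow> divisor" where
  "cuspidal_divisor r a = (\<Sum>k\<le>r. frag_cmul (a k) (level_divisor r k))"

definition rational_cuspidal_divisors :: "nat \<Rightarrow> divisor set" where
  "rational_cuspidal_divisors r = range (cuspidal_divisor r)"

definition cuspidal_class_group :: "nat \<Rightarrow> divisor set monoid" where
  "cuspidal_class_group r = subgroup_generated (J0 (2 ^ r))
     (divisor_class (2 ^ r) ` {D \<in> rational_cuspidal_divisors r. deg D = 0})"

definition E_vec :: "nat \<Rightarrow> nat \<Rightarrow> nat \<Rightarrow> int" where
  "E_vec r g = (let \<mu> = min g (r - g) in
     (\<lambda>k. 0)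
       (0 := if odd g then 0 else 3 * 2 ^ (\<mu> - 2),
        1 := if odd g then 2 ^ (\<mu> - 1) else - (2 ^ (\<mu> - 2)),
        g := - 1))"

definition B2_vec :: "nat \<Rightarrow> nat \<Rightarrow> nat \<Rightarrow> int" where
  "B2_vec r f =
     (if f = r then (\<lambda>k. 0)(0 := 1, r := - 1)
      else if f = r - 1 then
        (if even r then (\<lambda>k. 0)(0 := 1, 1 := - 1)
         else (\<lambda>k. 0)(0 := - 1, 1 := - 1, r := 2))
      else if even (r - f) then E_vec r ((r + f - 2) div 2)
      else E_vec r ((r - f + 3) div 2))"

definition B2 :: "nat \<Rightarrow> nat \<Rightarrow> divisor" where
  "B2 r f = cuspidal_divisor r (B2_vec r f)"

end

theory Submission
  imports Defs "HOL-Number_Theory.Cong"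
begin

text \<open>By the maximum principle, a modular function whose divisor is supported at the cusps is,
  up to a constant, a product of powers of the functions \<open>\<eta>(2\<^sup>i\<^sup>+\<^sup>1 \<tau>) / \<eta>(2\<^sup>i \<tau>)\<close>. The inversion formula
  for theta functions determines the additive periods of the logarithm of \<open>\<eta>(2 \<tau>) / \<eta>(\<tau>)\<close> under
  \<open>\<Gamma>\<^sub>0(2)\<close>, and thereby the exponents for which such a product is invariant under \<open>\<Gamma>\<^sub>0(2\<^sup>r)\<close>.
  In terms of \<open>\<gamma>\<^sub>k = 8 a\<^sub>k / 2\<^sup>m\<close> with \<open>m = max k (r - k)\<close>, the divisor \<open>(a\<^sub>0, \<dots>, a\<^sub>r)\<close> of degree 0 is
  principal iff the numbers \<open>5 \<gamma>\<^sub>k - 2 \<gamma>\<^sub>k\<^sub>-\<^sub>1 - 2 \<gamma>\<^sub>k\<^sub>+\<^sub>1\<close> (suitably modified for \<open>k = r\<close>) are integers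
  and a weighted sum of the \<open>\<gamma>\<^sub>k\<close> is an even integer. Modulo the divisors of two eta quotients, the
  entries at the levels \<open>2\<^sup>2\<close> and \<open>2\<^sup>r\<^sup>-\<^sup>1\<close> vanish; the condition then decouples into separate conditions
  at the levels \<open>2\<^sup>g\<close> with \<open>3 \<le> g \<le> r - 2\<close>, each of which is the pivot of exactly one \<open>E_vec\<close>, and a
  condition on the remaining entries, which are covered by the last two generators.\<close>

section \<open>Inversion of theta functions\<close>

text \<open>The numbers 5, -2 and 8 come from inverting the matrix of orders. In units of 1/24 the
  order of \<open>\<eta>(2\<^sup>i \<tau>)\<close> at a cusp of level \<open>2\<^sup>k\<close> is
  \<open>2\<^sup>k \<cdot> 2\<^sup>-\<^sup>|\<^sup>i\<^sup>-\<^sup>k\<^sup>|\<close>, and the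
  inverse of \<open>(2\<^sup>-\<^sup>|\<^sup>i\<^sup>-\<^sup>k\<^sup>|)\<close> is tridiagonal with
  5/3 inside the diagonal and -2/3 beside it; 8 is 24/3. The main obstacle is the integrality of the
  exponents. Whether a product of rational powers is invariant depends on the exact periods, and a
  formula modulo 24 says nothing after multiplication by a rational number. Exact periods are
  accessible on parabolic elements and on products of these. Conjugation by a translation through
  1/2 sends suitable elements of \<open>\<Gamma>\<^sub>0(2)\<close> back into the group but
  exchanges its two cusps, and so changes exact periods in a controlled way; this separates the
  exponents. Since \<open>\<eta>(2\<tau>) / \<eta>(\<tau>)\<close> has weight 0, its logarithm
  changes by constants, and neither the multiplier of \<open>\<eta>\<close> nor the constant of the
  inversion formula has to be known. The maximum principle is applied on finitely many closed discs
  in the coordinates at the cusps, whose images cover the curve.\<close>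

definition qpoch :: "complex \<Rightarrow> complex \<Rightarrow> complex" where
  "qpoch a q = prodinf (\<lambda>n. 1 + a * q ^ n)"

lemma qpoch_has_prod:
  assumes "norm q < 1"
  shows "(\<lambda>n. 1 + a * q ^ n) has_prod qpoch a q"
proof -
  have "summable (\<lambda>n. norm (a * q ^ n))"
    unfolding norm_mult norm_power by (intro summable_mult summable_geometric) (use assms in auto)
  hence "abs_convergent_prod (\<lambda>n. 1 + a * q ^ n)"
    by (intro summable_imp_abs_convergent_prod) auto
  hence "convergent_prod (\<lambda>n. 1 + a * q ^ n)"
    by (rule abs_convergent_prod_imp_convergent_prod)
  thus ?thesis unfolding qpoch_def by (rule convergent_prod_has_prod)
qed

lemma qpoch_LIMSEQ:
  assumes "norm q < 1"
  shows "(\<lambda>N. \<Prod>n<N. 1 + a * q ^ n) \<longlonglongrightarrow> qpoch a q"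
proof -
  have "convergent_prod (\<lambda>n. 1 + a * q ^ n)"
    using qpoch_has_prod[OF assms] has_prod_iff by blast
  hence "(\<lambda>N. \<Prod>n\<le>N. 1 + a * q ^ n) \<longlonglongrightarrow> qpoch a q"
    unfolding qpoch_def by (rule convergent_prod_LIMSEQ)
  hence "(\<lambda>N. \<Prod>n<Suc N. 1 + a * q ^ n) \<longlonglongrightarrow> qpoch a q"
    by (simp only: lessThan_Suc_atMost)
  thus ?thesis by (subst filterlim_sequentially_Suc [symmetric])
qed

lemma qpoch_eq_0_iff:
  assumes "norm q < 1"
  shows "qpoch a q = 0 \<longleftrightarrow> (\<exists>n. 1 + a * q ^ n = 0)"
  using has_prod_eq_0_iff[OF qpoch_has_prod[OF assms, of a]] by (auto simp: image_iff eq_commute[of 0])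

lemma qpoch_unfold:
  assumes "norm q < 1"
  shows "qpoch a q = (1 + a) * qpoch (a * q) q"
proof (rule LIMSEQ_unique)
  show "(\<lambda>N. \<Prod>n<Suc N. 1 + a * q ^ n) \<longlonglongrightarrow> qpoch a q"
    by (subst filterlim_sequentially_Suc) (rule qpoch_LIMSEQ[OF assms])
  have "(\<Prod>n<Suc N. 1 + a * q ^ n) = (1 + a) * (\<Prod>n<N. 1 + a * q * q ^ n)" for N
    by (subst prod.lessThan_Suc_shift) (simp add: mult.assoc)
  moreover have "(\<lambda>N. (1 + a) * (\<Prod>n<N. 1 + a * q * q ^ n)) \<longlonglongrightarrow> (1 + a) * qpoch (a * q) q"
    by (intro tendsto_intros qpoch_LIMSEQ assms)
  ultimately show "(\<lambda>N. \<Prod>n<Suc N. 1 + a * q ^ n) \<longlonglongrightarrow> (1 + a) * qpoch (a * q) q"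
    by simp
qed

lemma norm_square_less_1: "norm (q::complex) < 1 \<Longrightarrow> norm (q\<^sup>2) < 1"
  by (simp add: norm_power abs_square_less_1)

lemma qpoch_even_odd:
  assumes "norm q < 1"
  shows "qpoch a (q\<^sup>2) * qpoch (a * q) (q\<^sup>2) = qpoch a q"
proof (rule LIMSEQ_unique)
  show "(\<lambda>N. (\<Prod>n<N. 1 + a * (q\<^sup>2) ^ n) * (\<Prod>n<N. 1 + a * q * (q\<^sup>2) ^ n))
          \<longlonglongrightarrow> qpoch a (q\<^sup>2) * qpoch (a * q) (q\<^sup>2)"
    by (intro tendsto_intros qpoch_LIMSEQ norm_square_less_1 assms)
  have "(\<Prod>n<N. 1 + a * (q\<^sup>2) ^ n) * (\<Prod>n<N. 1 + a * q * (q\<^sup>2) ^ n) = (\<Prod>n<2*N. 1 + a * q ^ n)" for N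
  proof (induction N)
    case (Suc N)
    have "(\<Prod>n<2 * Suc N. 1 + a * q ^ n) = (\<Prod>n<2 * N. 1 + a * q ^ n) * ((1 + a * q ^ (2*N)) * (1 + a * q ^ Suc (2*N)))"
      by (simp add: mult.assoc)
    moreover have "(q\<^sup>2) ^ N = q ^ (2 * N)" by (simp add: power_mult)
    ultimately show ?case using Suc by (simp add: mult_ac)
  qed simp
  moreover have "(\<lambda>N. \<Prod>n<2*N. 1 + a * q ^ n) \<longlonglongrightarrow> qpoch a q"
    by (rule filterlim_compose[OF qpoch_LIMSEQ[OF assms]], rule filterlim_subseq) (auto simp: strict_mono_def)
  ultimately show "(\<lambda>N. (\<Prod>n<N. 1 + a * (q\<^sup>2) ^ n) * (\<Prod>n<N. 1 + a * q * (q\<^sup>2) ^ n)) \<longlonglongrightarrow> qpoch a q"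
    by simp
qed

lemma qpoch_mult_minus:
  assumes "norm q < 1"
  shows "qpoch a q * qpoch (-a) q = qpoch (-(a\<^sup>2)) (q\<^sup>2)"
proof (rule LIMSEQ_unique)
  show "(\<lambda>N. (\<Prod>n<N. 1 + a * q ^ n) * (\<Prod>n<N. 1 + (-a) * q ^ n)) \<longlonglongrightarrow> qpoch a q * qpoch (-a) q"
    by (intro tendsto_intros qpoch_LIMSEQ assms)
  have "(\<Prod>n<N. 1 + a * q ^ n) * (\<Prod>n<N. 1 + (-a) * q ^ n) = (\<Prod>n<N. 1 + (-(a\<^sup>2)) * (q\<^sup>2) ^ n)" for N
    unfolding prod.distrib[symmetric]
    by (intro prod.cong refl) (simp add: power_mult[symmetric] power2_eq_square algebra_simps mult_2 power_add)
  moreover have "(\<lambda>N. \<Prod>n<N. 1 + (-(a\<^sup>2)) * (q\<^sup>2) ^ n) \<longlonglongrightarrow> qpoch (-(a\<^sup>2)) (q\<^sup>2)"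
    by (intro qpoch_LIMSEQ norm_square_less_1 assms)
  ultimately show "(\<lambda>N. (\<Prod>n<N. 1 + a * q ^ n) * (\<Prod>n<N. 1 + (-a) * q ^ n)) \<longlonglongrightarrow> qpoch (-(a\<^sup>2)) (q\<^sup>2)"
    by simp
qed

lemma qpoch_ne_0:
  assumes "norm q < 1" "norm a < 1"
  shows "qpoch a q \<noteq> 0"
proof
  assume "qpoch a q = 0"
  then obtain n where "1 + a * q ^ n = 0"
    using qpoch_eq_0_iff[OF assms(1)] by blast
  hence "a * q ^ n = -1" by (simp add: add_eq_0_iff)
  hence "norm (a * q ^ n) = 1" by simp
  moreover have "norm (a * q ^ n) \<le> norm a * 1"
    unfolding norm_mult norm_power using assms by (intro mult_left_mono power_le_one) auto
  ultimately show False using assms by simp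
qed

text \<open>Euler's identity: the product of the \<open>1 + p^n\<close> is inverse to the product of
  the \<open>1 - p^n\<close> with n odd. Splitting the product of all \<open>1 - p^n\<close> by the
  parity of n, and pairing \<open>1 + p^n\<close> with \<open>1 - p^n\<close>, both lead to the
  product of the \<open>1 - p^(2n)\<close>, which is nonzero and cancels.\<close>

lemma qpoch_euler:
  assumes "norm p < 1"
  shows "qpoch p p * qpoch (-p) (p\<^sup>2) = 1"
proof -
  have "qpoch (-p) (p\<^sup>2) * qpoch (-(p\<^sup>2)) (p\<^sup>2) = qpoch (-p) p"
    using qpoch_even_odd[OF assms, of "-p"] by (simp add: power2_eq_square)
  moreover have "qpoch p p * qpoch (-p) p = qpoch (-(p\<^sup>2)) (p\<^sup>2)"
    by (rule qpoch_mult_minus[OF assms])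
  moreover have "qpoch (-(p\<^sup>2)) (p\<^sup>2) \<noteq> 0"
    using norm_square_less_1[OF assms] by (intro qpoch_ne_0) auto
  ultimately show ?thesis by (metis mult.assoc mult.commute mult_cancel_right2)
qed

text \<open>On a closed disc inside \<open>S\<close> compactness bounds \<open>norm (g z)\<close> by
  some \<rho> < 1 and \<open>norm (f z)\<close> by some C, so the partial products converge
  uniformly by the M-test with terms \<open>C * \<rho> ^ n\<close>.\<close>

lemma holomorphic_qpoch:
  assumes "open S" "f holomorphic_on S" "g holomorphic_on S" "\<And>z. z \<in> S \<Longrightarrow> norm (g z) < 1"
  shows "(\<lambda>z. qpoch (f z) (g z)) holomorphic_on S"
proof (rule holomorphic_uniform_sequence[where f = "\<lambda>N z. \<Prod>n<N. 1 + f z * g z ^ n"])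
  show "open S" by fact
  show "(\<lambda>z. \<Prod>n<N. 1 + f z * g z ^ n) holomorphic_on S" for N
    using assms by (intro holomorphic_intros)
  fix x assume "x \<in> S"
  then obtain d where d: "d > 0" "cball x d \<subseteq> S"
    using \<open>open S\<close> open_contains_cball by blast
  have cf: "continuous_on (cball x d) f" "continuous_on (cball x d) g"
    using assms d holomorphic_on_imp_continuous_on holomorphic_on_subset by blast+
  have "compact ((\<lambda>z. norm (g z)) ` cball x d)"
    by (intro compact_continuous_image continuous_intros cf compact_cball)
  then obtain z0 where z0: "z0 \<in> cball x d" "\<And>z. z \<in> cball x d \<Longrightarrow> norm (g z) \<le> norm (g z0)"
    using continuous_attains_sup[OF compact_cball _ continuous_on_norm[OF cf(2)]] d
    by (metis cball_eq_empty not_less_iff_gr_or_eq)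
  define \<rho> where "\<rho> = norm (g z0)"
  have \<rho>: "0 \<le> \<rho>" "\<rho> < 1" using z0 d assms by (auto simp: \<rho>_def)
  have "bounded (f ` cball x d)"
    by (intro compact_imp_bounded compact_continuous_image cf compact_cball)
  then obtain C where C: "\<And>z. z \<in> cball x d \<Longrightarrow> norm (f z) \<le> C"
    unfolding bounded_iff by blast
  have "uniformly_convergent_on (cball x d) (\<lambda>N z. \<Prod>n<N. 1 + f z * g z ^ n)"
  proof (rule uniformly_convergent_on_prod)
    show "uniformly_convergent_on (cball x d) (\<lambda>N z. \<Sum>n<N. norm (f z * g z ^ n))"
    proof (rule Weierstrass_m_test')
      fix n z assume z: "z \<in> cball x d"
      show "norm (norm (f z * g z ^ n)) \<le> C * \<rho> ^ n"
        using C[OF z] z0(2)[OF z] by (auto simp: norm_mult norm_power \<rho>_def intro!: mult_mono power_mono order.trans[OF norm_ge_zero C[OF z]])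
    next
      show "summable (\<lambda>n. C * \<rho> ^ n)" using \<rho> by (intro summable_mult summable_geometric) auto
    qed
  qed (use cf in \<open>auto intro!: continuous_intros\<close>)
  then obtain h where h: "uniform_limit (cball x d) (\<lambda>N z. \<Prod>n<N. 1 + f z * g z ^ n) h sequentially"
    unfolding uniformly_convergent_on_def by blast
  have "h z = qpoch (f z) (g z)" if "z \<in> cball x d" for z
  proof (rule LIMSEQ_unique)
    show "(\<lambda>N. \<Prod>n<N. 1 + f z * g z ^ n) \<longlonglongrightarrow> h z" by (rule tendsto_uniform_limitI[OF h that])
    show "(\<lambda>N. \<Prod>n<N. 1 + f z * g z ^ n) \<longlonglongrightarrow> qpoch (f z) (g z)"
      using that d assms by (intro qpoch_LIMSEQ) auto
  qed
  hence "uniform_limit (cball x d) (\<lambda>N z. \<Prod>n<N. 1 + f z * g z ^ n) (\<lambda>z. qpoch (f z) (g z)) sequentially"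
    using h by (subst uniform_limit_cong'[where g = "\<lambda>N z. \<Prod>n<N. 1 + f z * g z ^ n" and i = h]) auto
  thus "\<exists>d>0. cball x d \<subseteq> S \<and> uniform_limit (cball x d) (\<lambda>N z. \<Prod>n<N. 1 + f z * g z ^ n) (\<lambda>z. qpoch (f z) (g z)) sequentially"
    using d by blast
qed

section \<open>The theta function as an infinite product\<close>

definition ee :: "complex \<Rightarrow> complex" where
  "ee z = exp (2 * of_real pi * \<i> * z)"

lemma ee_add: "ee (z + w) = ee z * ee w"
  by (simp add: ee_def exp_add[symmetric] algebra_simps)

lemma ee_0 [simp]: "ee 0 = 1" by (simp add: ee_def)

lemma ee_nonzero [simp]: "ee z \<noteq> 0" by (simp add: ee_def)

lemma ee_minus: "ee (-z) = inverse (ee z)"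
  by (simp add: ee_def exp_minus)

lemma ee_diff: "ee (z - w) = ee z / ee w"
  using ee_add[of z "-w"] by (simp add: ee_minus divide_inverse)

lemma ee_of_nat: "ee (of_nat n * z) = ee z ^ n"
  by (simp add: ee_def exp_of_nat_mult[symmetric] algebra_simps)

lemma ee_eq_1_iff: "ee z = 1 \<longleftrightarrow> z \<in> \<int>"
proof
  assume "ee z = 1"
  then obtain n :: int where n: "Re (2 * of_real pi * \<i> * z) = 0" "Im (2 * of_real pi * \<i> * z) = of_int (2 * n) * pi"
    unfolding ee_def exp_eq_1 by blast
  hence "z = of_int n" by (auto simp: complex_eq_iff)
  thus "z \<in> \<int>" by simp
next
  assume "z \<in> \<int>"
  then obtain n :: int where "z = of_int n" by (auto elim: Ints_cases)
  thus "ee z = 1" unfolding ee_def exp_eq_1 by (auto intro!: exI[of _ n])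
qed

lemma ee_of_int [simp]: "ee (of_int n) = 1"
  by (simp add: ee_eq_1_iff)

lemma ee_1 [simp]: "ee 1 = 1"
  using ee_of_int[of 1] by simp

lemma ee_half: "ee (1/2) = -1" "ee (-(1/2)) = -1"
proof -
  show "ee (1/2) = -1" unfolding ee_def by simp
  thus "ee (-(1/2)) = -1" by (simp only: ee_minus) simp
qed

lemma norm_ee: "norm (ee z) = exp (-(2 * pi * Im z))"
  by (simp add: ee_def)

lemma norm_ee_less_1: "Im z > 0 \<Longrightarrow> norm (ee z) < 1"
  by (simp add: norm_ee)

lemma holomorphic_ee [holomorphic_intros]: "f holomorphic_on A \<Longrightarrow> (\<lambda>z. ee (f z)) holomorphic_on A"
  unfolding ee_def by (intro holomorphic_intros)

text \<open>Jacobi's theta function in product form, without the exponential prefactor and without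
  the product of the \<open>1 - ee (n * t)\<close>. Both only affect the constant and the
  exponential in the inversion formula.\<close>

definition jtheta :: "complex \<Rightarrow> complex \<Rightarrow> complex" where
  "jtheta z t = qpoch (- ee z) (ee t) * qpoch (- ee (t - z)) (ee t)"

lemma jtheta_plus_1: "jtheta (z + 1) t = jtheta z t"
  by (simp add: jtheta_def ee_add ee_diff)

text \<open>What remains of \<open>jtheta\<close> after the factor \<open>1 - ee z\<close>, which
  carries the simple zero at the origin.\<close>

definition jtheta_reg :: "complex \<Rightarrow> complex \<Rightarrow> complex" where
  "jtheta_reg z t = qpoch (- ee (z + t)) (ee t) * qpoch (- ee (t - z)) (ee t)"

lemma jtheta_split:
  assumes "Im t > 0"
  shows "jtheta z t = (1 - ee z) * jtheta_reg z t"
  unfolding jtheta_def jtheta_reg_def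
  by (subst qpoch_unfold) (simp_all add: norm_ee_less_1 assms ee_add)

lemma jtheta_plus_t:
  assumes "Im t > 0"
  shows "jtheta (z + t) t = - ee (-z) * jtheta z t"
proof -
  note q = norm_ee_less_1[OF assms]
  have 1: "qpoch (- ee (-z)) (ee t) = (1 - ee (-z)) * qpoch (- ee (t - z)) (ee t)"
    by (subst qpoch_unfold[OF q]) (simp add: ee_minus ee_diff field_simps)
  have 2: "jtheta (z + t) t = qpoch (- ee (z + t)) (ee t) * qpoch (- ee (-z)) (ee t)"
    by (simp add: jtheta_def)
  also have "\<dots> = (1 - ee (-z)) * jtheta_reg z t"
    unfolding 1 jtheta_reg_def by simp
  also have "1 - ee (-z) = - ee (-z) * (1 - ee z)"
    by (simp add: ee_minus field_simps)
  finally show ?thesis by (simp add: jtheta_split[OF assms])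
qed

lemma jtheta_eq_0_iff:
  assumes "Im t > 0"
  shows "jtheta z t = 0 \<longleftrightarrow> (\<exists>m n :: int. z = of_int m + of_int n * t)"
proof
  note q = norm_ee_less_1[OF assms]
  assume "jtheta z t = 0"
  then consider n where "1 - ee z * ee t ^ n = 0" | n where "1 - ee (t - z) * ee t ^ n = 0"
    unfolding jtheta_def by (auto simp: qpoch_eq_0_iff[OF q])
  thus "\<exists>m n :: int. z = of_int m + of_int n * t"
  proof cases
    case (1 n)
    hence "ee (z + of_nat n * t) = 1" by (simp add: ee_add ee_of_nat)
    then obtain m :: int where "z + of_nat n * t = of_int m"
      unfolding ee_eq_1_iff by (auto elim: Ints_cases)
    hence "z = of_int m + of_int (- int n) * t" by (simp add: algebra_simps)
    thus ?thesis by blast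
  next
    case (2 n)
    hence "ee (t - z + of_nat n * t) = 1" by (subst ee_add) (simp add: ee_of_nat)
    then obtain m :: int where "t - z + of_nat n * t = of_int m"
      unfolding ee_eq_1_iff by (auto elim: Ints_cases)
    hence "z = of_int (-m) + of_int (int n + 1) * t" by (simp add: algebra_simps)
    thus ?thesis by blast
  qed
next
  assume "\<exists>m n :: int. z = of_int m + of_int n * t"
  then obtain m n :: int where z: "z = of_int m + of_int n * t" by blast
  have *: "jtheta (w + t) t = 0 \<longleftrightarrow> jtheta w t = 0" for w
    by (simp add: jtheta_plus_t[OF assms])
  have "jtheta (of_int m + of_int n * t) t = 0"
  proof (induction n rule: int_induct[where k = 0])
    case base
    show ?case by (simp add: jtheta_split[OF assms])
  next
    case (step1 i)
    thus ?case using *[of "of_int m + of_int i * t"] by (simp add: algebra_simps)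
  next
    case (step2 i)
    thus ?case using *[of "of_int m + of_int (i - 1) * t"] by (simp add: algebra_simps)
  qed
  thus "jtheta z t = 0" by (simp add: z)
qed

lemma holomorphic_jtheta:
  assumes "Im t > 0" "f holomorphic_on S" "open S"
  shows "(\<lambda>z. jtheta (f z) t) holomorphic_on S"
  unfolding jtheta_def using assms norm_ee_less_1[OF assms(1)]
  by (intro holomorphic_intros holomorphic_qpoch) auto

lemma holomorphic_jtheta_reg:
  assumes "Im t > 0" "f holomorphic_on S" "open S"
  shows "(\<lambda>z. jtheta_reg (f z) t) holomorphic_on S"
  unfolding jtheta_reg_def using assms norm_ee_less_1[OF assms(1)]
  by (intro holomorphic_intros holomorphic_qpoch) auto

lemma jtheta_reg_0:
  assumes "Im t > 0"
  shows "jtheta_reg 0 t \<noteq> 0"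
  unfolding jtheta_reg_def using norm_ee_less_1[OF assms] by (simp add: qpoch_ne_0)

lemma lattice_coords:
  assumes "Im t > 0"
  obtains m n :: int and x y :: real where "z = of_int m + of_int n * t + (of_real x + of_real y * t)"
    "x \<in> {0..1}" "y \<in> {0..1}"
proof -
  define v where "v = Im z / Im t"
  define u where "u = Re z - v * Re t"
  have z: "z = of_real u + of_real v * t"
    using assms by (simp add: complex_eq_iff u_def v_def)
  have "z = of_int \<lfloor>u\<rfloor> + of_int \<lfloor>v\<rfloor> * t + (of_real (frac u) + of_real (frac v) * t)"
    unfolding z frac_def by (simp add: algebra_simps)
  thus ?thesis by (rule that) (auto simp: frac_ge_0 frac_lt_1 less_imp_le)
qed

text \<open>Under translation by t and by -1 both sides acquire the same factors, and both have
  simple zeros at the lattice points, so their quotient extends to an entire doubly periodic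
  function and is constant by Liouville. The constant may depend on t and is left undetermined;
  \<open>exp_lweber_fricke\<close> eliminates it.\<close>

lemma jtheta_inversion:
  assumes t: "Im t > 0"
  obtains C where "\<And>z. jtheta z t \<noteq> 0 \<Longrightarrow>
    jtheta (z / t) (-1/t) = C * (exp (pi * \<i> * (z\<^sup>2 / t + z / t - z)) * jtheta z t)"
proof -
  have t0: "t \<noteq> 0" using t by auto
  have t': "Im (-1/t) > 0" using t by (simp add: Im_divide field_simps sum_power2_gt_zero_iff)
  \<comment> \<open>The quadratic exponent is chosen such that translation by t cancels the factor
    of \<open>jtheta z t\<close>, while translation by -1 reproduces the factor of
    \<open>jtheta (z / t) (-1/t)\<close>.\<close>
  define E where "E = (\<lambda>z. exp (pi * \<i> * (z\<^sup>2 / t + z / t - z)))"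
  define num where "num = (\<lambda>z. jtheta (z / t) (-1/t))"
  define den where "den = (\<lambda>z. E z * jtheta z t)"
  have E0 [simp]: "E z \<noteq> 0" for z by (simp add: E_def)
  have em1: "exp (pi * \<i>) = -1" by simp
  have Et: "E (z + t) = E z * (- ee z)" for z
  proof -
    have "pi * \<i> * ((z + t)\<^sup>2 / t + (z + t) / t - (z + t)) = pi * \<i> * (z\<^sup>2 / t + z / t - z) + (2 * pi * \<i> * z) + pi * \<i>"
      using t0 by (simp add: field_simps power2_eq_square)
    thus ?thesis unfolding E_def ee_def by (simp only: exp_add em1) simp
  qed
  have E1: "E (z - 1) = E z * (- ee (-z / t))" for z
  proof -
    have "pi * \<i> * ((z - 1)\<^sup>2 / t + (z - 1) / t - (z - 1)) = pi * \<i> * (z\<^sup>2 / t + z / t - z) + (2 * pi * \<i> * (-z/t)) + pi * \<i>"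
      using t0 by (simp add: field_simps power2_eq_square)
    thus ?thesis unfolding E_def ee_def by (simp only: exp_add em1) simp
  qed
  have numt: "num (z + t) = num z" for z
    using jtheta_plus_1[of "z/t" "-1/t"] t0 by (simp add: num_def add_divide_distrib)
  have num1: "num (z - 1) = - ee (-z/t) * num z" for z
    using jtheta_plus_t[OF t', of "z/t"] t0 by (simp add: num_def diff_divide_distrib)
  have dent: "den (z + t) = den z" for z
    by (simp add: den_def Et jtheta_plus_t[OF t] ee_minus)
  have den1: "den (z - 1) = - ee (-z/t) * den z" for z
    using jtheta_plus_1[of "z - 1" t] by (simp add: den_def E1)
  define G where "G = (\<lambda>z. num z / den z)"
  have Gt: "G (z + t) = G z" for z by (simp add: G_def numt dent)
  have G1: "G (z - 1) = G z" for z by (simp add: G_def num1 den1)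
  define \<Lambda> where "\<Lambda> = {z. jtheta z t = 0}"
  have \<Lambda>_iff: "z \<in> \<Lambda> \<longleftrightarrow> (\<exists>m n :: int. z = of_int m + of_int n * t)" for z
    unfolding \<Lambda>_def using jtheta_eq_0_iff[OF t] by simp
  have cont_jt: "continuous_on UNIV (\<lambda>z. jtheta z t)"
    by (intro holomorphic_on_imp_continuous_on holomorphic_jtheta t holomorphic_intros) auto
  have op: "open (- \<Lambda>)"
    unfolding \<Lambda>_def Collect_neg_eq[symmetric] by (intro open_Collect_neq cont_jt continuous_intros)
  have holG: "G holomorphic_on - \<Lambda>"
    unfolding G_def num_def den_def E_def using t0
    by (intro holomorphic_intros holomorphic_jtheta t' t op) (auto simp: \<Lambda>_def)
  define k where "k = (\<lambda>z. jtheta_reg (z / t) (-1/t) / (E z * jtheta_reg z t))"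
  define L where "L = (1/t) * k 0"
  have Gk: "G z = (1 - ee (z/t)) / (1 - ee z) * k z" for z
    unfolding G_def num_def den_def jtheta_split[OF t'] jtheta_split[OF t] k_def by simp
  have contreg: "continuous_on UNIV (\<lambda>z. jtheta_reg z t)"
    by (intro holomorphic_on_imp_continuous_on holomorphic_jtheta_reg t holomorphic_intros) auto
  have contreg': "continuous_on UNIV (\<lambda>z. jtheta_reg (z/t) (-1/t))"
    using t0 by (intro holomorphic_on_imp_continuous_on holomorphic_jtheta_reg t' holomorphic_intros) auto
  have "isCont k 0"
    unfolding k_def E_def using contreg contreg' jtheta_reg_0[OF t] t0
    by (intro continuous_intros) (auto simp: continuous_on_eq_continuous_at)
  hence k0: "(k \<longlongrightarrow> k 0) (at 0)" by (simp add: isCont_def)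
  have deriv: "((\<lambda>z. (1 - ee (c * z)) / z) \<longlongrightarrow> - (2 * pi * \<i> * c)) (at 0)" for c
  proof -
    have "((\<lambda>z. 1 - ee (c * z)) has_field_derivative - (2 * pi * \<i> * c)) (at 0)"
      unfolding ee_def by (auto intro!: derivative_eq_intros)
    thus ?thesis by (simp add: has_field_derivative_iff)
  qed
  \<comment> \<open>The two vanishing factors are divided by z, which turns the quotient at the
    origin into a quotient of derivatives, namely 1/t.\<close>
  have "((\<lambda>z. ((1 - ee (1/t * z)) / z) / ((1 - ee (1 * z)) / z) * k z) \<longlongrightarrow> (- (2 * pi * \<i> * (1/t)) / (- (2 * pi * \<i> * 1))) * k 0) (at 0)"
    by (intro tendsto_intros deriv k0) auto
  moreover have "eventually (\<lambda>z. ((1 - ee (1/t * z)) / z) / ((1 - ee (1 * z)) / z) * k z = G z) (at 0)"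
    unfolding eventually_at_filter by (auto simp: Gk)
  ultimately have "(G \<longlongrightarrow> (- (2 * pi * \<i> * (1/t)) / (- (2 * pi * \<i> * 1))) * k 0) (at 0)"
    by (rule Lim_transform_eventually)
  hence Glim: "(G \<longlongrightarrow> L) (at 0)" by (simp add: L_def)
  define F where "F = (\<lambda>z. if z \<in> \<Lambda> then L else G z)"
  have Lt: "z + t \<in> \<Lambda> \<longleftrightarrow> z \<in> \<Lambda>" for z unfolding \<Lambda>_def by (simp add: jtheta_plus_t[OF t])
  have L1: "z - 1 \<in> \<Lambda> \<longleftrightarrow> z \<in> \<Lambda>" for z unfolding \<Lambda>_def using jtheta_plus_1[of "z-1" t] by simp
  have Ft: "F (z + t) = F z" for z by (simp add: F_def Lt Gt)
  have F1: "F (z - 1) = F z" for z by (simp add: F_def L1 G1)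
  have Fn: "F (z + of_int n * t) = F z" for z n
  proof (induction n rule: int_induct[where k = 0])
    case (step1 i) thus ?case using Ft[of "z + of_int i * t"] by (simp add: algebra_simps)
  next
    case (step2 i) thus ?case using Ft[of "z + of_int (i-1) * t"] by (simp add: algebra_simps)
  qed simp
  have Fm: "F (z + of_int m) = F z" for z m
  proof (induction m rule: int_induct[where k = 0])
    case (step1 i) thus ?case using F1[of "z + of_int (i+1)"] by (simp add: algebra_simps)
  next
    case (step2 i) thus ?case using F1[of "z + of_int i"] by (simp add: algebra_simps)
  qed simp
  have Fmn: "F (of_int m + of_int n * t + z) = F z" for z m n
    using Fm[of "z + of_int n * t" m] Fn[of z n] by (simp add: algebra_simps)
  have holF: "F holomorphic_on - \<Lambda>"
    using holG by (rule holomorphic_transform) (auto simp: F_def)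
  have "open {z. jtheta_reg z t \<noteq> 0}" by (intro open_Collect_neq contreg continuous_intros)
  then obtain e where e: "e > 0" "\<And>z. z \<in> ball 0 e \<Longrightarrow> jtheta_reg z t \<noteq> 0"
    using jtheta_reg_0[OF t] by (metis (mono_tags, lifting) mem_Collect_eq openE subset_eq)
  define d where "d = min e 1"
  have d: "d > 0" using e by (simp add: d_def)
  have zd: "z \<notin> \<Lambda>" if "z \<in> ball 0 d" "z \<noteq> 0" for z
  proof
    assume "z \<in> \<Lambda>"
    hence "ee z = 1" using jtheta_split[OF t, of z] e(2)[of z] that by (auto simp: \<Lambda>_def d_def)
    then obtain n :: int where "z = of_int n" unfolding ee_eq_1_iff by (auto elim: Ints_cases)
    thus False using that by (auto simp: d_def)
  qed
  have 0: "0 \<in> \<Lambda>" unfolding \<Lambda>_iff by (intro exI[of _ 0]) simp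
  \<comment> \<open>Only the singularity at 0 is removed by hand; periodicity carries the result to
    every other lattice point.\<close>
  have hol0: "F holomorphic_on ball 0 d"
  proof (rule no_isolated_singularity[where K = "{0}"])
    have "F \<midarrow>0\<rightarrow> L"
    proof (rule Lim_transform_eventually[OF Glim])
      have "eventually (\<lambda>z. z \<in> ball 0 d - {0}) (at 0)"
        using eventually_at_ball'[OF d, of 0 UNIV] by eventually_elim auto
      thus "eventually (\<lambda>z. G z = F z) (at 0)"
        by eventually_elim (simp add: F_def zd)
    qed
    hence "isCont F 0" using 0 by (simp add: isCont_def F_def)
    moreover have "isCont F z" if "z \<in> ball 0 d - {0}" for z
    proof -
      have "z \<in> - \<Lambda>" using zd[of z] that by blast
      thus ?thesis using holomorphic_on_imp_continuous_on[OF holF] unfolding continuous_on_eq_continuous_at[OF op] by blast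
    qed
    ultimately show "continuous_on (ball 0 d) F"
      by (intro continuous_at_imp_continuous_on) blast
    show "F holomorphic_on ball 0 d - {0}"
      by (rule holomorphic_on_subset[OF holF]) (use zd in auto)
  qed auto
  have "F holomorphic_on UNIV"
  proof -
    have "F field_differentiable at z" for z
    proof (cases "z \<in> \<Lambda>")
      case False
      hence "z \<in> - \<Lambda>" by simp
      thus ?thesis by (rule holomorphic_on_imp_differentiable_at[OF holF op])
    next
      case True
      then obtain m n :: int where z: "z = of_int m + of_int n * t" unfolding \<Lambda>_iff by blast
      have "F w = F (w - z)" for w using Fmn[of m n "w - z"] by (simp add: z)
      hence "F = F \<circ> (\<lambda>w. w - z)" by auto
      moreover have "(F \<circ> (\<lambda>w. w - z)) field_differentiable at z"
      proof (rule field_differentiable_compose)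
        show "(\<lambda>w. w - z) field_differentiable at z" by (auto intro!: derivative_intros)
        have "F field_differentiable at 0"
          by (rule holomorphic_on_imp_differentiable_at[OF hol0]) (use d in auto)
        thus "F field_differentiable at (z - z)" by simp
      qed
      ultimately show ?thesis by simp
    qed
    thus ?thesis by (simp add: holomorphic_on_def field_differentiable_at_within)
  qed
  moreover have "bounded (range F)"
  proof -
    define Q where "Q = (\<lambda>(x, y). of_real x + of_real y * t) ` ({0..1} \<times> {0..1::real})"
    have "compact Q" unfolding Q_def
      by (intro compact_continuous_image compact_Times) (auto intro!: continuous_intros simp: split_def)
    moreover have "continuous_on Q F"
      by (rule holomorphic_on_imp_continuous_on, rule holomorphic_on_subset[OF \<open>F holomorphic_on UNIV\<close>]) simp
    ultimately have "compact (F ` Q)" by (intro compact_continuous_image)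
    moreover have "F z \<in> F ` Q" for z
    proof -
      obtain m n x y where "z = of_int m + of_int n * t + (of_real x + of_real y * t)" "x \<in> {0..1}" "y \<in> {0..1::real}"
        using lattice_coords[OF t] by metis
      hence "F z = F (of_real x + of_real y * t)" using Fmn[of m n "of_real x + of_real y * t"] by simp
      moreover have "of_real x + of_real y * t \<in> Q" unfolding Q_def
        using \<open>x \<in> _\<close> \<open>y \<in> _\<close> by (intro image_eqI[of _ _ "(x, y)"]) auto
      ultimately show ?thesis by simp
    qed
    ultimately show ?thesis by (intro bounded_subset[OF compact_imp_bounded]) auto
  qed
  ultimately obtain C where C: "\<And>z. F z = C"
    using Liouville_theorem[of F] unfolding constant_on_def by blast
  have "jtheta (z / t) (-1/t) = C * (exp (pi * \<i> * (z\<^sup>2 / t + z / t - z)) * jtheta z t)" if "jtheta z t \<noteq> 0" for z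
    using C[of z] that by (simp add: F_def \<Lambda>_def G_def num_def den_def E_def field_simps)
  thus ?thesis by (rule that)
qed

lemma UHP_iff [simp]: "z \<in> upper_half_plane \<longleftrightarrow> Im z > 0"
  by (simp add: upper_half_plane_def)

lemma convex_UHP: "convex upper_half_plane"
  unfolding upper_half_plane_def by (rule convex_halfspace_Im_gt)

lemma open_UHP: "open upper_half_plane"
  unfolding upper_half_plane_def by (rule open_halfspace_Im_gt)

lemma connected_UHP: "connected upper_half_plane"
  using convex_UHP convex_connected by blast

section \<open>A logarithm of the product of the \<open>1 + q^n\<close> on the unit disc\<close>

lemma log_qpoch_exists:
  "\<exists>l. l holomorphic_on ball 0 1 \<and> (\<forall>q\<in>ball 0 1. exp (l q) = qpoch q q) \<and> l 0 = 0"
proof -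
  have "(\<lambda>q. qpoch q q) holomorphic_on ball 0 1"
    by (intro holomorphic_qpoch holomorphic_intros) auto
  moreover have "\<forall>q\<in>ball 0 1. qpoch q q \<noteq> 0" by (simp add: qpoch_ne_0)
  moreover have "simply_connected (ball (0::complex) 1)"
    by (intro convex_imp_simply_connected convex_ball)
  ultimately obtain g where g: "g holomorphic_on ball 0 1" "\<And>q. q \<in> ball 0 1 \<Longrightarrow> qpoch q q = exp (g q)"
    using simply_connected_eq_holomorphic_log[OF open_ball, of "0::complex" 1] by blast
  have "exp (g 0) = 1" using g(2)[of 0] by (simp add: qpoch_def)
  thus ?thesis using g by (intro exI[of _ "\<lambda>q. g q - g 0"]) (auto intro!: holomorphic_intros simp: exp_diff)
qed

text \<open>The normalisation at q = 0 makes \<open>lweber t - pi * \<i> * t / 12\<close> tend to 0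
  at the cusp at infinity, rather than to some multiple of \<open>2 * pi * \<i>\<close>.\<close>

definition log_qpoch :: "complex \<Rightarrow> complex" where
  "log_qpoch = (SOME l. l holomorphic_on ball 0 1 \<and> (\<forall>q\<in>ball 0 1. exp (l q) = qpoch q q) \<and> l 0 = 0)"

lemma log_qpoch:
  "log_qpoch holomorphic_on ball 0 1" "norm q < 1 \<Longrightarrow> exp (log_qpoch q) = qpoch q q" "log_qpoch 0 = 0"
  using someI_ex[OF log_qpoch_exists] unfolding log_qpoch_def by auto

section \<open>The logarithm of \<open>\<eta>(2 \<tau>) / \<eta>(\<tau>)\<close> and its periods\<close>

text \<open>A logarithm of the quotient of Dedekind eta functions \<open>\<eta>(2\<tau>) / \<eta>(\<tau>)\<close>.\<close>

definition lweber :: "complex \<Rightarrow> complex" where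
  "lweber t = pi * \<i> * t / 12 + log_qpoch (ee t)"

lemma exp_lweber: "Im t > 0 \<Longrightarrow> exp (lweber t) = exp (pi * \<i> * t / 12) * qpoch (ee t) (ee t)"
  by (simp add: lweber_def exp_add log_qpoch norm_ee_less_1)

lemma holomorphic_lweber:
  assumes "f holomorphic_on S" "\<And>z. z \<in> S \<Longrightarrow> Im (f z) > 0"
  shows "(\<lambda>z. lweber (f z)) holomorphic_on S"
proof -
  have "(log_qpoch \<circ> (\<lambda>z. ee (f z))) holomorphic_on S"
    using assms norm_ee_less_1 by (intro holomorphic_on_compose_gen[OF _ log_qpoch(1)] holomorphic_intros) auto
  thus ?thesis unfolding lweber_def o_def using assms by (intro holomorphic_intros) auto
qed

lemma lweber_plus_1: "lweber (t + 1) = lweber t + pi * \<i> / 12"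
  by (simp add: lweber_def ee_add field_simps)

lemma lweber_asymp: "((\<lambda>t. lweber t - pi * \<i> * t / 12) \<longlongrightarrow> 0) (filtercomap Im at_top)"
proof -
  have "((\<lambda>t. exp (-(2 * pi * Im t))) \<longlongrightarrow> 0) (filtercomap Im at_top)"
  proof (rule filterlim_compose[of "\<lambda>x. exp (-(2 * pi * x))" _ _ Im])
    show "filterlim Im at_top (filtercomap Im at_top)" by (rule filterlim_filtercomap)
    show "((\<lambda>x. exp (-(2 * pi * x))) \<longlongrightarrow> 0) at_top" by real_asymp
  qed
  hence "(ee \<longlongrightarrow> 0) (filtercomap Im at_top)"
    by (subst tendsto_norm_zero_iff[symmetric]) (simp add: norm_ee)
  moreover have "isCont log_qpoch 0"
    using holomorphic_on_imp_continuous_on[OF log_qpoch(1)] by (simp add: continuous_on_eq_continuous_at)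
  ultimately have "((\<lambda>t. log_qpoch (ee t)) \<longlongrightarrow> log_qpoch 0) (filtercomap Im at_top)"
    by (intro isCont_tendsto_compose[of 0 log_qpoch])
  thus ?thesis by (simp add: lweber_def log_qpoch)
qed

lemma Im_minus_inverse_pos: "Im t > 0 \<Longrightarrow> Im (-1/t) > 0"
  by (simp add: Im_divide field_simps sum_power2_gt_zero_iff)

lemma ee_double: "ee (t/2) ^ 2 = ee t"
  using ee_of_nat[of 2 "t/2"] by simp

text \<open>At a half-period the two products in \<open>jtheta\<close> agree, up to a factor 2 in
  the first case, so the values are squares. The bases are the products in Weber's three functions;
  the fourth identity is Weber's relation that these functions multiply to the square root of
  2.\<close>

lemma jtheta_half_periods:
  assumes t: "Im t > 0"
  defines "q \<equiv> ee t" and "p \<equiv> ee (t/2)"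
  shows "jtheta (-(1/2)) t = 2 * qpoch q q ^ 2"
        "jtheta (t/2) t = qpoch (-p) q ^ 2"
        "jtheta ((t-1)/2) t = qpoch p q ^ 2"
        "qpoch q q * qpoch p q * qpoch (-p) q = 1"
        "qpoch p p * qpoch (-p) q = 1"
proof -
  have q: "norm q < 1" and p: "norm p < 1" using t by (auto simp: q_def p_def intro!: norm_ee_less_1)
  have pq: "q = p\<^sup>2" by (simp add: p_def q_def ee_double)
  have "qpoch 1 q = 2 * qpoch q q" by (subst qpoch_unfold[OF q]) simp
  moreover have "ee (t + 1/2) = - q" unfolding q_def ee_add ee_half by simp
  ultimately show "jtheta (-(1/2)) t = 2 * qpoch q q ^ 2"
    unfolding jtheta_def q_def[symmetric] ee_half by (simp add: power2_eq_square)
  show "jtheta (t/2) t = qpoch (-p) q ^ 2"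
    by (simp add: jtheta_def p_def q_def power2_eq_square)
  have "ee (t/2 - 1/2) = - p" "ee (t - (t/2 - 1/2)) = -p"
    using ee_add[of "t/2" "1/2"] ee_half by (simp_all add: ee_diff p_def)
  thus "jtheta ((t-1)/2) t = qpoch p q ^ 2"
    by (simp add: jtheta_def q_def diff_divide_distrib power2_eq_square)
  show *: "qpoch p p * qpoch (-p) q = 1" using qpoch_euler[OF p] by (simp add: pq)
  have "qpoch q q * qpoch p q = qpoch p p" using qpoch_even_odd[OF p, of p] by (simp add: pq power2_eq_square mult.commute)
  thus "qpoch q q * qpoch p q * qpoch (-p) q = 1" using * by simp
qed

text \<open>Inversion exchanges two of the half-periods and fixes the third modulo the lattice. The
  three instances of \<open>jtheta_inversion\<close> multiply to a relation for the cube of the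
  unknown constant, and the cube of a single instance then becomes free of it. The values being
  squares, a sixth power results.\<close>

lemma exp_lweber_fricke:
  assumes t: "Im t > 0"
  shows "exp (6 * (lweber (-1/t) + lweber (t/2))) = 1/8"
proof -
  have t0: "t \<noteq> 0" using t by auto
  define t' where "t' = -1/t"
  have t': "Im t' > 0" using Im_minus_inverse_pos[OF t] by (simp add: t'_def)
  define q p q' p' where "q = ee t" "p = ee (t/2)" "q' = ee t'" "p' = ee (t'/2)"
  note h = jtheta_half_periods[OF t, folded q_p_q'_p'_def]
  note h' = jtheta_half_periods[OF t', folded q_p_q'_p'_def]
  obtain C where C0: "\<And>z. jtheta z t \<noteq> 0 \<Longrightarrow>
    jtheta (z / t) t' = C * (exp (pi * \<i> * (z\<^sup>2 / t + z / t - z)) * jtheta z t)"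
    using jtheta_inversion[OF t] unfolding t'_def by metis
  have C: "jtheta w t' = C * (exp (pi * \<i> * x) * jtheta z t)"
    if "jtheta z t \<noteq> 0" "w = z / t" "x = z\<^sup>2 / t + z / t - z" for z w x
    using C0[OF that(1)] that(2,3) by simp
  define A B D where "A = qpoch q q ^ 2" "B = qpoch (-p) q ^ 2" "D = qpoch p q ^ 2"
  define A' B' D' where "A' = qpoch q' q' ^ 2" "B' = qpoch (-p') q' ^ 2" "D' = qpoch p' q' ^ 2"
  have ABD: "A * B * D = 1" "A' * B' * D' = 1"
    unfolding A_B_D_def A'_B'_D'_def power_mult_distrib[symmetric] using h(4) h'(4) by (simp_all add: mult_ac)
  define X1 X2 X3 where "X1 = exp (pi * \<i> * (-1/(4*t) + 1/2))"
    "X2 = exp (pi * \<i> * (1/2 - t/4))" "X3 = exp (pi * \<i> * (1/2 - t/4 - 1/(4*t)))"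
  have e1: "B' = C * X1 * (2 * A)"
  proof -
    have "jtheta (-(1/2)) t \<noteq> 0" using h(4) by (auto simp: h(1))
    hence "jtheta (t'/2) t' = C * (exp (pi * \<i> * (-1/(4*t) + 1/2)) * jtheta (-(1/2)) t)"
      by (rule C) (use t0 in \<open>auto simp: t'_def field_simps power2_eq_square\<close>)
    thus ?thesis unfolding h h' X1_X2_X3_def A_B_D_def A'_B'_D'_def by simp
  qed
  have e2: "2 * A' = C * X2 * B"
  proof -
    have "jtheta (t/2) t \<noteq> 0" using h(4) by (auto simp: h(2))
    hence "jtheta (1/2) t' = C * (exp (pi * \<i> * (1/2 - t/4)) * jtheta (t/2) t)"
      by (rule C) (use t0 in \<open>auto simp: field_simps power2_eq_square\<close>)
    also have "jtheta (1/2) t' = jtheta (-(1/2)) t'" using jtheta_plus_1[of "-(1/2)" t'] by simp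
    finally show ?thesis unfolding h h' X1_X2_X3_def A_B_D_def A'_B'_D'_def by simp
  qed
  have e3: "D' = C * X3 * D"
  proof -
    have "jtheta ((t-1)/2) t \<noteq> 0" using h(4) by (auto simp: h(3))
    hence "jtheta ((t'-1)/2 + 1) t' = C * (exp (pi * \<i> * (1/2 - t/4 - 1/(4*t))) * jtheta ((t-1)/2) t)"
      by (rule C) (use t0 in \<open>auto simp: t'_def field_simps power2_eq_square\<close>)
    thus ?thesis unfolding jtheta_plus_1 h h' X1_X2_X3_def A_B_D_def A'_B'_D'_def by simp
  qed
  \<comment> \<open>In the product of the three instances all infinite products cancel by Weber's
    relation, for t as well as for -1/t.\<close>
  have "2 = 2 * (A' * B' * D')" unfolding ABD by simp
  also have "\<dots> = (2 * A') * B' * D'" by (simp only: mult.assoc)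
  also have "\<dots> = C^3 * X1 * X2 * X3 * 2 * (A * B * D)"
    unfolding e1 e2 e3 by (simp add: power3_eq_cube mult_ac)
  finally have C3: "C^3 * X1 * X2 * X3 = 1" unfolding ABD by simp
  have X: "X2 ^ 2 = exp (pi * \<i> * (1/(2*t) - t/4)) * (X1 * X3)"
    unfolding X1_X2_X3_def exp_add[symmetric] exp_of_nat_mult[symmetric]
    using t0 by (intro arg_cong[where f = exp]) (simp add: field_simps)
  have "8 * A' ^ 3 = (2 * A') ^ 3" by (simp add: power_mult_distrib)
  also have "\<dots> = C^3 * X2 * X2^2 * B ^ 3" unfolding e2 by (simp add: power3_eq_cube power2_eq_square)
  also have "\<dots> = (C^3 * X1 * X2 * X3) * exp (pi * \<i> * (1/(2*t) - t/4)) * B ^ 3" unfolding X by (simp add: mult_ac)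
  finally have main: "8 * A' ^ 3 = exp (pi * \<i> * (1/(2*t) - t/4)) * B ^ 3" unfolding C3 by simp
  have tt: "Im (t/2) > 0" using t by simp
  have "exp (6 * (lweber t' + lweber (t/2))) = (exp (lweber t') * exp (lweber (t/2))) ^ 6"
    by (simp add: exp_add[symmetric] exp_of_nat_mult[symmetric])
  also have "\<dots> = (exp (pi * \<i> * t' / 12) * exp (pi * \<i> * (t/2) / 12)) ^ 6 * A' ^ 3 * qpoch p p ^ 6"
    unfolding exp_lweber[OF t'] exp_lweber[OF tt] q_p_q'_p'_def[symmetric] A'_B'_D'_def
      power_mult_distrib power_mult[symmetric] by (simp add: mult_ac)
  also have "(exp (pi * \<i> * t' / 12) * exp (pi * \<i> * (t/2) / 12)) ^ 6 = exp (- (pi * \<i> * (1/(2*t) - t/4)))"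
    unfolding exp_add[symmetric] exp_of_nat_mult[symmetric] t'_def
    using t0 by (intro arg_cong[where f = exp]) (simp add: field_simps)
  also have "A' ^ 3 = (8 * A' ^ 3) / 8" by simp
  also note main
  also have "exp (- (pi * \<i> * (1/(2*t) - t/4))) * (exp (pi * \<i> * (1/(2*t) - t/4)) * B ^ 3 / 8) * qpoch p p ^ 6
      = B ^ 3 * qpoch p p ^ 6 / 8"
    unfolding exp_minus by simp
  also have "B ^ 3 * qpoch p p ^ 6 = (qpoch p p * qpoch (-p) q) ^ 6"
    unfolding A_B_D_def power_mult_distrib power_mult[symmetric] by (simp add: mult.commute)
  also have "(qpoch p p * qpoch (-p) q) ^ 6 = 1" unfolding h by simp
  finally show ?thesis by (simp add: t'_def)
qed

text \<open>Six times the sum of the two logarithms has a constant exponential, so the derivative of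
  the sum vanishes on the connected half-plane. The value of the constant is irrelevant: it cancels
  in \<open>lweber_V\<close> and only shifts a limit in \<open>lweber_cusp\<close>.\<close>

lemma lweber_fricke:
  obtains C where "\<And>t. Im t > 0 \<Longrightarrow> lweber (-1/t) = C - lweber (t/2)"
proof -
  define F where "F = (\<lambda>t. lweber (-1/t) + lweber (t/2))"
  have hol: "F holomorphic_on upper_half_plane"
    unfolding F_def
  proof (intro holomorphic_on_add holomorphic_lweber)
    show "(\<lambda>z. -1/z) holomorphic_on upper_half_plane" by (intro holomorphic_intros) auto
    show "Im (-1/z) > 0" if "z \<in> upper_half_plane" for z using that by (intro Im_minus_inverse_pos) simp
    show "(\<lambda>z. z/2) holomorphic_on upper_half_plane" by (intro holomorphic_intros) auto
    show "Im (z/2) > 0" if "z \<in> upper_half_plane" for z using that by simp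
  qed
  have "(F has_field_derivative 0) (at t)" if "t \<in> upper_half_plane" for t
  proof -
    have D: "(F has_field_derivative deriv F t) (at t)"
      using holomorphic_derivI[OF hol open_UHP that] .
    have "((\<lambda>t. exp (6 * F t)) has_field_derivative exp (6 * F t) * (6 * deriv F t)) (at t)"
      by (auto intro!: derivative_eq_intros D)
    moreover have "((\<lambda>t. exp (6 * F t)) has_field_derivative 0) (at t)"
    proof (rule DERIV_cong_ev[THEN iffD1, OF refl _ refl])
      show "((\<lambda>_. 1/8) has_field_derivative 0) (at t)" by simp
      show "eventually (\<lambda>t. 1/8 = exp (6 * F t)) (nhds t)"
        unfolding F_def using eventually_nhds_in_open[OF open_UHP that]
        by eventually_elim (rule exp_lweber_fricke[symmetric], simp)
    qed
    ultimately have "exp (6 * F t) * (6 * deriv F t) = 0" by (rule DERIV_unique)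
    thus ?thesis using D by simp
  qed
  hence *: "F constant_on upper_half_plane"
    by (intro DERIV_zero_connected_constant_on[OF connected_UHP open_UHP finite.emptyI
          holomorphic_on_imp_continuous_on[OF hol]]) blast
  then obtain C where C: "\<And>t. t \<in> upper_half_plane \<Longrightarrow> F t = C"
    unfolding constant_on_def by blast
  have "lweber (-1/t) = C - lweber (t/2)" if "Im t > 0" for t
    using C[of t] that unfolding F_def by (simp add: eq_diff_eq)
  thus ?thesis by (rule that)
qed

section \<open>Integral matrices of determinant 1 and generators of
  \<open>\<Gamma>\<^sub>0(2)\<close>\<close>

abbreviation entry :: "int ^ 2 ^ 2 \<Rightarrow> 2 \<Rightarrow> 2 \<Rightarrow> int" where
  "entry A i j \<equiv> vec_nth (vec_nth A i) j"

definition mat2 :: "int \<Rightarrow> int \<Rightarrow> int \<Rightarrow> int \<Rightarrow> int ^ 2 ^ 2" where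
  "mat2 a b c d = vector [vector [a, b], vector [c, d]]"

lemma mat2_nth [simp]:
  "entry (mat2 a b c d) 1 1 = a" "entry (mat2 a b c d) 1 2 = b" "entry (mat2 a b c d) 2 1 = c" "entry (mat2 a b c d) 2 2 = d"
  by (simp_all add: mat2_def vector_2)

lemma mat2_eq_iff: "A = B \<longleftrightarrow> entry A 1 1 = entry B 1 1 \<and> entry A 1 2 = entry B 1 2 \<and> entry A 2 1 = entry B 2 1 \<and> entry A 2 2 = entry B 2 2"
  for A B :: "int ^ 2 ^ 2"
  by (auto simp: vec_eq_iff forall_2)

lemma mat2_cases: obtains a b c d where "A = mat2 a b c d"
  using that[of "entry A 1 1" "entry A 1 2" "entry A 2 1" "entry A 2 2"] by (simp add: mat2_eq_iff)

lemma mat2_mult: "mat2 a b c d ** mat2 a' b' c' d' = mat2 (a * a' + b * c') (a * b' + b * d') (c * a' + d * c') (c * b' + d * d')"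
  by (simp add: mat2_eq_iff matrix_matrix_mult_def sum_2)

lemma mat2_in_SL2Z: "mat2 a b c d \<in> SL2Z \<longleftrightarrow> a * d - b * c = 1"
  by (simp add: SL2Z_def det_2)

lemma mat2_in_Gamma0: "mat2 a b c d \<in> Gamma0 N \<longleftrightarrow> a * d - b * c = 1 \<and> int N dvd c"
  by (simp add: Gamma0_def mat2_in_SL2Z)

lemma Gamma0_SL2Z: "A \<in> Gamma0 N \<Longrightarrow> A \<in> SL2Z"
  by (simp add: Gamma0_def)

lemma SL2Z_cases:
  assumes "A \<in> SL2Z" obtains a b c d where "A = mat2 a b c d" "a * d - b * c = 1"
  using assms mat2_cases[of A] mat2_in_SL2Z by metis

lemma Gamma0_cases:
  assumes "A \<in> Gamma0 N" obtains a b c d where "A = mat2 a b c d" "a * d - b * c = 1" "int N dvd c"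
  using assms mat2_cases[of A] mat2_in_Gamma0 by metis

lemma SL2Z_mult: "A \<in> SL2Z \<Longrightarrow> B \<in> SL2Z \<Longrightarrow> A ** B \<in> SL2Z"
  by (simp add: SL2Z_def det_mul)

lemma Gamma0_mult: "A \<in> Gamma0 N \<Longrightarrow> B \<in> Gamma0 N \<Longrightarrow> A ** B \<in> Gamma0 N"
proof -
  assume "A \<in> Gamma0 N" "B \<in> Gamma0 N"
  moreover have "entry (A ** B) 2 1 = entry A 2 1 * entry B 1 1 + entry A 2 2 * entry B 2 1"
    by (simp add: matrix_matrix_mult_def sum_2)
  ultimately show ?thesis using SL2Z_mult[of A B] by (simp add: Gamma0_def)
qed

lemma Gamma0_dvd: "A \<in> Gamma0 N \<Longrightarrow> M dvd N \<Longrightarrow> A \<in> Gamma0 M"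
  by (auto simp: Gamma0_def intro: dvd_trans[of "int M" "int N"])

lemma mobius_mat2: "mobius (mat2 a b c d) z = (of_int a * z + of_int b) / (of_int c * z + of_int d)"
  by (simp add: mobius_def)

lemma mobius_denom_nonzero:
  assumes "a * d - b * c = (1::int)" "Im z > 0"
  shows "of_int c * z + of_int d \<noteq> 0"
proof
  assume *: "of_int c * z + of_int d = 0"
  hence "Im (of_int c * z + of_int d) = 0" by simp
  hence "c = 0" using assms by simp
  thus False using assms * by auto
qed

lemma Im_mobius:
  assumes "a * d - b * c = (1::int)" "Im z > 0"
  shows "Im (mobius (mat2 a b c d) z) = Im z / (cmod (of_int c * z + of_int d))\<^sup>2"
proof -
  have det: "real_of_int a * real_of_int d - real_of_int b * real_of_int c = 1"
    using arg_cong[OF assms(1), of real_of_int] by simp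
  have "Im ((of_int a * z + of_int b) * cnj (of_int c * z + of_int d)) = (real_of_int a * real_of_int d - real_of_int b * real_of_int c) * Im z"
    by (simp add: algebra_simps)
  hence "Im ((of_int a * z + of_int b) * cnj (of_int c * z + of_int d)) = Im z" by (simp add: det)
  thus ?thesis unfolding mobius_mat2 by (subst complex_div_cnj) (simp add: Im_divide_of_real flip: of_real_power)
qed

lemma Im_mobius_pos:
  assumes "A \<in> SL2Z" "Im z > 0"
  shows "Im (mobius A z) > 0"
  using SL2Z_cases[OF assms(1)] Im_mobius[OF _ assms(2)] mobius_denom_nonzero[OF _ assms(2)] assms(2)
  by (metis divide_pos_pos norm_eq_zero zero_less_power2)

lemma mobius_mult:
  assumes "B \<in> SL2Z" "Im z > 0"
  shows "mobius (A ** B) z = mobius A (mobius B z)"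
proof -
  obtain a b c d where A: "A = mat2 a b c d" by (rule mat2_cases)
  obtain a' b' c' d' where B: "B = mat2 a' b' c' d'" "a' * d' - b' * c' = 1" by (rule SL2Z_cases[OF assms(1)])
  have nz: "of_int c' * z + of_int d' \<noteq> 0" by (rule mobius_denom_nonzero[OF B(2) assms(2)])
  define D where "D = of_int c' * z + of_int d'"
  have "mobius A (mobius B z) = ((of_int a * ((of_int a' * z + of_int b') / D) + of_int b) * D) / ((of_int c * ((of_int a' * z + of_int b') / D) + of_int d) * D)"
    using nz unfolding A B mobius_mat2 D_def by simp
  also have "\<dots> = mobius (A ** B) z"
    using nz unfolding A B mat2_mult mobius_mat2 D_def[symmetric] by (simp add: distrib_right) (simp add: D_def algebra_simps)
  finally show ?thesis ..
qed

lemma holomorphic_mobius: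
  assumes "A \<in> SL2Z"
  shows "mobius A holomorphic_on upper_half_plane"
proof -
  obtain a b c d where A: "A = mat2 a b c d" "a * d - b * c = 1" by (rule SL2Z_cases[OF assms])
  have "(\<lambda>z. (of_int a * z + of_int b) / (of_int c * z + of_int d)) holomorphic_on upper_half_plane"
    using mobius_denom_nonzero[OF A(2)] by (intro holomorphic_intros) auto
  thus ?thesis unfolding A by (simp add: mobius_mat2[abs_def])
qed

text \<open>The adjugate, which stays integral and inverts a matrix of determinant 1.\<close>

definition minv :: "int ^ 2 ^ 2 \<Rightarrow> int ^ 2 ^ 2" where
  "minv A = mat2 (entry A 2 2) (- entry A 1 2) (- entry A 2 1) (entry A 1 1)"

lemma minv_mat2 [simp]: "minv (mat2 a b c d) = mat2 d (-b) (-c) a"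
  by (simp add: minv_def)

lemma mat_1_eq: "(mat 1 :: int ^ 2 ^ 2) = mat2 1 0 0 1"
  by (simp add: mat2_eq_iff mat_def)

lemma SL2Z_minv: assumes "A \<in> SL2Z" shows "minv A \<in> SL2Z" "A ** minv A = mat 1" "minv A ** A = mat 1"
proof -
  obtain a b c d where A: "A = mat2 a b c d" "a * d - b * c = 1" by (rule SL2Z_cases[OF assms])
  show "minv A \<in> SL2Z" "A ** minv A = mat 1" "minv A ** A = mat 1"
    using A by (auto simp: mat2_in_SL2Z mat2_mult mat_1_eq algebra_simps)
qed

lemma Gamma0_minv: "A \<in> Gamma0 N \<Longrightarrow> minv A \<in> Gamma0 N"
  using SL2Z_minv(1) by (auto simp: Gamma0_def minv_def)

lemma mat_1_in_Gamma0: "mat 1 \<in> Gamma0 N"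
  by (simp add: mat_1_eq mat2_in_Gamma0)

lemma mobius_1 [simp]: "mobius (mat 1) z = z"
  by (simp add: mat_1_eq mobius_mat2)

lemma mobius_minv:
  assumes "A \<in> SL2Z" "Im z > 0"
  shows "mobius A (mobius (minv A) z) = z" "mobius (minv A) (mobius A z) = z"
  using assms SL2Z_minv[OF assms(1)] by (simp_all flip: mobius_mult)

lemma det_odd:
  assumes "a * d - b * c = (1::int)" "even c"
  shows "odd a" "odd d"
proof -
  have "odd (a * d - b * c)" unfolding assms(1) by simp
  thus "odd a" "odd d" using assms(2) by auto
qed

lemma small_residue_pos:
  fixes a c :: int assumes "c > 0"
  shows "\<exists>n. 2 * \<bar>a + n * c\<bar> \<le> c"
proof -
  define m where "m = a mod c"
  have m: "0 \<le> m" "m < c" "m = a - (a div c) * c"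
    using assms by (auto simp: m_def minus_div_mult_eq_mod)
  show ?thesis
  proof (cases "2 * m \<le> c")
    case True
    thus ?thesis using m by (intro exI[of _ "- (a div c)"]) (simp add: algebra_simps)
  next
    case False
    have "a + (- (a div c) - 1) * c = m - c" using m(3) by (simp add: algebra_simps)
    thus ?thesis using False m(1,2) by (intro exI[of _ "- (a div c) - 1"]) simp
  qed
qed

lemma small_residue:
  fixes a c :: int assumes "c \<noteq> 0"
  obtains n where "2 * \<bar>a + n * c\<bar> \<le> \<bar>c\<bar>"
proof (cases "c > 0")
  case True
  thus ?thesis using small_residue_pos[of c a] that by auto
next
  case False
  then obtain n where "2 * \<bar>a + n * (-c)\<bar> \<le> -c" using small_residue_pos[of "-c" a] assms by auto
  thus ?thesis using False that[of "-n"] by simp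
qed

text \<open>Euclid's algorithm: \<open>\<Gamma>\<^sub>0(2)\<close> is generated by \<open>\<tau> \<mapsto> \<tau> + 1\<close> and \<open>\<tau> \<mapsto> \<tau> / (2\<tau> + 1)\<close> up to sign.\<close>

lemma Gamma0_2_induct [consumes 2, case_names base T V M]:
  fixes a b c d :: int
  assumes "a * d - b * c = 1" "even c"
    and base: "Q 1 0 0 1"
    and T: "\<And>n a b c d. a * d - b * c = 1 \<Longrightarrow> even c \<Longrightarrow> Q a b c d \<Longrightarrow> Q (a + n * c) (b + n * d) c d"
    and V: "\<And>n a b c d. a * d - b * c = 1 \<Longrightarrow> even c \<Longrightarrow> Q a b c d \<Longrightarrow> Q a b (c + 2 * n * a) (d + 2 * n * b)"
    and M: "\<And>a b c d. a * d - b * c = 1 \<Longrightarrow> even c \<Longrightarrow> Q a b c d \<Longrightarrow> Q (-a) (-b) (-c) (-d)"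
  shows "Q a b c d"
  using assms(1,2)
proof (induction "nat \<bar>c\<bar>" arbitrary: a b c d rule: less_induct)
  case less
  show ?case
  proof (cases "c = 0")
    case True
    hence "a * d = 1" using less by simp
    hence "(a = 1 \<and> d = 1) \<or> (a = -1 \<and> d = -1)" by (simp add: zmult_eq_1_iff)
    moreover have "Q 1 n 0 1" for n using T[of 1 1 0 0 n] base by simp
    moreover from this have "Q (-1) n 0 (-1)" for n using M[of 1 1 "-n" 0] by simp
    ultimately show ?thesis using True by auto
  next
    case False
    obtain n where n: "2 * \<bar>a + n * c\<bar> \<le> \<bar>c\<bar>" using small_residue[OF False] by metis
    define a' b' where "a' = a + n * c" "b' = b + n * d"
    have det': "a' * d - b' * c = 1" using less.prems by (simp add: a'_b'_def algebra_simps)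
    \<comment> \<open>An odd \<open>a'\<close> is nonzero, so the second division, by
      \<open>2 * a'\<close>, is possible. The two divisions give
      \<open>\<bar>c'\<bar> \<le> \<bar>a'\<bar> \<le> \<bar>c\<bar> / 2\<close>, which makes the
      recursion terminate.\<close>
    have odda: "odd a'" using det_odd[OF det' less.prems(2)] by simp
    hence "a' \<noteq> 0" by auto
    then obtain m where m: "2 * \<bar>c + m * (2 * a')\<bar> \<le> \<bar>2 * a'\<bar>" using small_residue[of "2 * a'" c] by auto
    define c' d' where "c' = c + 2 * m * a'" "d' = d + 2 * m * b'"
    have det'': "a' * d' - b' * c' = 1" using det' by (simp add: c'_d'_def algebra_simps)
    have ev: "even c'" using less.prems by (simp add: c'_d'_def)
    have "c + m * (2 * a') = c'" by (simp add: c'_d'_def)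
    hence "\<bar>c'\<bar> \<le> \<bar>a'\<bar>" using m by (simp add: abs_mult)
    moreover have "2 * \<bar>a'\<bar> \<le> \<bar>c\<bar>" using n by (simp add: a'_b'_def)
    ultimately have "nat \<bar>c'\<bar> < nat \<bar>c\<bar>" using \<open>c \<noteq> 0\<close> by linarith
    from less.hyps[OF this det'' ev] have "Q a' b' c' d'" .
    from V[OF det'' ev this, of "-m"] have "Q a' b' c d" by (simp add: c'_d'_def)
    from T[OF det' less.prems(2) this, of "-n"] show ?thesis by (simp add: a'_b'_def)
  qed
qed

section \<open>Periods of the logarithm: exact values and residues modulo 24\<close>

definition is_period :: "int \<Rightarrow> int \<Rightarrow> int \<Rightarrow> int \<Rightarrow> int \<Rightarrow> bool" where
  "is_period a b c d n \<longleftrightarrow> (\<forall>t. Im t > 0 \<longrightarrow> lweber (mobius (mat2 a b c d) t) = lweber t + pi * \<i> / 12 * of_int n)"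

lemma lweber_plus_int: "lweber (t + of_int n) = lweber t + pi * \<i> / 12 * of_int n"
proof (induction n rule: int_induct[where k = 0])
  case (step1 i) thus ?case using lweber_plus_1[of "t + of_int i"] by (simp add: algebra_simps)
next
  case (step2 i) thus ?case using lweber_plus_1[of "t + of_int (i-1)"] by (simp add: algebra_simps diff_divide_distrib)
qed simp

text \<open>The inversion of \<open>lweber_fricke\<close> conjugates this matrix into the
  translation by -n. It is applied twice with opposite signs, so its constant cancels.\<close>

lemma lweber_V:
  assumes t: "Im t > 0"
  shows "lweber (mobius (mat2 1 0 (2 * n) 1) t) = lweber t + pi * \<i> / 12 * of_int n"
proof -
  have t0: "t \<noteq> 0" using t by auto
  obtain C where C: "\<And>t. Im t > 0 \<Longrightarrow> lweber (-1/t) = C - lweber (t/2)" by (rule lweber_fricke) blast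
  define s where "s = - of_int (2 * n) + (-1/t)"
  have s: "Im s > 0" using Im_minus_inverse_pos[OF t] by (simp add: s_def)
  have "mobius (mat2 1 0 (2 * n) 1) t = -1/s"
    using t0 s mobius_denom_nonzero[of 1 1 0 "2 * n" t] t by (auto simp: mobius_mat2 s_def divide_simps)
      (auto simp: algebra_simps)?
  also have "lweber \<dots> = C - lweber (s / 2)" by (rule C[OF s])
  also have "s / 2 = -1/(2 * t) + of_int (-n)" by (simp add: s_def field_simps)
  also have "lweber \<dots> = lweber (-1/(2 * t)) + pi * \<i> / 12 * of_int (-n)" by (rule lweber_plus_int)
  also have "lweber (-1/(2 * t)) = C - lweber t" using C[of "2 * t"] t by simp
  finally show ?thesis by (simp add: algebra_simps)
qed

lemma is_period_mult:
  assumes "is_period a b c d n" "is_period a' b' c' d' n'" "a' * d' - b' * c' = 1"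
  shows "is_period (a * a' + b * c') (a * b' + b * d') (c * a' + d * c') (c * b' + d * d') (n + n')"
  unfolding is_period_def mat2_mult[symmetric]
proof safe
  fix t :: complex assume t: "Im t > 0"
  have B: "mat2 a' b' c' d' \<in> SL2Z" using assms by (simp add: mat2_in_SL2Z)
  show "lweber (mobius (mat2 a b c d ** mat2 a' b' c' d') t) = lweber t + pi * \<i> / 12 * of_int (n + n')"
    using assms t Im_mobius_pos[OF B t] unfolding is_period_def mobius_mult[OF B t] by (simp add: algebra_simps)
qed

lemma is_period_T: "is_period 1 n 0 1 n"
  unfolding is_period_def mobius_mat2 using lweber_plus_int by simp

lemma is_period_V: "is_period 1 0 (2 * n) 1 n"
  unfolding is_period_def using lweber_V by simp

lemma is_period_minus: "is_period a b c d n \<Longrightarrow> is_period (-a) (-b) (-c) (-d) n"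
proof -
  have "mobius (mat2 (-a) (-b) (-c) (-d)) t = mobius (mat2 a b c d) t" for t
    using minus_divide_divide[of "of_int a * t + of_int b" "of_int c * t + of_int d"]
    by (simp add: mobius_mat2)
  thus "is_period a b c d n \<Longrightarrow> ?thesis" by (simp add: is_period_def)
qed

text \<open>The period of \<open>lweber\<close> along \<open>(a, b; 2c, d)\<close> modulo 24.\<close>

definition period_formula :: "int \<Rightarrow> int \<Rightarrow> int \<Rightarrow> int \<Rightarrow> int" where
  "period_formula a b c d = - (a + d) * c + b * d * (2 * c\<^sup>2 + 1) + 3 * c * d + 3 * ((d\<^sup>2 - 1) div 2)"

lemma three_dvd_square_minus_1: "\<not> 3 dvd (a::int) \<Longrightarrow> 3 dvd a\<^sup>2 - 1"
proof -
  assume "\<not> 3 dvd a"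
  hence "a mod 3 = 1 \<or> a mod 3 = 2" by presburger
  moreover have "a\<^sup>2 mod 3 = (a mod 3)\<^sup>2 mod 3" by (simp add: power_mod)
  ultimately have "a\<^sup>2 mod 3 = 1 mod 3" by auto
  thus ?thesis by (simp only: mod_eq_dvd_iff)
qed

lemma eight_dvd_square_minus_1: "odd (a::int) \<Longrightarrow> 8 dvd a\<^sup>2 - 1"
proof -
  assume "odd a"
  then obtain x where x: "a = 2 * x + 1" by (auto elim: oddE)
  have "even (x * (x + 1))" by simp
  then obtain y where "x * (x + 1) = 2 * y" by (elim evenE)
  hence "a\<^sup>2 - 1 = 8 * y" by (simp add: x power2_eq_square algebra_simps)
  thus ?thesis by simp
qed

lemma dvd_24I: "8 dvd x \<Longrightarrow> 3 dvd x \<Longrightarrow> 24 dvd (x::int)"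
  by presburger

text \<open>The difference is \<open>n * (d\<^sup>2 - 1) * (2 * c\<^sup>2 + 1)\<close>. Since d is
  odd, 8 divides the middle factor; 3 divides it unless 3 divides d, and then 3 does not divide c
  and the last factor is divisible by 3.\<close>

lemma period_formula_T:
  assumes "a * d - b * (2 * c) = 1"
  shows "24 dvd period_formula (a + n * (2 * c)) (b + n * d) c d - (period_formula a b c d + n)"
proof -
  have d: "odd d" using det_odd[OF assms] by simp
  have "24 dvd (d\<^sup>2 - 1) * (2 * c\<^sup>2 + 1)"
  proof (intro dvd_24I)
    show "8 dvd (d\<^sup>2 - 1) * (2 * c\<^sup>2 + 1)" using eight_dvd_square_minus_1[OF d] by simp
    show "3 dvd (d\<^sup>2 - 1) * (2 * c\<^sup>2 + 1)"
    proof (cases "3 dvd d")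
      case True
      have "\<not> 3 dvd c"
      proof
        assume "3 dvd c"
        hence "3 dvd a * d - b * (2 * c)" using True by simp
        thus False using assms by simp
      qed
      hence "3 dvd 2 * (c\<^sup>2 - 1) + 3" by (intro dvd_add dvd_mult three_dvd_square_minus_1) auto
      thus ?thesis by (intro dvd_mult) (simp add: algebra_simps)
    qed (auto intro: dvd_mult2 three_dvd_square_minus_1)
  qed
  moreover have "period_formula (a + n * (2 * c)) (b + n * d) c d - (period_formula a b c d + n) = n * ((d\<^sup>2 - 1) * (2 * c\<^sup>2 + 1))"
    by (simp add: period_formula_def algebra_simps power2_eq_square)
  ultimately show ?thesis by simp
qed

text \<open>By the determinant relation the difference equals \<open>G\<close>. Modulo 3 it is
  \<open>(1 - a\<^sup>2) * (1 - b\<^sup>2)\<close>, and 3 cannot divide both a and b; modulo 8 the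
  claim is a parity statement after writing the odd entries as \<open>2 * x + 1\<close> and
  \<open>2 * y + 1\<close>.\<close>

lemma period_formula_V:
  assumes "a * d - b * (2 * c) = 1"
  shows "24 dvd period_formula a b (c + a) (d + 2 * b) - (period_formula a b c d + 1)"
proof -
  have ad: "odd a" "odd d" using det_odd[OF assms] by simp_all
  obtain x where x: "a = 2 * x + 1" using ad by (auto elim: oddE)
  obtain y where y: "d = 2 * y + 1" using ad by (auto elim: oddE)
  define G where "G = 1 - a\<^sup>2 + 12 * b * c + 6 * a * b + 12 * a * b\<^sup>2 * c + 12 * b\<^sup>2 * c\<^sup>2 + 4 * a\<^sup>2 * b\<^sup>2 + 8 * b\<^sup>2 + 6 * b * d"
  have det: "a * d = 1 + 2 * b * c" using assms by simp
  have hd: "(d + 2 * b)\<^sup>2 - 1 = (d\<^sup>2 - 1) + 2 * (2 * (b * d + b\<^sup>2))" by (simp add: power2_eq_square algebra_simps)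
  have "((d + 2 * b)\<^sup>2 - 1) div 2 = (d\<^sup>2 - 1) div 2 + 2 * (b * d + b\<^sup>2)"
    unfolding hd by (subst div_mult_self2) auto
  hence "period_formula a b (c + a) (d + 2 * b) - (period_formula a b c d + 1) =
      - (a + d + 2 * b) * (c + a) + (a + d) * c + b * (d + 2 * b) * (2 * (c+a)\<^sup>2 + 1) - b * d * (2 * c\<^sup>2+1)
      + 3 * (c+a) * (d+2 * b) - 3 * c * d + 6 * (b * d+b\<^sup>2) - 1"
    by (simp add: period_formula_def algebra_simps)
  also have "\<dots> = G + (a * d - 1 - 2 * b * c) * (2 + 4 * b * c + 2 * a * b)"
    unfolding G_def by (simp add: algebra_simps power2_eq_square)
  also have "\<dots> = G" using det by simp
  finally have *: "period_formula a b (c + a) (d + 2 * b) - (period_formula a b c d + 1) = G" .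
  have "24 dvd G"
  proof (intro dvd_24I)
    have xy: "2 * x * y + x + y = b * c" using det by (simp add: x y algebra_simps)
    have "even (2 * x * y + x + y) \<longleftrightarrow> even (b * c)" by (simp only: xy)
    hence par: "even (x + y) \<longleftrightarrow> even b \<or> even c" by simp
    \<comment> \<open>This is a quarter of \<open>G\<close>. Its parity depends only on the parities
      of b, c, x and y, which \<open>par\<close> ties together.\<close>
    define E where "E = - (x * (x+1)) + 3 * b * c + 3 * a * b\<^sup>2 * c + 3 * b\<^sup>2 * c\<^sup>2 + a\<^sup>2 * b\<^sup>2 + 2 * b\<^sup>2 + 3 * b * (x+y+1)"
    have "even E"
      unfolding E_def using par ad by (cases "even b"; cases "even c"; cases "even x") simp_all
    then obtain k where "E = 2 * k" by (elim evenE)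
    moreover have "G = 4 * E"
      unfolding G_def E_def x y by (simp add: algebra_simps power2_eq_square)
    ultimately show "8 dvd G" by simp
    have "3 dvd (1 - a\<^sup>2) * (1 - b\<^sup>2)"
    proof (cases "3 dvd a")
      case True
      have "\<not> 3 dvd b"
      proof
        assume "3 dvd b"
        hence "3 dvd a * d - b * (2 * c)" using True by simp
        thus False using assms by simp
      qed
      thus ?thesis using three_dvd_square_minus_1[of b] by (metis dvd_diff_commute dvd_mult)
    next
      case False
      thus ?thesis using three_dvd_square_minus_1[of a] by (metis dvd_diff_commute dvd_mult2)
    qed
    moreover have "G = (1 - a\<^sup>2) * (1 - b\<^sup>2) + 3 * (4 * b * c + 2 * a * b + 4 * a * b\<^sup>2 * c + 4 * b\<^sup>2 * c\<^sup>2 + a\<^sup>2 * b\<^sup>2 + 3 * b\<^sup>2 + 2 * b * d)"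
      unfolding G_def by (simp add: algebra_simps)
    ultimately show "3 dvd G" by simp
  qed
  thus ?thesis by (simp add: *)
qed

lemma period_formula_V_int:
  assumes "a * d - b * (2 * c) = 1"
  shows "24 dvd period_formula a b (c + n * a) (d + n * (2 * b)) - (period_formula a b c d + n)"
proof (induction n rule: int_induct[where k = 0])
  case (step1 i)
  have "a * (d + i * (2 * b)) - b * (2 * (c + i * a)) = 1" using assms by (simp add: algebra_simps)
  from dvd_add[OF period_formula_V[OF this] step1(2)] show ?case by (simp add: algebra_simps)
next
  case (step2 i)
  have "a * (d + (i-1) * (2 * b)) - b * (2 * (c + (i-1) * a)) = 1" using assms by (simp add: algebra_simps)
  from dvd_diff[OF step2(2) period_formula_V[OF this]] show ?case by (simp add: algebra_simps)
qed simp

lemma period_exists: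
  assumes "a * d - b * c = 1" "even c"
  shows "\<exists>n. is_period a b c d n \<and> 24 dvd n - period_formula a b (c div 2) d"
  using assms
proof (induction rule: Gamma0_2_induct)
  case base
  show ?case using is_period_T[of 0] by (intro exI[of _ 0]) (simp add: period_formula_def)
next
  case (T n a b c d)
  then obtain m where m: "is_period a b c d m" "24 dvd m - period_formula a b (c div 2) d" by blast
  obtain c' where c: "c = 2 * c'" using T by (auto elim: evenE)
  have "is_period (a + n * c) (b + n * d) c d (n + m)"
    using is_period_mult[OF is_period_T m(1), of n] T by simp
  moreover have "24 dvd (n + m) - period_formula (a + n * c) (b + n * d) (c div 2) d"
    using dvd_diff[OF m(2) period_formula_T[of a d b c' n]] T by (simp add: c algebra_simps)
  ultimately show ?case by blast
next
  case (V n a b c d)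
  then obtain m where m: "is_period a b c d m" "24 dvd m - period_formula a b (c div 2) d" by blast
  obtain c' where c: "c = 2 * c'" using V by (auto elim: evenE)
  have "is_period a b (c + 2 * n * a) (d + 2 * n * b) (n + m)"
    using is_period_mult[OF is_period_V m(1), of n] V by (simp add: algebra_simps)
  moreover have "(c + 2 * n * a) div 2 = c' + n * a" by (simp add: c)
  hence "24 dvd (n + m) - period_formula a b ((c + 2 * n * a) div 2) (d + 2 * n * b)"
    using dvd_diff[OF m(2) period_formula_V_int[of a d b c' n]] V by (simp add: c algebra_simps)
  ultimately show ?case by blast
next
  case (M a b c d)
  then obtain m where m: "is_period a b c d m" "24 dvd m - period_formula a b (c div 2) d" by blast
  obtain c' where c: "c = 2 * c'" using M by (auto elim: evenE)
  have "(-c) div 2 = -c'" "c div 2 = c'" using c by presburger+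
  hence "period_formula (-a) (-b) ((-c) div 2) (-d) = period_formula a b (c div 2) d"
    by (simp add: period_formula_def algebra_simps)
  thus ?case using is_period_minus[OF m(1)] m(2) by auto
qed

text \<open>The exact integer is kept, not just its residue modulo 24, because
  \<open>exponents_integral\<close> tests non-integral exponents against it.\<close>

definition period :: "int \<Rightarrow> int \<Rightarrow> int \<Rightarrow> int \<Rightarrow> int" where
  "period a b c d = (THE n. is_period a b c d n)"

lemma period_eqI:
  assumes "is_period a b c d n"
  shows "period a b c d = n"
  unfolding period_def
proof (rule the_equality, rule assms)
  fix m assume "is_period a b c d m"
  hence "pi * \<i> / 12 * of_int m = pi * \<i> / 12 * (of_int n :: complex)"
    using assms unfolding is_period_def by (metis add_left_cancel imaginary_unit.sel(2) zero_less_one)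
  thus "m = n" by simp
qed

lemma period:
  assumes "a * d - b * c = 1" "even c"
  shows "is_period a b c d (period a b c d)" "24 dvd period a b c d - period_formula a b (c div 2) d"
  using period_exists[OF assms] period_eqI by auto

lemma lweber_mobius:
  assumes "a * d - b * c = 1" "even c" "Im t > 0"
  shows "lweber (mobius (mat2 a b c d) t) = lweber t + pi * \<i> / 12 * of_int (period a b c d)"
  using period(1)[OF assms(1,2)] assms(3) unfolding is_period_def by blast

lemma period_mult:
  assumes "a * d - b * c = 1" "even c" "a' * d' - b' * c' = 1" "even c'"
  shows "period (a * a' + b * c') (a * b' + b * d') (c * a' + d * c') (c * b' + d * d') = period a b c d + period a' b' c' d'"
  by (intro period_eqI is_period_mult period assms)

lemma period_T: "period 1 n 0 1 = n"
  by (intro period_eqI is_period_T)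

lemma period_V: "period 1 0 (2 * n) 1 = n"
  by (intro period_eqI is_period_V)

definition periodM :: "int ^ 2 ^ 2 \<Rightarrow> int" where
  "periodM A = period (entry A 1 1) (entry A 1 2) (entry A 2 1) (entry A 2 2)"

lemma periodM_mat2 [simp]: "periodM (mat2 a b c d) = period a b c d"
  by (simp add: periodM_def)

lemma periodM_mult:
  assumes "A \<in> Gamma0 2" "B \<in> Gamma0 2"
  shows "periodM (A ** B) = periodM A + periodM B"
proof -
  obtain a b c d where A: "A = mat2 a b c d" "a * d - b * c = 1" "int 2 dvd c" by (rule Gamma0_cases[OF assms(1)])
  obtain a' b' c' d' where B: "B = mat2 a' b' c' d'" "a' * d' - b' * c' = 1" "int 2 dvd c'" by (rule Gamma0_cases[OF assms(2)])
  show ?thesis using A B by (simp add: mat2_mult period_mult)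
qed

text \<open>A homomorphism to the abelian group of integers does not see conjugation.\<close>

lemma periodM_conj:
  assumes "A \<in> Gamma0 2" "B \<in> Gamma0 2"
  shows "periodM (A ** B ** minv A) = periodM B"
proof -
  have "periodM (A ** minv A) = periodM A + periodM (minv A)"
    using assms by (intro periodM_mult Gamma0_minv)
  moreover have "periodM (A ** minv A) = 0"
    using SL2Z_minv(2)[OF Gamma0_SL2Z[OF assms(1)]] period_T[of 0] by (simp add: mat_1_eq)
  ultimately show ?thesis
    using assms by (simp add: periodM_mult Gamma0_mult Gamma0_minv)
qed

lemma lweber_periodM:
  assumes "A \<in> Gamma0 2" "Im t > 0"
  shows "lweber (mobius A t) = lweber t + pi * \<i> / 12 * of_int (periodM A)"
  using assms by (elim Gamma0_cases) (simp add: lweber_mobius)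

text \<open>The conjugate of \<open>A\<close> by \<open>\<tau> \<mapsto> 2\<^sup>i \<tau>\<close>.\<close>

definition dil :: "nat \<Rightarrow> int ^ 2 ^ 2 \<Rightarrow> int ^ 2 ^ 2" where
  "dil i A = mat2 (entry A 1 1) (2 ^ i * entry A 1 2) (entry A 2 1 div 2 ^ i) (entry A 2 2)"

lemma dil_mat2: "dil i (mat2 a b (2 ^ i * c) d) = mat2 a (2 ^ i * b) c d"
  by (simp add: dil_def)

lemma power_2_split: "i < r \<Longrightarrow> (2::int) ^ r = 2 ^ i * (2 * 2 ^ (r - 1 - i))"
  using power_add[of "2::int" i "Suc (r - 1 - i)"] by simp

lemma dil_in_Gamma0:
  assumes "A \<in> Gamma0 (2 ^ r)" "i \<le> r"
  shows "dil i A \<in> Gamma0 (2 ^ (r - i))"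
proof -
  obtain a b c d where A: "A = mat2 a b c d" "a * d - b * c = 1" "int (2 ^ r) dvd c" by (rule Gamma0_cases[OF assms(1)])
  have r: "(2::int) ^ r = 2 ^ i * 2 ^ (r - i)" using assms by (simp flip: power_add)
  obtain k where k: "c = 2 ^ i * (2 ^ (r - i) * k)" using A(3) by (auto simp: r mult.assoc)
  show ?thesis using A(2) unfolding A(1) k dil_mat2 mat2_in_Gamma0 by (simp add: algebra_simps)
qed

lemma dil_in_Gamma0_2:
  assumes "A \<in> Gamma0 (2 ^ r)" "i < r"
  shows "dil i A \<in> Gamma0 2"
  by (rule Gamma0_dvd[OF dil_in_Gamma0[OF assms(1)]]) (use assms in \<open>auto intro: dvd_power\<close>)

lemma mobius_dil:
  assumes "A \<in> Gamma0 (2 ^ r)" "i \<le> r" "Im t > 0"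
  shows "2 ^ i * mobius A t = mobius (dil i A) (2 ^ i * t)"
proof -
  obtain a b c d where A: "A = mat2 a b c d" "a * d - b * c = 1" "int (2 ^ r) dvd c" by (rule Gamma0_cases[OF assms(1)])
  have "(2::int) ^ i dvd 2 ^ r" using assms by (simp add: le_imp_power_dvd)
  hence "2 ^ i dvd c" using dvd_trans[of "2 ^ i" "2 ^ r" c] A(3) by simp
  then obtain k where k: "c = 2 ^ i * k" by (elim dvdE)
  show ?thesis unfolding A(1) k dil_mat2 mobius_mat2 by (simp add: algebra_simps)
qed

lemma period_formula_cong:
  assumes "a * d - b * (2 * c) = 1"
  shows "[period a b (2 * c) d = period_formula a b c d] (mod 24)"
  using period(2)[of a d b "2 * c"] assms by (simp add: cong_iff_dvd_diff)

text \<open>Ligozat's criterion for the character of an eta quotient to be trivial.\<close>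

lemma sum_period_dvd:
  fixes s :: "nat \<Rightarrow> int"
  assumes s: "24 dvd (\<Sum>i<r. 2 ^ i * s i)" "24 dvd (\<Sum>i<r. 2 ^ (r - 1 - i) * s i)" "even (\<Sum>i<r. s i)"
    and A: "A \<in> Gamma0 (2 ^ r)"
  shows "24 dvd (\<Sum>i<r. s i * periodM (dil i A))"
proof -
  obtain a b c d where A': "A = mat2 a b c d" "a * d - b * c = 1" "int (2 ^ r) dvd c" by (rule Gamma0_cases[OF A])
  obtain C where c: "c = 2 ^ r * C" using A'(3) by auto
  define S1 S2 S3 where "S1 = (\<Sum>i<r. 2 ^ i * s i)" "S2 = (\<Sum>i<r. 2 ^ (r - 1 - i) * s i)" "S3 = (\<Sum>i<r. s i)"
  define e where "e = (d\<^sup>2 - 1) div 2"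
  \<comment> \<open>The i-th dilation multiplies b by \<open>2 ^ i\<close> and has
    \<open>2 ^ (r - 1 - i) * C\<close> in place of c. As the product of the two powers of 2 does not
    depend on i, \<open>period_formula\<close> becomes a combination of
    \<open>2 ^ (r - 1 - i)\<close>, \<open>2 ^ i\<close> and 1 with coefficients \<open>K\<close>,
    \<open>b * d\<close> and \<open>3 * e\<close> independent of i.\<close>
  define K where "K = 2 * b * d * 2 ^ (r - 1) * C\<^sup>2 - (a + d) * C + 3 * d * C"
  have "[(\<Sum>i<r. s i * periodM (dil i A)) = (\<Sum>i<r. s i * period_formula a (2 ^ i * b) (2 ^ (r - 1 - i) * C) d)] (mod 24)"
  proof (intro cong_sum cong_mult cong_refl)
    fix i assume i: "i \<in> {..<r}"
    have "(2::int) ^ r = 2 ^ i * (2 * 2 ^ (r - 1 - i))" using i by (intro power_2_split) simp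
    hence c': "c = 2 ^ i * (2 * (2 ^ (r - 1 - i) * C))" by (simp add: c)
    have "periodM (dil i A) = period a (2 ^ i * b) (2 * (2 ^ (r - 1 - i) * C)) d"
      unfolding A'(1) c' dil_mat2 by simp
    moreover have "a * d - (2 ^ i * b) * (2 * (2 ^ (r - 1 - i) * C)) = 1"
      using A'(2) by (simp add: c' algebra_simps)
    ultimately show "[periodM (dil i A) = period_formula a (2 ^ i * b) (2 ^ (r - 1 - i) * C) d] (mod 24)"
      using period_formula_cong by simp
  qed
  also have "(\<Sum>i<r. s i * period_formula a (2 ^ i * b) (2 ^ (r - 1 - i) * C) d)
      = (\<Sum>i<r. K * (2 ^ (r - 1 - i) * s i) + b * d * (2 ^ i * s i) + 3 * e * s i)"
  proof (intro sum.cong refl)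
    fix i assume i: "i \<in> {..<r}"
    have p: "(2::int) ^ (r - 1) = 2 ^ i * 2 ^ (r - 1 - i)" using i by (simp flip: power_add)
    show "s i * period_formula a (2 ^ i * b) (2 ^ (r - 1 - i) * C) d = K * (2 ^ (r - 1 - i) * s i) + b * d * (2 ^ i * s i) + 3 * e * s i"
      unfolding period_formula_def K_def e_def p by (simp add: algebra_simps power2_eq_square)
  qed
  also have "\<dots> = K * S2 + b * d * S1 + 3 * e * S3"
    by (simp only: sum.distrib sum_distrib_left S1_S2_S3_def)
  finally have *: "[(\<Sum>i<r. s i * periodM (dil i A)) = K * S2 + b * d * S1 + 3 * e * S3] (mod 24)" .
  have "24 dvd 3 * e * S3"
  proof (cases "r = 0")
    case True
    thus ?thesis by (simp add: S1_S2_S3_def)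
  next
    case False
    hence "odd d" using det_odd(2)[OF A'(2)] c by simp
    from eight_dvd_square_minus_1[OF this] obtain k where "d\<^sup>2 - 1 = 8 * k" by blast
    hence "e = 4 * k" by (simp add: e_def)
    moreover obtain l where "S3 = 2 * l" using s(3) unfolding S1_S2_S3_def by (elim evenE)
    ultimately show ?thesis by simp
  qed
  moreover have "24 dvd S1" "24 dvd S2" using s by (simp_all add: S1_S2_S3_def)
  ultimately have "24 dvd K * S2 + b * d * S1 + 3 * e * S3" by simp
  thus ?thesis using * cong_dvd_iff by blast
qed

section \<open>Integrality and parity of the exponents of an invariant product\<close>

lemma period_dvd_8:
  assumes "a * d - b * (2 * c) = 1" "8 dvd b" "8 dvd c" "8 dvd d - 1"
  shows "8 dvd period a b (2 * c) d"
proof -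
  obtain k where k: "d = 8 * k + 1" using assms(4) by (auto elim!: dvdE simp: diff_eq_eq)
  have "(d\<^sup>2 - 1) div 2 = 8 * (4 * k\<^sup>2 + k)" by (simp add: k power2_eq_square algebra_simps)
  moreover obtain b' c' where "b = 8 * b'" "c = 8 * c'" using assms by (auto elim!: dvdE)
  ultimately have "period_formula a b c d = 8 * (- (a + d) * c' + b' * d * (2 * c\<^sup>2 + 1) + 3 * c' * d + 3 * (4 * k\<^sup>2 + k))"
    by (simp add: period_formula_def algebra_simps)
  hence "8 dvd period_formula a b c d" by simp
  moreover have "24 dvd period a b (2 * c) d - period_formula a b c d"
    using period_formula_cong[OF assms(1)] by (simp add: cong_iff_dvd_diff)
  hence "8 dvd period a b (2 * c) d - period_formula a b c d"
    by (rule dvd_trans[rotated]) simp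
  ultimately show ?thesis using dvd_add[of 8 "period a b (2 * c) d - period_formula a b c d" "period_formula a b c d"] by simp
qed

lemma period_minus:
  assumes "a * d - b * c = 1" "even c"
  shows "period (-a) (-b) (-c) (-d) = period a b c d"
  by (intro period_eqI is_period_minus period assms)

text \<open>These are the powers of (3, -1; 4, -1), which fixes the cusp 1/2. This matrix is
  translation by 1 times the negative of (1, 0; -4, 1), hence has period 1 - 2 = -1.\<close>

lemma period_parabolic: "period (1 + 2 * n) (-n) (4 * n) (1 - 2 * n) = -n"
proof -
  have 3: "period 3 (-1) 4 (-1) = -1"
  proof -
    have "period (-1) 0 4 (-1) = -2"
      using period_minus[of 1 1 0 "-4"] period_V[of "-2"] by simp
    thus ?thesis using period_mult[of 1 1 1 0 "-1" "-1" 0 4] period_T[of 1] by simp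
  qed
  have step: "period (1 + 2 * (n + 1)) (-(n + 1)) (4 * (n + 1)) (1 - 2 * (n + 1)) = period (1 + 2 * n) (-n) (4 * n) (1 - 2 * n) - 1" for n
  proof -
    have det: "(1 + 2 * n) * (1 - 2 * n) - (-n) * (4 * n) = 1" by (simp add: algebra_simps)
    have eqs: "(1 + 2 * n) * 3 + (-n) * 4 = 1 + 2 * (n + 1)" "(1 + 2 * n) * (-1) + (-n) * (-1) = -(n + 1)"
      "4 * n * 3 + (1 - 2 * n) * 4 = 4 * (n + 1)" "4 * n * (-1) + (1 - 2 * n) * (-1) = 1 - 2 * (n + 1)"
      by simp_all
    have "period ((1 + 2 * n) * 3 + (-n) * 4) ((1 + 2 * n) * (-1) + (-n) * (-1)) (4 * n * 3 + (1 - 2 * n) * 4) (4 * n * (-1) + (1 - 2 * n) * (-1))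
      = period (1 + 2 * n) (-n) (4 * n) (1 - 2 * n) + period 3 (-1) 4 (-1)"
      by (rule period_mult[OF det]) auto
    thus ?thesis unfolding eqs 3 by simp
  qed
  show ?thesis
  proof (induction n rule: int_induct[where k = 0])
    case base
    show ?case using period_T[of 0] by simp
  next
    case (step1 i)
    thus ?case using step[of i] by simp
  next
    case (step2 i)
    thus ?case using step[of "i - 1"] by simp
  qed
qed

text \<open>The two matrices are conjugate by translation by 1/2. On the right stands a product of
  parabolic elements fixing 0 and y/5, with periods -50 and 2. The translation moves the fixed
  points to 1/2 and (2y+5)/10, thus from one cusp of \<open>\<Gamma>\<^sub>0(2)\<close> to the
  other, and the periods become 25 and -1. The difference is 24 - (-48) = 72.\<close>

lemma period_noncongruence:
  assumes y: "coprime 5 (4 * y)"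
  shows "period (1 - 980 * y) (480 * y + 196 * y\<^sup>2) (-2000 * y) (1 + 980 * y + 400 * y\<^sup>2)
    = period (1 + 20 * y) (-4 * y\<^sup>2) (-2000 * y) (1 - 20 * y + 400 * y\<^sup>2) + 72"
proof -
  obtain u v where "u * 5 + v * (4 * y) = gcd 5 (4 * y)" using bezout_int by blast
  hence uv: "5 * u + 4 * y * v = 1" using y by (simp add: algebra_simps)
  hence "odd u" by (metis dvd_add_right_iff dvd_mult dvd_triv_left even_mult_iff even_numeral odd_one mult.assoc mult_2 numeral_Bit0)
  hence "even (5 - u)" by simp
  then obtain h where "5 - u = 2 * h" by (elim evenE)
  hence h: "u = 5 - 2 * h" by simp
  define w where "w = - v"
  have rel: "12 - 5 * h = 2 * y * w" using uv by (simp add: h w_def)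
  \<comment> \<open>\<open>D\<close> sends the cusp 0 to y/5. \<open>D'\<close> is its conjugate by
    translation by 1/2, integral because u is odd, and sends 1/2 to (2y+5)/10.\<close>
  define D where "D = mat2 u y (4 * w) 5"
  define D' where "D' = mat2 (u + 2 * w) (y + h - w) (4 * w) (5 - 2 * w)"
  have D: "D \<in> Gamma0 2" using uv by (auto simp: D_def mat2_in_Gamma0 w_def algebra_simps)
  have "(u + 2 * w) * (5 - 2 * w) - (y + h - w) * (4 * w) = 25 - 10 * h - 4 * y * w"
    by (simp add: h algebra_simps)
  also have "\<dots> = 1" using rel by simp
  finally have D': "D' \<in> Gamma0 2" by (auto simp: D'_def mat2_in_Gamma0)
  have 1: "D ** mat2 1 0 4 1 ** minv D = mat2 (1 + 20 * y) (-4 * y\<^sup>2) 100 (1 - 20 * y)"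
    unfolding D_def minv_mat2 mat2_mult using uv by (simp add: mat2_eq_iff w_def algebra_simps power2_eq_square)
  have "period 1 0 4 1 = 2" using period_V[of 2] by simp
  hence p1: "period (1 + 20 * y) (-4 * y\<^sup>2) 100 (1 - 20 * y) = 2"
    using periodM_conj[OF D, of "mat2 1 0 4 1"] unfolding 1 by (simp add: mat2_in_Gamma0)
  have "u + 2 * w + 2 * (y + h - w) = 2 * y + 5" by (simp add: h)
  have 2: "D' ** mat2 3 (-1) 4 (-1) ** minv D' = mat2 (51 + 20 * y) (-((2 * y + 5)\<^sup>2)) 100 (-49 - 20 * y)"
    unfolding D'_def minv_mat2 mat2_mult using rel by (simp add: mat2_eq_iff h algebra_simps power2_eq_square)
  have "period 3 (-1) 4 (-1) = -1" using period_parabolic[of 1] by simp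
  hence p2: "period (51 + 20 * y) (-((2 * y + 5)\<^sup>2)) 100 (-49 - 20 * y) = -1"
    using periodM_conj[OF D', of "mat2 3 (-1) 4 (-1)"] unfolding 2 by (simp add: mat2_in_Gamma0)
  \<comment> \<open>The product of (1, 0; -100, 1) with the parabolic element at y/5; the translated
    counterpart of this factorisation follows below.\<close>
  have "period (1 + 20 * y) (-4 * y\<^sup>2) (-2000 * y) (1 - 20 * y + 400 * y\<^sup>2)
     = period 1 0 (2 * (-50)) 1 + period (1 + 20 * y) (-4 * y\<^sup>2) 100 (1 - 20 * y)"
    using period_mult[of 1 1 0 "2 * (-50)" "1 + 20 * y" "1 - 20 * y" "-4 * y\<^sup>2" 100]
    by (simp add: algebra_simps power2_eq_square)
  moreover have "period (-49) 25 (-100) 51 = 25" using period_parabolic[of "-25"] by simp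
  moreover have "period (1 - 980 * y) (480 * y + 196 * y\<^sup>2) (-2000 * y) (1 + 980 * y + 400 * y\<^sup>2)
     = period (-49) 25 (-100) 51 + period (51 + 20 * y) (-((2 * y + 5)\<^sup>2)) 100 (-49 - 20 * y)"
    using period_mult[of "-49" 51 25 "-100" "51 + 20 * y" "-49 - 20 * y" "-((2 * y + 5)\<^sup>2)" 100]
    by (simp add: algebra_simps power2_eq_square)
  ultimately show ?thesis using p1 p2 period_V[of "-50"] by simp
qed

lemma period_conj_T:
  assumes "a * d - b * c = 1" "even c"
  shows "period (a + n * c) (b + n * (d - a) - n\<^sup>2 * c) c (d - n * c) = period a b c d"
proof -
  have A: "mat2 a b c d \<in> Gamma0 2" using assms by (simp add: mat2_in_Gamma0)
  have T: "mat2 1 n 0 1 \<in> Gamma0 2" by (simp add: mat2_in_Gamma0)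
  show ?thesis using periodM_conj[OF T A] by (simp add: mat2_mult algebra_simps power2_eq_square)
qed

lemma dyadic_Ints:
  fixes x :: real
  assumes "9 * x \<in> \<int>" "2 ^ n * x \<in> \<int>"
  shows "x \<in> \<int>"
proof -
  have "coprime (9::int) (2 ^ n)" by (simp add: coprime_power_right_iff)
  then obtain u v where "u * 9 + v * 2 ^ n = (1::int)" using bezout_int[of 9 "2 ^ n"] by auto
  hence "real_of_int (u * 9 + v * 2 ^ n) = 1" by simp
  hence "x = (of_int u * 9 + of_int v * 2 ^ n) * x" by simp
  also have "\<dots> = of_int u * (9 * x) + of_int v * (2 ^ n * x)" by (simp add: algebra_simps)
  also have "\<dots> \<in> \<int>" using assms by auto
  finally show ?thesis .
qed

text \<open>Two matrices of \<open>\<Gamma>\<^sub>0(2\<^sup>r)\<close> are chosen such that their dilations by \<open>2\<^sup>i\<close> have the same period for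
  \<open>i > j\<close>, but periods that differ by \<open>72 = 3 \<cdot> 24\<close> for \<open>i = j\<close>. Thus \<open>3 s\<^sub>j\<close> is an integer, and so is \<open>s\<^sub>j\<close>
  because its denominator is a power of 2.\<close>

lemma exponents_integral:
  fixes s :: "nat \<Rightarrow> real"
  assumes s: "\<And>A. A \<in> Gamma0 (2 ^ r) \<Longrightarrow> \<exists>k::int. (\<Sum>i<r. s i * periodM (dil i A)) = 24 * k"
    and dyadic: "\<And>i. i < r \<Longrightarrow> \<exists>n. 2 ^ n * s i \<in> \<int>"
    and "j < r"
  shows "s j \<in> \<int>"
  using \<open>j < r\<close>
proof (induction j rule: less_induct)
  case (less j)
  define w y :: int where "w = 2 ^ r" "y = 2 ^ j * w"
  \<comment> \<open>\<open>A'\<close> is the conjugate of \<open>A\<close> by translation by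
    \<open>1 / 2 ^ (j + 1)\<close>. Dilation by \<open>2 ^ i\<close> turns this into translation by
    \<open>2 ^ i / 2 ^ (j + 1)\<close>, which is integral and leaves the period unchanged for i > j,
    and equals 1/2 for i = j, the case of \<open>period_noncongruence\<close>. The factor
    \<open>2 ^ r\<close> in w puts both matrices into the group.\<close>
  define A where "A = mat2 (1 + 20 * y) (-4 * y * w) (2 ^ j * (-2000 * y)) (1 - 20 * y + 400 * y\<^sup>2)"
  define A' where "A' = mat2 (1 - 980 * y) (480 * w + 196 * y * w) (2 ^ j * (-2000 * y)) (1 + 980 * y + 400 * y\<^sup>2)"
  have dvd: "2 ^ r dvd 2 ^ j * (-2000 * y)" by (simp add: w_y_def)
  have ev: "even w" "even y" using \<open>j < r\<close> by (auto simp: w_y_def)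
  have detA: "(1 + 20 * y) * (1 - 20 * y + 400 * y\<^sup>2) - (-4 * y * w) * (2 ^ j * (-2000 * y)) = 1"
    by (simp add: w_y_def(2) algebra_simps power2_eq_square)
  have detA': "(1 - 980 * y) * (1 + 980 * y + 400 * y\<^sup>2) - (480 * w + 196 * y * w) * (2 ^ j * (-2000 * y)) = 1"
    by (simp add: w_y_def(2) algebra_simps power2_eq_square)
  have A: "A \<in> Gamma0 (2 ^ r)" "A' \<in> Gamma0 (2 ^ r)"
    using detA detA' dvd by (simp_all add: A_def A'_def mat2_in_Gamma0)
  define \<delta> where "\<delta> = (\<lambda>i. periodM (dil i A') - periodM (dil i A))"
  obtain k :: int where k: "(\<Sum>i<r. s i * periodM (dil i A)) = 24 * real_of_int k"
    using s[OF A(1)] by blast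
  obtain k' :: int where k': "(\<Sum>i<r. s i * periodM (dil i A')) = 24 * real_of_int k'"
    using s[OF A(2)] by blast
  have sum: "(\<Sum>i<r. s i * \<delta> i) = 24 * (k' - k)"
    using k k' by (simp add: \<delta>_def algebra_simps sum_subtractf)
  have gt: "\<delta> i = 0" if i: "i > j" "i < r" for i
  proof -
    define n :: int where "n = 2 ^ (i - j - 1)"
    have pi: "(2::int) ^ i = 2 ^ j * (2 * n)" unfolding n_def using power_2_split[OF i(1)] by simp
    have "(2::int) ^ r = 2 ^ i * 2 ^ (r - i)" using i by (simp flip: power_add)
    then obtain z where z: "w = 2 * n * z" using pi unfolding w_y_def
      by (metis mult.assoc mult.commute)
    define c where "c = -2000 * (2 ^ j * z)"
    have yz: "y = 2 ^ j * (2 * n * z)" unfolding w_y_def(2) z ..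
    have c: "2 ^ j * (-2000 * y) = 2 ^ i * c" unfolding yz pi c_def by (simp add: algebra_simps)
    have nc: "n * c = - 1000 * y" by (simp add: yz c_def algebra_simps)
    have hy: "y = 2 ^ j * w" by (simp add: w_y_def)
    have e1: "1 + 20 * y + n * c = 1 - 980 * y" using nc by simp
    have e3: "1 - 20 * y + 400 * y\<^sup>2 - n * c = 1 + 980 * y + 400 * y\<^sup>2" using nc by simp
    have nnc: "n\<^sup>2 * c = n * (- 1000 * y)" by (simp only: power2_eq_square mult.assoc nc)
    have e2: "2 ^ i * (- 4 * y * w) + n * ((1 - 20 * y + 400 * y\<^sup>2) - (1 + 20 * y)) - n\<^sup>2 * c = 2 ^ i * (480 * w + 196 * y * w)"
      unfolding nnc pi by (simp add: hy algebra_simps power2_eq_square)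
    have "(1 + 20 * y) * (1 - 20 * y + 400 * y\<^sup>2) - 2 ^ i * (- 4 * y * w) * c = 1"
      unfolding mult.assoc[of "2 ^ i" "- 4 * y * w"] mult.left_commute[of "2 ^ i" "- 4 * y * w"] c[symmetric] by (rule detA)
    moreover have "even c" by (simp add: c_def)
    ultimately show ?thesis
      unfolding \<delta>_def A_def A'_def c dil_mat2 periodM_mat2
      using period_conj_T[of "1 + 20 * y" "1 - 20 * y + 400 * y\<^sup>2" "2 ^ i * (- 4 * y * w)" c n, unfolded e1 e2 e3] by simp
  qed
  have eq: "\<delta> j = 72"
  proof -
    have "coprime 5 (4 * y)"
      using coprime_power_right_iff[of "5::int" 2 "j + r"] coprime_power_right_iff[of "5::int" 2 2]
      by (simp add: w_y_def flip: power_add)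
    from period_noncongruence[OF this] show ?thesis
      unfolding \<delta>_def A_def A'_def dil_mat2 periodM_mat2 by (simp add: w_y_def power2_eq_square algebra_simps)
  qed
  have lt: "8 dvd \<delta> i" if i: "i < j" for i
  proof -
    have pj: "(2::int) ^ j = 2 ^ i * (2 * 2 ^ (j - i - 1))" using power_2_split[OF i] by simp
    define c where "c = 2 ^ (j - i - 1) * (-2000 * y)"
    have c: "2 ^ j * (-2000 * y) = 2 ^ i * (2 * c)" unfolding pj c_def by simp
    obtain w' y' where w': "w = 2 * w'" "y = 2 * y'" using ev by (auto elim!: evenE)
    have "8 dvd periodM (dil i A)"
      unfolding A_def c dil_mat2 periodM_mat2
    proof (rule period_dvd_8)
      show "(1 + 20 * y) * (1 - 20 * y + 400 * y\<^sup>2) - 2 ^ i * (- 4 * y * w) * (2 * c) = 1"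
        unfolding mult.assoc[of "2 ^ i" "- 4 * y * w"] mult.left_commute[of "2 ^ i" "- 4 * y * w"] c[symmetric] by (rule detA)
      show "8 dvd 2 ^ i * (- 4 * y * w)" by (simp add: w')
      show "8 dvd c" by (simp add: c_def)
      show "8 dvd 1 - 20 * y + 400 * y\<^sup>2 - 1" by (simp add: w' power2_eq_square)
    qed
    moreover have "8 dvd periodM (dil i A')"
      unfolding A'_def c dil_mat2 periodM_mat2
    proof (rule period_dvd_8)
      show "(1 - 980 * y) * (1 + 980 * y + 400 * y\<^sup>2) - 2 ^ i * (480 * w + 196 * y * w) * (2 * c) = 1"
        unfolding mult.assoc[of "2 ^ i"] mult.left_commute[of "2 ^ i" "480 * w + 196 * y * w"] c[symmetric] by (rule detA')
      show "8 dvd 2 ^ i * (480 * w + 196 * y * w)"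
      proof (rule dvd_mult)
        have "480 * w + 196 * y * w = 8 * (120 * w' + 98 * y' * w')" by (simp add: w')
        thus "8 dvd 480 * w + 196 * y * w" by simp
      qed
      show "8 dvd c" by (simp add: c_def)
      show "8 dvd 1 + 980 * y + 400 * y\<^sup>2 - 1" by (simp add: w' power2_eq_square)
    qed
    ultimately show ?thesis by (simp add: \<delta>_def)
  qed
  have "(\<Sum>i<r. s i * \<delta> i) = (\<Sum>i\<le>j. s i * \<delta> i)"
    using \<open>j < r\<close> gt by (intro sum.mono_neutral_right) auto
  also have "\<dots> = 72 * s j + (\<Sum>i<j. s i * \<delta> i)"
    by (simp add: eq lessThan_Suc_atMost[symmetric])
  \<comment> \<open>The periods for i < j are known only to differ by multiples of 8, so the
    relation is divided by 8 rather than by 24. The remaining factor 9 is odd, which suffices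
    against a denominator that is a power of 2.\<close>
  finally have *: "9 * s j = 3 * (k' - k) - (\<Sum>i<j. s i * (\<delta> i / 8))"
    using sum by (simp add: sum_divide_distrib[symmetric])
  have "9 * s j \<in> \<int>"
    unfolding *
  proof (intro Ints_diff Ints_mult Ints_sum)
    fix i assume i: "i \<in> {..<j}"
    show "s i \<in> \<int>" using less.IH[of i] i less.prems by auto
    show "real_of_int (\<delta> i) / 8 \<in> \<int>" using lt[of i] i by auto
  qed auto
  moreover obtain n where "2 ^ n * s j \<in> \<int>" using dyadic less.prems by blast
  ultimately show ?case by (rule dyadic_Ints)
qed

text \<open>For a matrix with lower right entry 5 and off-diagonal entries highly divisible by 2,
  all terms of the period formula vanish modulo 8 except
  \<open>3 * ((5\<^sup>2 - 1) div 2) = 36\<close>. Every dilation then has period 4 modulo 8, and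
  the weighted sum is four times the sum of the exponents.\<close>

lemma exponents_even:
  fixes s :: "nat \<Rightarrow> int"
  assumes s: "\<And>A. A \<in> Gamma0 (2 ^ r) \<Longrightarrow> 24 dvd (\<Sum>i<r. s i * periodM (dil i A))"
  shows "even (\<Sum>i<r. s i)"
proof -
  have "coprime (5::int) (2 ^ (r + 7))" by (simp add: coprime_power_right_iff)
  then obtain u v where uv: "u * 5 + v * 2 ^ (r + 7) = (1::int)" using bezout_int[of 5 "2 ^ (r + 7)"] by auto
  define A where "A = mat2 u (-8 * v) (2 ^ (r + 4)) 5"
  have det: "u * 5 - (-8 * v) * 2 ^ (r + 4) = 1" using uv by (simp add: power_add)
  have A: "A \<in> Gamma0 (2 ^ r)" using det by (simp add: A_def mat2_in_Gamma0 power_add)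
  have p: "[periodM (dil i A) = 4] (mod 8)" if i: "i < r" for i
  proof -
    define c :: int where "c = 8 * 2 ^ (r - i)"
    have "(2::int) ^ r = 2 ^ i * 2 ^ (r - i)" using i by (simp flip: power_add)
    hence c: "2 ^ (r + 4) = 2 ^ i * (2 * c)" by (simp add: c_def power_add)
    have "24 dvd period u (2 ^ i * (-8 * v)) (2 * c) 5 - period_formula u (2 ^ i * (-8 * v)) c 5"
      using period_formula_cong[of u 5 "2 ^ i * (-8 * v)" c] det unfolding c by (simp add: cong_iff_dvd_diff algebra_simps)
    hence "8 dvd period u (2 ^ i * (-8 * v)) (2 * c) 5 - period_formula u (2 ^ i * (-8 * v)) c 5"
      by (rule dvd_trans[rotated]) simp
    moreover have "8 dvd period_formula u (2 ^ i * (-8 * v)) c 5 - 4"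
    proof -
      have "period_formula u (2 ^ i * (-8 * v)) c 5 - 4 = 8 * (- (u + 5) * 2 ^ (r - i) - 2 ^ i * v * 5 * (2 * c\<^sup>2 + 1) + 15 * 2 ^ (r - i) + 4)"
        by (simp add: period_formula_def c_def algebra_simps)
      thus ?thesis by simp
    qed
    ultimately have "8 dvd period u (2 ^ i * (-8 * v)) (2 * c) 5 - 4" using dvd_add by fastforce
    thus ?thesis unfolding A_def c dil_mat2 periodM_mat2 by (simp add: cong_iff_dvd_diff)
  qed
  have "[(\<Sum>i<r. s i * periodM (dil i A)) = (\<Sum>i<r. s i * 4)] (mod 8)"
    by (intro cong_sum cong_mult cong_refl p) auto
  moreover have "8 dvd (\<Sum>i<r. s i * periodM (dil i A))" using s[OF A] by (rule dvd_trans[rotated]) simp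
  ultimately have "8 dvd (\<Sum>i<r. s i * 4)" using cong_dvd_iff by blast
  also have "(\<Sum>i<r. s i * 4) = (\<Sum>i<r. s i) * 4" by (simp add: sum_distrib_right)
  finally show ?thesis by presburger
qed

section \<open>Orders of eta quotients at the cusps\<close>

text \<open>A logarithm of the product of the \<open>\<eta>(2\<^sup>i\<^sup>+\<^sup>1 \<tau>) /
  \<eta>(2\<^sup>i \<tau>)\<close> to the powers \<open>s i\<close>. The exponents are real because
  they are not yet known to be integers when a given modular function is compared with such a
  product.\<close>

definition lquot :: "nat \<Rightarrow> (nat \<Rightarrow> real) \<Rightarrow> complex \<Rightarrow> complex" where
  "lquot r s t = (\<Sum>i<r. of_real (s i) * lweber (2 ^ i * t))"

lemma Im_pow2_mult [simp]: "Im (2 ^ i * t) = 2 ^ i * Im t"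
proof -
  have "(2::complex) ^ i = of_real (2 ^ i)" by simp
  thus ?thesis by (simp only: times_complex.sel Im_complex_of_real Re_complex_of_real)
qed

lemma holomorphic_lquot:
  assumes "f holomorphic_on S" "\<And>z. z \<in> S \<Longrightarrow> Im (f z) > 0"
  shows "(\<lambda>z. lquot r s (f z)) holomorphic_on S"
  unfolding lquot_def
  by (intro holomorphic_intros holomorphic_lweber assms) (use assms in auto)

lemma lquot_Gamma0:
  fixes s :: "nat \<Rightarrow> real"
  assumes "A \<in> Gamma0 (2 ^ r)" "Im t > 0"
  shows "lquot r s (mobius A t) = lquot r s t + pi * \<i> / 12 * of_real (\<Sum>i<r. s i * periodM (dil i A))"
proof -
  have "lweber (2 ^ i * mobius A t) = lweber (2 ^ i * t) + pi * \<i> / 12 * of_int (periodM (dil i A))" if "i < r" for i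
    using mobius_dil[OF assms(1), of i] that assms(2) lweber_periodM[OF dil_in_Gamma0_2[OF assms(1) that]] by simp
  thus ?thesis by (simp add: lquot_def sum_distrib_left sum.distrib distrib_left algebra_simps)
qed

abbreviation at_i_inf :: "complex filter" where
  "at_i_inf \<equiv> filtercomap Im at_top"

lemma eventually_at_i_inf: "eventually P at_i_inf \<longleftrightarrow> (\<exists>y. \<forall>t. Im t > y \<longrightarrow> P t)"
  unfolding eventually_filtercomap eventually_at_top_dense by blast

lemma at_i_inf_nontrivial [simp]: "at_i_inf \<noteq> bot"
proof -
  have "Im (Complex 0 (y + 1)) > y" for y by simp
  thus ?thesis unfolding trivial_limit_def eventually_at_i_inf by blast
qed

lemma at_i_inf_pos: "eventually (\<lambda>t. Im t > 0) at_i_inf"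
  unfolding eventually_at_i_inf by auto

lemma filterlim_at_i_inf_affine:
  assumes "p > 0"
  shows "filterlim (\<lambda>t. of_real p * t + q) at_i_inf at_i_inf"
  unfolding filterlim_iff
proof (intro allI impI)
  fix P assume "eventually P at_i_inf"
  then obtain y where y: "\<And>t. Im t > y \<Longrightarrow> P t" unfolding eventually_at_i_inf by blast
  have "P (of_real p * t + q)" if "Im t > (y - Im q) / p" for t
    using that assms by (intro y) (simp add: field_simps)
  thus "eventually (\<lambda>t. P (of_real p * t + q)) at_i_inf" unfolding eventually_at_i_inf by blast
qed

lemma lweber_asymp_affine:
  assumes "p > 0"
  shows "((\<lambda>t. lweber (of_real p * t + q) - pi * \<i> * (of_real p * t) / 12) \<longlongrightarrow> pi * \<i> * q / 12) at_i_inf"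
proof -
  have "((\<lambda>t. lweber (of_real p * t + q) - pi * \<i> * (of_real p * t + q) / 12) \<longlongrightarrow> 0) at_i_inf"
    by (rule filterlim_compose[OF lweber_asymp filterlim_at_i_inf_affine[OF assms]])
  from tendsto_add[OF this tendsto_const[of "pi * \<i> * q / 12"]] show ?thesis
    by (simp add: algebra_simps add_divide_distrib)
qed

text \<open>The exponent of 2 in c, capped at r, so that c = 0 has level exponent r. For c the lower
  left entry of A it gives the level of the cusp \<open>act A Infty\<close>.\<close>

definition is_level :: "nat \<Rightarrow> int \<Rightarrow> nat \<Rightarrow> bool" where
  "is_level r c k \<longleftrightarrow> k \<le> r \<and> 2 ^ k dvd c \<and> (k < r \<longrightarrow> \<not> 2 ^ Suc k dvd c)"

lemma is_level_exists: "\<exists>k. is_level r c k"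
proof -
  define S where "S = {k. k \<le> r \<and> 2 ^ k dvd c}"
  have fin: "finite S" by (rule finite_subset[of _ "{..r}"]) (auto simp: S_def)
  have "0 \<in> S" by (simp add: S_def)
  hence M: "Max S \<in> S" using Max_in[OF fin] by blast
  have "\<not> 2 ^ Suc (Max S) dvd c" if "Max S < r"
  proof
    assume "2 ^ Suc (Max S) dvd c"
    hence "Suc (Max S) \<in> S" using that by (simp add: S_def)
    hence "Suc (Max S) \<le> Max S" using Max_ge[OF fin] by blast
    thus False by simp
  qed
  thus ?thesis using M unfolding is_level_def S_def by blast
qed

lemma is_level_unique:
  assumes "is_level r c k" "is_level r c l"
  shows "k = l"
proof -
  have "\<not> k < l" if "is_level r c k" "is_level r c l" for k l
  proof
    assume "k < l"
    hence "(2::int) ^ Suc k dvd 2 ^ l" by (intro le_imp_power_dvd) simp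
    thus False using that \<open>k < l\<close> by (auto simp: is_level_def dest: dvd_trans)
  qed
  thus ?thesis using assms linorder_neqE_nat by metis
qed

text \<open>24 times the order, in terms of \<open>ee t\<close>, of
  \<open>\<eta>(2\<^sup>i\<^sup>+\<^sup>1 \<tau>) / \<eta>(2\<^sup>i \<tau>)\<close> at a cusp of
  level \<open>2\<^sup>k\<close>.\<close>

definition order_coeff :: "nat \<Rightarrow> nat \<Rightarrow> real" where
  "order_coeff k i = (if i < k then 2 ^ i else - (4 ^ k / 2 ^ Suc i))"

text \<open>The two cases correspond to the two cusps of \<open>\<Gamma>\<^sub>0(2)\<close>. For i <
  k the dilation of A lies in that group and only adds a period. Otherwise the dilated argument is
  the image, under some element of the group, of -1/\<sigma> with \<sigma> affine in t, and
  \<open>lweber_fricke\<close> replaces the logarithm by its negative at \<sigma>/2.\<close>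

lemma lweber_cusp:
  assumes "A \<in> SL2Z" "is_level r (entry A 2 1) k" "i < r"
  shows "\<exists>C. ((\<lambda>t. lweber (2 ^ i * mobius A t) - pi * \<i> * (of_real (order_coeff k i) * t) / 12) \<longlongrightarrow> C) at_i_inf"
proof -
  obtain a b c d where A: "A = mat2 a b c d" "a * d - b * c = 1" by (rule SL2Z_cases[OF assms(1)])
  have lev: "is_level r c k" using assms(2) by (simp add: A)
  show ?thesis
  proof (cases "i < k")
    case True
    have "(2::int) ^ Suc i dvd 2 ^ k" by (rule le_imp_power_dvd) (use True in simp)
    hence "2 ^ Suc i dvd c" using lev unfolding is_level_def by (auto dest: dvd_trans)
    hence AG: "A \<in> Gamma0 (2 ^ Suc i)" using A(2) by (simp add: A(1) mat2_in_Gamma0)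
    have "((\<lambda>t. lweber (of_real (2 ^ i) * t + 0) - pi * \<i> * (of_real (2 ^ i) * t) / 12 + pi * \<i> / 12 * of_int (periodM (dil i A)))
        \<longlongrightarrow> pi * \<i> * 0 / 12 + pi * \<i> / 12 * of_int (periodM (dil i A))) at_i_inf"
      by (intro tendsto_add lweber_asymp_affine tendsto_const) simp
    moreover have "eventually (\<lambda>t. lweber (of_real (2 ^ i) * t + 0) - pi * \<i> * (of_real (2 ^ i) * t) / 12 + pi * \<i> / 12 * of_int (periodM (dil i A))
        = lweber (2 ^ i * mobius A t) - pi * \<i> * (of_real (order_coeff k i) * t) / 12) at_i_inf"
      using at_i_inf_pos
    proof eventually_elim
      case (elim t)
      have "lweber (2 ^ i * mobius A t) = lweber (2 ^ i * t) + pi * \<i> / 12 * of_int (periodM (dil i A))"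
        using mobius_dil[OF AG, of i] elim lweber_periodM[OF dil_in_Gamma0_2[OF AG]] by simp
      thus ?case using True by (simp add: order_coeff_def)
    qed
    ultimately show ?thesis by - (rule exI, erule Lim_transform_eventually)
  next
    case False
    hence k: "k < r" "k \<le> i" using assms(3) by auto
    obtain u where u: "c = 2 ^ k * u" using lev unfolding is_level_def by blast
    have "odd u" using lev k unfolding is_level_def u by simp
    define n where "n = i - k"
    have pi: "(2::int) ^ i = 2 ^ k * 2 ^ n" using k by (simp add: n_def flip: power_add)
    have pi': "(2::complex) ^ i = 2 ^ k * 2 ^ n" using k by (simp add: n_def flip: power_add)
    have "coprime u (2 ^ n)" using \<open>odd u\<close> by (simp add: coprime_power_right_iff coprime_right_2_iff_odd)
    then obtain x1 y1 where "x1 * u + y1 * 2 ^ n = 1" using bezout_int[of u "2 ^ n"] by auto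
    hence xy: "u * (x1 * d) + 2 ^ n * (y1 * d) = d" by (metis distrib_right mult.assoc mult.commute mult_1)
    define \<beta> y where "\<beta> = x1 * d" "y = y1 * d"
    have d: "u * \<beta> + 2 ^ n * y = d" using xy by (simp add: \<beta>_y_def)
    define p x where "p = 2 ^ n * a" "x = 2 ^ k * b - a * \<beta>"
    have det: "p * y - x * u = 1"
      using A(2) unfolding p_x_def u d[symmetric] by (simp add: algebra_simps)
    \<comment> \<open>(p, x; u, y) times the translation by -y times the inversion. The translation
      makes the lower left entry \<open>y * (u - 1)\<close>, which is even because u is odd.\<close>
    define \<gamma>' where "\<gamma>' = mat2 (y * p - x) p (y * u - y) u"
    have \<gamma>': "\<gamma>' \<in> Gamma0 2"
    proof -
      have "(y * p - x) * u - p * (y * u - y) = p * y - x * u" by (simp add: algebra_simps)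
      thus ?thesis using det \<open>odd u\<close> by (simp add: \<gamma>'_def mat2_in_Gamma0)
    qed
    obtain C where C: "\<And>t. Im t > 0 \<Longrightarrow> lweber (-1/t) = C - lweber (t/2)" using lweber_fricke by blast
    define p' q' where "p' = 4 ^ k / (2::real) ^ Suc i" "q' = (of_int \<beta> / 2 ^ n + of_int y) / (2::complex)"
    have p': "p' > 0" by (simp add: p'_q'_def)
    have main: "lweber (2 ^ i * mobius A t) = C + pi * \<i> / 12 * of_int (periodM \<gamma>') - lweber (of_real p' * t + q')" if t: "Im t > 0" for t
    proof -
      define \<sigma> where "\<sigma> = (2 ^ k * t + of_int \<beta>) / 2 ^ n + of_int y"
      have "Im ((2 ^ k * t + of_int \<beta>) / 2 ^ n) > 0"
      proof -
        have "Im ((2 ^ k * t + of_int \<beta>) / of_real (2 ^ n)) = 2 ^ k * Im t / 2 ^ n" by (simp only: Im_divide_of_real) simp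
        thus ?thesis using t by simp
      qed
      hence \<sigma>: "Im \<sigma> > 0" by (simp add: \<sigma>_def)
      hence \<sigma>0: "\<sigma> \<noteq> 0" by auto
      have \<sigma>n: "2 ^ n * \<sigma> = 2 ^ k * t + of_int \<beta> + 2 ^ n * of_int y" by (simp add: \<sigma>_def field_simps)
      have nz: "of_int c * t + of_int d \<noteq> 0" by (rule mobius_denom_nonzero[OF A(2) t])
      have e1: "of_int p * \<sigma> - (of_int y * of_int p - of_int x) = 2 ^ k * (of_int a * t + of_int b)"
      proof -
        have "of_int p * \<sigma> = of_int a * (2 ^ n * \<sigma>)" by (simp add: p_x_def)
        thus ?thesis unfolding \<sigma>n by (simp add: p_x_def algebra_simps)
      qed
      have e2: "2 ^ n * (of_int u * \<sigma> - (of_int y * of_int u - of_int y)) = of_int c * t + of_int d"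
      proof -
        have "2 ^ n * (of_int u * \<sigma> - (of_int y * of_int u - of_int y)) = of_int u * (2 ^ n * \<sigma>) - 2 ^ n * (of_int y * of_int u - of_int y)"
          by (simp add: algebra_simps)
        thus ?thesis unfolding \<sigma>n by (simp add: u d[symmetric] algebra_simps)
      qed
      have "2 ^ i * mobius A t = (2 ^ n * (2 ^ k * (of_int a * t + of_int b))) / (of_int c * t + of_int d)"
        by (simp add: A(1) mobius_mat2 pi' mult_ac)
      also have "\<dots> = (of_int p * \<sigma> - (of_int y * of_int p - of_int x)) / (of_int u * \<sigma> - (of_int y * of_int u - of_int y))"
        unfolding e1[symmetric] e2[symmetric] by simp
      also have "\<dots> = ((of_int y * of_int p - of_int x) * (-1/\<sigma>) + of_int p) / ((of_int y * of_int u - of_int y) * (-1/\<sigma>) + of_int u)"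
      proof -
        have "(of_int y * of_int p - of_int x) * (-1/\<sigma>) + of_int p = (of_int p * \<sigma> - (of_int y * of_int p - of_int x)) / \<sigma>"
          "(of_int y * of_int u - of_int y) * (-1/\<sigma>) + of_int u = (of_int u * \<sigma> - (of_int y * of_int u - of_int y)) / \<sigma>"
          using \<sigma>0 by (simp_all add: field_simps)
        thus ?thesis using \<sigma>0 by simp
      qed
      also have "\<dots> = mobius \<gamma>' (-1/\<sigma>)" by (simp add: \<gamma>'_def mobius_mat2)
      finally have "lweber (2 ^ i * mobius A t) = lweber (-1/\<sigma>) + pi * \<i> / 12 * of_int (periodM \<gamma>')"
        using lweber_periodM[OF \<gamma>' Im_minus_inverse_pos[OF \<sigma>]] by simp
      also have "lweber (-1/\<sigma>) = C - lweber (\<sigma>/2)" by (rule C[OF \<sigma>])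
      also have "\<sigma> / 2 = of_real p' * t + q'"
      proof -
        have "(4::complex) ^ k = 2 ^ k * 2 ^ k" by (simp add: power_mult_distrib[symmetric])
        hence "of_real p' = 2 ^ k / 2 ^ n / (2::complex)" by (simp add: p'_q'_def pi')
        thus ?thesis by (simp add: \<sigma>_def p'_q'_def field_simps)
      qed
      finally show ?thesis by simp
    qed
    have "((\<lambda>t. C + pi * \<i> / 12 * of_int (periodM \<gamma>') - (lweber (of_real p' * t + q') - pi * \<i> * (of_real p' * t) / 12))
        \<longlongrightarrow> C + pi * \<i> / 12 * of_int (periodM \<gamma>') - pi * \<i> * q' / 12) at_i_inf"
      by (intro tendsto_intros lweber_asymp_affine p')
    moreover have "eventually (\<lambda>t. C + pi * \<i> / 12 * of_int (periodM \<gamma>') - (lweber (of_real p' * t + q') - pi * \<i> * (of_real p' * t) / 12)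
        = lweber (2 ^ i * mobius A t) - pi * \<i> * (of_real (order_coeff k i) * t) / 12) at_i_inf"
      using at_i_inf_pos
    proof eventually_elim
      case (elim t)
      have "order_coeff k i = - p'" using False by (simp add: order_coeff_def p'_q'_def)
      thus ?case using main[OF elim] by simp
    qed
    ultimately show ?thesis by - (rule exI, erule Lim_transform_eventually)
  qed
qed

text \<open>Measured in \<open>ee t\<close>; multiplication by the width of the cusp gives the order
  in the local coordinate.\<close>

definition quot_order :: "nat \<Rightarrow> (nat \<Rightarrow> real) \<Rightarrow> nat \<Rightarrow> real" where
  "quot_order r s k = (\<Sum>i<r. s i * order_coeff k i) / 24"

lemma lquot_cusp:
  assumes "A \<in> SL2Z" "is_level r (entry A 2 1) k"
  obtains C where "((\<lambda>t. lquot r s (mobius A t) - 2 * pi * \<i> * (of_real (quot_order r s k) * t)) \<longlongrightarrow> C) at_i_inf"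
proof -
  obtain C where C: "\<And>i. i < r \<Longrightarrow> ((\<lambda>t. lweber (2 ^ i * mobius A t) - pi * \<i> * (of_real (order_coeff k i) * t) / 12) \<longlongrightarrow> C i) at_i_inf"
    using lweber_cusp[OF assms] by metis
  have "((\<lambda>t. \<Sum>i<r. of_real (s i) * (lweber (2 ^ i * mobius A t) - pi * \<i> * (of_real (order_coeff k i) * t) / 12)) \<longlongrightarrow> (\<Sum>i<r. of_real (s i) * C i)) at_i_inf"
    by (intro tendsto_intros C) auto
  moreover have "(\<Sum>i<r. of_real (s i) * (lweber (2 ^ i * mobius A t) - pi * \<i> * (of_real (order_coeff k i) * t) / 12))
    = lquot r s (mobius A t) - 2 * pi * \<i> * (of_real (quot_order r s k) * t)" for t
  proof -
    have "(\<Sum>i<r. of_real (s i) * (pi * \<i> * (of_real (order_coeff k i) * t) / 12)) = (\<Sum>i<r. pi * \<i> / 12 * t * of_real (s i * order_coeff k i))"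
      by (intro sum.cong) auto
    also have "\<dots> = pi * \<i> / 12 * t * of_real (\<Sum>i<r. s i * order_coeff k i)"
      by (simp only: sum_distrib_left of_real_sum)
    also have "\<dots> = 2 * pi * \<i> * (of_real (quot_order r s k) * t)" by (simp add: quot_order_def)
    finally show ?thesis by (simp add: lquot_def right_diff_distrib sum_subtractf)
  qed
  ultimately show ?thesis using that by simp
qed

section \<open>Widths of cusps and expansions in the local coordinate\<close>

lemma translation_eq: "vector [vector [1, int h], vector [0, 1]] = mat2 1 (int h) 0 1"
  by (simp add: mat2_def)

text \<open>The equation determines B as the conjugate of the translation by A, and the lower left
  entry of this conjugate is \<open>- (c\<^sup>2 * h)\<close>.\<close>

lemma exists_Gamma0_translation_iff:
  assumes "A \<in> SL2Z"
  shows "(\<exists>B\<in>Gamma0 N. B ** A = A ** mat2 1 h 0 1) \<longleftrightarrow> int N dvd (entry A 2 1)\<^sup>2 * h"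
proof -
  obtain a b c d where A: "A = mat2 a b c d" "a * d - b * c = 1" by (rule SL2Z_cases[OF assms])
  define B where "B = mat2 (1 - a * c * h) (a\<^sup>2 * h) (- (c\<^sup>2 * h)) (1 + a * c * h)"
  have BA: "B = A ** mat2 1 h 0 1 ** minv A"
  proof -
    have "(a * h + b) * (-c) + a * d = 1 - a * c * h" "(c * h + d) * a + c * (- b) = 1 + a * c * h"
      using A(2) by (simp_all add: algebra_simps)
    thus ?thesis unfolding A(1) B_def minv_mat2 mat2_mult by (simp add: mat2_eq_iff algebra_simps power2_eq_square)
  qed
  have B1: "B \<in> SL2Z" unfolding BA using assms SL2Z_minv(1)[OF assms]
    by (intro SL2Z_mult) (auto simp: mat2_in_SL2Z)
  have "B ** A = A ** mat2 1 h 0 1 ** (minv A ** A)" by (simp add: BA matrix_mul_assoc)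
  hence B2: "B ** A = A ** mat2 1 h 0 1" using SL2Z_minv[OF assms] by simp
  have "B' = B" if "B' ** A = A ** mat2 1 h 0 1" for B'
  proof -
    have "B' ** (A ** minv A) = B" by (simp add: matrix_mul_assoc that BA)
    thus ?thesis using SL2Z_minv[OF assms] by simp
  qed
  hence "(\<exists>B\<in>Gamma0 N. B ** A = A ** mat2 1 h 0 1) \<longleftrightarrow> B \<in> Gamma0 N" using B2 by blast
  also have "\<dots> \<longleftrightarrow> int N dvd c\<^sup>2 * h" using B1 by (simp add: Gamma0_def B_def)
  finally show ?thesis by (simp add: A(1))
qed

lemma level_dvd_iff:
  assumes "is_level r c k"
  shows "2 ^ r dvd c\<^sup>2 * int h \<longleftrightarrow> 2 ^ (r - 2 * k) dvd h"
proof (cases "2 * k \<le> r")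
  case False
  hence "(2::int) ^ r dvd 2 ^ (k + k)" by (intro le_imp_power_dvd) simp
  also have "(2::int) ^ (k + k) dvd c * c" using assms unfolding is_level_def power_add by (intro mult_dvd_mono) auto
  finally show ?thesis using False by (simp add: power2_eq_square)
next
  case True
  show ?thesis
  proof (cases "k < r")
    case True
    obtain u where u: "c = 2 ^ k * u" using assms unfolding is_level_def by blast
    have "odd u" using assms True unfolding is_level_def u by simp
    have h1: "(2::int) ^ r = 2 ^ (2 * k) * 2 ^ (r - 2 * k)" using \<open>2 * k \<le> r\<close> by (simp flip: power_add)
    have h2: "c\<^sup>2 * int h = 2 ^ (2 * k) * (u\<^sup>2 * int h)" by (simp add: u power_mult_distrib power_mult[symmetric] mult.commute)
    have "2 ^ r dvd c\<^sup>2 * int h \<longleftrightarrow> 2 ^ (r - 2 * k) dvd u\<^sup>2 * int h"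
      unfolding h1 h2 dvd_mult_cancel_left by simp
    also have "\<dots> \<longleftrightarrow> 2 ^ (r - 2 * k) dvd int h"
      using \<open>odd u\<close> by (intro coprime_dvd_mult_right_iff) (simp add: coprime_power_left_iff coprime_power_right_iff coprime_left_2_iff_odd)
    also have "\<dots> \<longleftrightarrow> int (2 ^ (r - 2 * k)) dvd int h" by simp
    also have "\<dots> \<longleftrightarrow> 2 ^ (r - 2 * k) dvd h" by (rule int_dvd_int_iff)
    finally show ?thesis .
  next
    case False
    hence "r = 0" using \<open>2 * k \<le> r\<close> by simp
    thus ?thesis by simp
  qed
qed

text \<open>Truncated subtraction is intended: for 2k at least r the width is 1.\<close>

lemma cusp_width_eq:
  assumes "A \<in> SL2Z" "is_level r (entry A 2 1) k"
  shows "cusp_width (2 ^ r) A = 2 ^ (r - 2 * k)"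
proof -
  have "cusp_width (2 ^ r) A = (LEAST h. h > 0 \<and> 2 ^ (r - 2 * k) dvd h)"
    unfolding cusp_width_def translation_eq exists_Gamma0_translation_iff[OF assms(1)]
    using level_dvd_iff[OF assms(2)] by simp
  also have "\<dots> = 2 ^ (r - 2 * k)"
    by (rule Least_equality) (auto intro: dvd_imp_le)
  finally show ?thesis .
qed

lemma cusp_width_props:
  assumes "A \<in> SL2Z" "N > 0"
  shows "cusp_width N A > 0" "\<exists>B\<in>Gamma0 N. B ** A = A ** mat2 1 (int (cusp_width N A)) 0 1"
proof -
  have "\<exists>B\<in>Gamma0 N. B ** A = A ** mat2 1 (int N) 0 1"
    unfolding exists_Gamma0_translation_iff[OF assms(1)] by simp
  hence "\<exists>h. h > 0 \<and> (\<exists>B\<in>Gamma0 N. B ** A = A ** mat2 1 (int h) 0 1)" using assms(2) by blast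
  from LeastI_ex[OF this] show "cusp_width N A > 0" "\<exists>B\<in>Gamma0 N. B ** A = A ** mat2 1 (int (cusp_width N A)) 0 1"
    unfolding cusp_width_def translation_eq by auto
qed

definition Gamma0_invariant :: "nat \<Rightarrow> (complex \<Rightarrow> complex) \<Rightarrow> bool" where
  "Gamma0_invariant N f \<longleftrightarrow> (\<forall>A\<in>Gamma0 N. \<forall>z. Im z > 0 \<longrightarrow> f (mobius A z) = f z)"

lemma mobius_T: "mobius (mat2 1 n 0 1) t = t + of_int n"
  by (simp add: mobius_mat2)

lemma invariant_periodic:
  assumes "Gamma0_invariant N f" "A \<in> SL2Z" "B \<in> Gamma0 N" "B ** A = A ** mat2 1 h 0 1" "Im t > 0"
  shows "f (mobius A (t + of_int (h * n))) = f (mobius A t)"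
proof -
  have step: "f (mobius A (t + of_int h)) = f (mobius A t)" if "Im t > 0" for t
  proof -
    have "mobius A (t + of_int h) = mobius (A ** mat2 1 h 0 1) t"
      using that by (subst mobius_mult) (auto simp: mat2_in_SL2Z mobius_T)
    also have "\<dots> = mobius B (mobius A t)" unfolding assms(4)[symmetric] by (rule mobius_mult[OF assms(2) that])
    finally show ?thesis using assms(1,3) Im_mobius_pos[OF assms(2) that] unfolding Gamma0_invariant_def by simp
  qed
  show ?thesis
  proof (induction n rule: int_induct[where k = 0])
    case (step1 i) thus ?case using step[of "t + of_int (h * i)"] assms(5) by (simp add: algebra_simps)
  next
    case (step2 i) thus ?case using step[of "t + of_int (h * (i-1))"] assms(5) by (simp add: algebra_simps)
  qed simp
qed

text \<open>Two logarithms of the coordinate lead to arguments that differ by a multiple of the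
  width, under which f composed with A is invariant.\<close>

lemma cusp_expansion_ee:
  assumes "Gamma0_invariant N f" "A \<in> SL2Z" "N > 0" "Im t > 0"
  shows "cusp_expansion N f A (ee (t / of_nat (cusp_width N A))) = f (mobius A t)"
proof -
  define w where "w = cusp_width N A"
  obtain B where w: "w > 0" and B: "B \<in> Gamma0 N" "B ** A = A ** mat2 1 (int w) 0 1"
    using cusp_width_props[OF assms(2,3)] unfolding w_def by blast
  define q where "q = ee (t / of_nat w)"
  define t' where "t' = of_nat w * Ln q / (2 * of_real pi * \<i>)"
  have "ee (t' / of_nat w) = q" using w by (simp add: ee_def t'_def q_def)
  hence "ee ((t' - t) / of_nat w) = 1" unfolding diff_divide_distrib ee_diff by (simp add: q_def)
  then obtain n :: int where "(t' - t) / of_nat w = of_int n" unfolding ee_eq_1_iff by (elim Ints_cases)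
  hence "t' = t + of_int (int w * n)" using w by (simp add: field_simps)
  hence "f (mobius A t') = f (mobius A t)" using invariant_periodic[OF assms(1,2) B assms(4)] by simp
  thus ?thesis by (simp add: cusp_expansion_def w_def q_def t'_def)
qed

lemma cusp_param:
  assumes "q \<noteq> 0" "norm q < 1" "w > (0::nat)"
  shows "Im (of_nat w * Ln q / (2 * of_real pi * \<i>)) > 0" "ee (of_nat w * Ln q / (2 * of_real pi * \<i>) / of_nat w) = q"
proof -
  have "Im (of_nat w * Ln q / (2 * of_real pi * \<i>)) = - (real w * ln (norm q)) / (2 * pi)"
    using assms(1) by (simp add: Im_divide power2_eq_square)
  also have "\<dots> > 0" using assms by (auto simp: divide_simps mult_less_0_iff)
  finally show "Im (of_nat w * Ln q / (2 * of_real pi * \<i>)) > 0" .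
  show "ee (of_nat w * Ln q / (2 * of_real pi * \<i>) / of_nat w) = q"
    using assms by (simp add: ee_def)
qed

lemma filterlim_cusp_param:
  assumes "w > (0::nat)"
  shows "filterlim (\<lambda>q. of_nat w * Ln q / (2 * of_real pi * \<i>)) at_i_inf (at 0)"
  unfolding filterlim_iff
proof (intro allI impI)
  fix P assume "eventually P at_i_inf"
  then obtain y where y: "\<And>t. Im t > y \<Longrightarrow> P t" unfolding eventually_at_i_inf by blast
  define d where "d = exp (- (2 * pi * y / real w))"
  have "P (of_nat w * Ln q / (2 * of_real pi * \<i>))" if "q \<noteq> 0" "norm q < d" for q
  proof (rule y)
    have "ln (norm q) < - (2 * pi * y / real w)" using that
      by (metis d_def exp_less_cancel_iff exp_ln zero_less_norm_iff)
    hence "y < - (real w * ln (norm q)) / (2 * pi)" using assms by (simp add: field_simps)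
    also have "\<dots> = Im (of_nat w * Ln q / (2 * of_real pi * \<i>))"
      using that(1) by (simp add: Im_divide power2_eq_square)
    finally show "y < Im (of_nat w * Ln q / (2 * of_real pi * \<i>))" .
  qed
  thus "eventually (\<lambda>q. P (of_nat w * Ln q / (2 * of_real pi * \<i>))) (at 0)"
    unfolding eventually_at by (intro exI[of _ d]) (auto simp: d_def)
qed

text \<open>The principal logarithm jumps along the negative axis. As the expansion does not depend
  on the branch, the punctured disc is covered by two slit discs, each with its own holomorphic
  logarithm.\<close>

lemma holomorphic_cusp_expansion:
  assumes "Gamma0_invariant N f" "A \<in> SL2Z" "N > 0" "f holomorphic_on upper_half_plane"
  shows "cusp_expansion N f A holomorphic_on ball 0 1 - {0}"
proof -
  define w where "w = cusp_width N A"
  have w: "w > 0" using cusp_width_props[OF assms(2,3)] unfolding w_def by blast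
  have holA: "(\<lambda>z. f (mobius A z)) holomorphic_on upper_half_plane"
    using holomorphic_on_compose_gen[OF holomorphic_mobius[OF assms(2)] assms(4)] Im_mobius_pos[OF assms(2)]
    unfolding o_def by (simp add: image_subset_iff)
  define S1 S2 where "S1 = (ball 0 1 - {0::complex}) \<inter> (- \<real>\<^sub>\<le>\<^sub>0)" "S2 = (ball 0 1 - {0::complex}) \<inter> (uminus -` (- \<real>\<^sub>\<le>\<^sub>0))"
  have c: "closed (\<real>\<^sub>\<le>\<^sub>0 :: complex set)" by (rule closed_nonpos_Reals_complex)
  have "open (uminus -` (- \<real>\<^sub>\<le>\<^sub>0) :: complex set)"
    using c by (intro open_vimage continuous_on_minus continuous_on_id) (simp add: open_Compl)
  hence op: "open S1" "open S2" unfolding S1_S2_def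
    using c by (auto intro!: open_Int open_Diff simp: open_Compl)
  have *: "F holomorphic_on S" if "open S" "S \<subseteq> ball 0 1 - {0}" "l holomorphic_on S"
      "\<And>q. q \<in> S \<Longrightarrow> exp (l q) = q" "F = cusp_expansion N f A" for S l F
  proof -
    define T where "T = (\<lambda>q. of_nat w * l q / (2 * of_real pi * \<i>))"
    have T: "Im (T q) > 0" "ee (T q / of_nat w) = q" if "q \<in> S" for q
    proof -
      show e: "ee (T q / of_nat w) = q" using w \<open>q \<in> S\<close> \<open>\<And>q. q \<in> S \<Longrightarrow> exp (l q) = q\<close> by (simp add: T_def ee_def)
      have "norm (ee (T q / of_nat w)) < 1" using e \<open>q \<in> S\<close> \<open>S \<subseteq> _\<close> by auto
      thus "Im (T q) > 0" using w by (auto simp: norm_ee zero_less_mult_iff zero_less_divide_iff)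
    qed
    have "T holomorphic_on S" unfolding T_def by (intro holomorphic_intros that(3)) auto
    from holomorphic_on_compose_gen[OF this holA] have "(\<lambda>q. f (mobius A (T q))) holomorphic_on S"
      using T(1) by (simp add: o_def image_subset_iff)
    moreover have "f (mobius A (T q)) = cusp_expansion N f A q" if "q \<in> S" for q
      using cusp_expansion_ee[OF assms(1-3) T(1)[OF that]] T(2)[OF that] by (simp add: w_def)
    ultimately show ?thesis using that(5) holomorphic_transform by blast
  qed
  have "cusp_expansion N f A holomorphic_on S1"
    by (rule *[of _ Ln]) (use op in \<open>auto simp: S1_S2_def intro!: holomorphic_intros\<close>)
  moreover have "cusp_expansion N f A holomorphic_on S2"
  proof (rule *[of _ "\<lambda>q. Ln (-q) + \<i> * pi"])
    show "(\<lambda>q. Ln (-q) + \<i> * pi) holomorphic_on S2"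
      by (intro holomorphic_intros) (auto simp: S1_S2_def)
    show "exp (Ln (-q) + \<i> * pi) = q" if "q \<in> S2" for q
      using that by (auto simp: S1_S2_def exp_add)
  qed (use op in \<open>auto simp: S1_S2_def\<close>)
  ultimately have "cusp_expansion N f A holomorphic_on S1 \<union> S2"
    using op by (intro holomorphic_on_Un)
  moreover have "S1 \<union> S2 = ball 0 1 - {0}"
    by (auto simp: S1_S2_def complex_nonpos_Reals_iff complex_eq_iff)
  ultimately show ?thesis by simp
qed

text \<open>A nonzero limit after division by the power makes the singularity of the quotient at 0
  removable, and the extended quotient is the nonvanishing factor that determines the order.\<close>

lemma zorder_tendsto:
  assumes "r > 0" "F holomorphic_on ball 0 r - {0}" "((\<lambda>q. F q * q powi (-n)) \<longlongrightarrow> L) (at 0)" "L \<noteq> 0"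
  shows "zorder F 0 = n" "F meromorphic_on {0}"
proof -
  define G where "G = (\<lambda>q. if q = 0 then L else F q * q powi (-n))"
  have G: "G holomorphic_on ball 0 r"
  proof (rule no_isolated_singularity'[where K = "{0}"])
    have "(\<lambda>q. F q * q powi (-n)) holomorphic_on ball 0 r - {0}"
      using assms by (intro holomorphic_intros) auto
    thus "G holomorphic_on ball 0 r - {0}" by (rule holomorphic_transform) (auto simp: G_def)
    have "(G \<longlongrightarrow> L) (at 0)"
      by (rule Lim_transform_eventually[OF assms(3)]) (auto simp: G_def eventually_at_filter)
    thus "(G \<longlongrightarrow> G z) (at z within ball 0 r)" if "z \<in> {0}" for z
      using that by (auto simp: G_def intro: tendsto_within_subset)
  qed auto
  have eq: "F w = G w * (w - 0) powi n" if "w \<noteq> 0" for w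
    using that by (simp add: G_def power_int_minus)
  show "zorder F 0 = n"
    by (rule zorder_eqI[of "ball 0 r" _ G]) (use assms G eq in \<open>auto simp: G_def\<close>)
  have "G analytic_on {0}" using G assms(1) analytic_at_ball analytic_at by (metis centre_in_ball open_ball)
  hence "(\<lambda>w. G w * (w - 0) powi n) meromorphic_on {0}"
    by (intro meromorphic_intros analytic_on_imp_meromorphic_on)
  also have "?this \<longleftrightarrow> F meromorphic_on {0}"
    by (intro meromorphic_on_cong) (auto simp: eventually_at_filter eq)
  finally show "F meromorphic_on {0}" .
qed

lemma zorder_cusp_expansion:
  assumes "Gamma0_invariant N f" "A \<in> SL2Z" "N > 0" "f holomorphic_on upper_half_plane"
    and lim: "((\<lambda>t. f (mobius A t) * ee (- (of_int n * t / of_nat (cusp_width N A)))) \<longlongrightarrow> L) at_i_inf" "L \<noteq> 0"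
  shows "zorder (cusp_expansion N f A) 0 = n" "cusp_expansion N f A meromorphic_on {0}"
proof -
  define w where "w = cusp_width N A"
  have w: "w > 0" using cusp_width_props[OF assms(2,3)] unfolding w_def by blast
  have "((\<lambda>q. f (mobius A (of_nat w * Ln q / (2 * of_real pi * \<i>))) * ee (- (of_int n * (of_nat w * Ln q / (2 * of_real pi * \<i>)) / of_nat w))) \<longlongrightarrow> L) (at 0)"
    by (rule filterlim_compose[OF lim(1)[folded w_def] filterlim_cusp_param[OF w]])
  moreover have "eventually (\<lambda>q. f (mobius A (of_nat w * Ln q / (2 * of_real pi * \<i>))) * ee (- (of_int n * (of_nat w * Ln q / (2 * of_real pi * \<i>)) / of_nat w))
     = cusp_expansion N f A q * q powi (-n)) (at 0)"
    unfolding eventually_at_filter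
  proof (intro always_eventually allI impI)
    fix q :: complex assume q: "q \<noteq> 0"
    have "ee (- (of_int n * (of_nat w * Ln q / (2 * of_real pi * \<i>)) / of_nat w)) = exp (of_int (-n) * Ln q)"
      using w unfolding ee_def by (intro arg_cong[where f = exp]) (simp add: field_simps)
    also have "\<dots> = exp (Ln q) powi (-n)" by (rule exp_power_int[symmetric])
    also have "\<dots> = q powi (-n)" using q by simp
    finally show "f (mobius A (of_nat w * Ln q / (2 * of_real pi * \<i>))) * ee (- (of_int n * (of_nat w * Ln q / (2 * of_real pi * \<i>)) / of_nat w))
     = cusp_expansion N f A q * q powi (-n)" by (simp add: cusp_expansion_def w_def)
  qed
  ultimately have "((\<lambda>q. cusp_expansion N f A q * q powi (-n)) \<longlongrightarrow> L) (at 0)"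
    by (rule Lim_transform_eventually)
  from zorder_tendsto[OF zero_less_one holomorphic_cusp_expansion[OF assms(1-4)] this lim(2)]
  show "zorder (cusp_expansion N f A) 0 = n" "cusp_expansion N f A meromorphic_on {0}" .
qed

section \<open>The maximum principle on the modular curve\<close>

lemma coprime_row_completion:
  assumes "coprime c (d::int)"
  obtains a b where "a * d - b * c = 1"
proof -
  obtain u v where "u * c + v * d = gcd c d" using bezout_int by blast
  hence "v * d - (-u) * c = 1" using assms by simp
  thus ?thesis by (rule that)
qed

lemma exists_minimal_row:
  assumes t: "Im t > 0"
  obtains c d :: int where "(c, d) \<noteq> (0, 0)"
    "\<And>c' d'. (c', d') \<noteq> (0, 0) \<Longrightarrow> cmod (of_int c * t + of_int d) \<le> cmod (of_int c' * t + of_int d')"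
proof -
  define M where "M = \<lceil>1 / Im t\<rceil>"
  define K where "K = \<lceil>1 + (1 / Im t + 1) * cmod t\<rceil>"
  define S where "S = {(c, d). (c, d) \<noteq> (0, 0) \<and> cmod (of_int c * t + of_int d) \<le> 1}"
  have "S \<subseteq> {-M..M} \<times> {-K..K}"
  proof safe
    fix c d assume "(c, d) \<in> S"
    hence n: "cmod (of_int c * t + of_int d) \<le> 1" by (auto simp: S_def)
    have "\<bar>real_of_int c\<bar> * Im t = \<bar>Im (of_int c * t + of_int d)\<bar>" using t by (simp add: abs_mult)
    also have "\<dots> \<le> 1" using n abs_Im_le_cmod order_trans by blast
    finally have c: "\<bar>real_of_int c\<bar> \<le> 1 / Im t" using t by (simp add: field_simps)
    hence "\<bar>real_of_int c\<bar> \<le> of_int M" unfolding M_def by linarith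
    thus "c \<in> {-M..M}" by auto
    have "cmod (of_int d) \<le> cmod (of_int c * t + of_int d) + cmod (of_int c * t)"
      using norm_triangle_ineq4[of "of_int c * t + of_int d" "of_int c * t"] by simp
    also have "\<dots> \<le> 1 + (1 / Im t) * cmod t" using n mult_right_mono[OF c norm_ge_zero[of t]] by (simp add: norm_mult)
    also have "\<dots> \<le> 1 + (1 / Im t + 1) * cmod t" by (intro add_left_mono mult_right_mono) auto
    finally have "\<bar>real_of_int d\<bar> \<le> of_int K" unfolding K_def by simp linarith
    thus "d \<in> {-K..K}" by auto
  qed
  hence fin: "finite S" by (rule finite_subset) auto
  have 01: "(0, 1) \<in> S" by (simp add: S_def)
  define f where "f = (\<lambda>(c, d). cmod (of_int c * t + of_int d))"
  obtain p where p: "p \<in> S" "\<And>q. q \<in> S \<Longrightarrow> f p \<le> f q"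
    using fin 01 arg_min_if_finite(1)[of S f] arg_min_least[of S _ f] by (metis empty_iff)
  obtain c d where cd: "p = (c, d)" by (cases p)
  show ?thesis
  proof (rule that[of c d])
    show "(c, d) \<noteq> (0, 0)" using p(1) by (auto simp: S_def cd)
    fix c' d' :: int assume nz: "(c', d') \<noteq> (0, 0)"
    show "cmod (of_int c * t + of_int d) \<le> cmod (of_int c' * t + of_int d')"
    proof (cases "(c', d') \<in> S")
      case True
      thus ?thesis using p(2)[of "(c', d')"] by (simp add: f_def cd)
    next
      case False
      hence "cmod (of_int c' * t + of_int d') > 1" using nz by (auto simp: S_def)
      thus ?thesis using p(1) by (auto simp: S_def cd)
    qed
  qed
qed

text \<open>A bottom row minimising \<open>cmod (c * t + d)\<close> is coprime and maximises the
  imaginary part in the orbit. After a translation the real part is at most 1/2 in absolute value,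
  while minimality against the top row gives absolute value at least 1, so the square of the
  imaginary part is at least 3/4; the weaker bound 1/2 is convenient.\<close>

lemma SL2Z_high_orbit:
  assumes t: "Im t > 0"
  obtains A where "A \<in> SL2Z" "Im (mobius A t) \<ge> 1/2"
proof -
  obtain c d :: int where cd: "(c, d) \<noteq> (0, 0)"
    "\<And>c' d'. (c', d') \<noteq> (0, 0) \<Longrightarrow> cmod (of_int c * t + of_int d) \<le> cmod (of_int c' * t + of_int d')"
    using exists_minimal_row[OF t] by blast
  define g where "g = gcd c d"
  have g: "g > 0" using cd(1) by (auto simp: g_def)
  obtain c0 d0 where c0: "c = g * c0" "d = g * d0" unfolding g_def by (meson dvdE gcd_dvd1 gcd_dvd2)
  have nz0: "(c0, d0) \<noteq> (0, 0)" using cd(1) c0 by auto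
  have "of_int c * t + of_int d = of_int g * (of_int c0 * t + of_int d0)" by (simp add: c0 algebra_simps)
  hence "cmod (of_int c * t + of_int d) = of_int g * cmod (of_int c0 * t + of_int d0)" using g by (simp add: norm_mult)
  moreover have "of_int c0 * t + of_int d0 \<noteq> 0" using nz0 t by (auto simp: complex_eq_iff)
  ultimately have "real_of_int g \<le> 1" using cd(2)[OF nz0] by simp
  hence "g = 1" using g by simp
  hence "coprime c d" by (simp add: g_def coprime_iff_gcd_eq_1)
  then obtain a b where det: "a * d - b * c = 1" by (rule coprime_row_completion)
  define u where "u = mobius (mat2 a b c d) t"
  have SL: "mat2 a b c d \<in> SL2Z" using det by (simp add: mat2_in_SL2Z)
  define n where "n = - round (Re u)"
  define A where "A = mat2 1 n 0 1 ** mat2 a b c d"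
  have A: "A \<in> SL2Z" unfolding A_def using SL by (intro SL2Z_mult) (simp add: mat2_in_SL2Z)
  have Au: "mobius A t = u + of_int n" unfolding A_def by (simp add: mobius_mult[OF SL t] mobius_T u_def)
  define v where "v = u + of_int n"
  have Rev: "\<bar>Re v\<bar> \<le> 1/2" using of_int_round_abs_le[of "Re u"] by (simp add: v_def n_def abs_minus_commute)
  have nzd: "of_int c * t + of_int d \<noteq> 0" by (rule mobius_denom_nonzero[OF det t])
  have "v = (of_int (a + n * c) * t + of_int (b + n * d)) / (of_int c * t + of_int d)"
    using nzd by (simp add: v_def u_def mobius_mat2 field_simps)
  hence "cmod v = cmod (of_int (a + n * c) * t + of_int (b + n * d)) / cmod (of_int c * t + of_int d)"
    by (simp only: norm_divide)
  moreover have "(a + n * c, b + n * d) \<noteq> (0, 0)"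
  proof
    assume "(a + n * c, b + n * d) = (0, 0)"
    hence "a = - n * c" "b = - n * d" by auto
    thus False using det by (simp add: algebra_simps)
  qed
  ultimately have "cmod v \<ge> 1" using cd(2)[of "a + n * c" "b + n * d"] nzd by simp
  hence "1 \<le> (cmod v)\<^sup>2" by (simp add: one_le_power)
  also have "\<dots> = (Re v)\<^sup>2 + (Im v)\<^sup>2" by (simp add: cmod_power2)
  also have "(Re v)\<^sup>2 \<le> (1/2)\<^sup>2" using Rev by (subst abs_le_square_iff[symmetric]) simp
  finally have sq: "(1/2)\<^sup>2 \<le> (Im v)\<^sup>2" by (simp add: power2_eq_square)
  have pos: "Im v > 0" using Im_mobius_pos[OF A t] by (simp add: Au v_def)
  have "1/2 \<le> Im v" by (rule power2_le_imp_le[OF sq less_imp_le[OF pos]])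
  thus ?thesis by (intro that[OF A]) (simp only: Au v_def)
qed

text \<open>Matrices with equal residues modulo N lie in the same coset of \<open>Gamma0 N\<close>,
  which bounds the number of cosets.\<close>

definition residue_mat :: "nat \<Rightarrow> int ^ 2 ^ 2 \<Rightarrow> int \<times> int \<times> int \<times> int" where
  "residue_mat N A = (entry A 1 1 mod N, entry A 1 2 mod N, entry A 2 1 mod N, entry A 2 2 mod N)"

lemma residue_mat_eq_imp:
  assumes "A \<in> SL2Z" "B \<in> SL2Z" "residue_mat N A = residue_mat N B"
  shows "A ** minv B \<in> Gamma0 N"
proof -
  obtain a b c d where A: "A = mat2 a b c d" "a * d - b * c = 1" by (rule SL2Z_cases[OF assms(1)])
  obtain a' b' c' d' where B: "B = mat2 a' b' c' d'" "a' * d' - b' * c' = 1" by (rule SL2Z_cases[OF assms(2)])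
  have "int N dvd c - c'" "int N dvd d - d'"
    using assms(3) by (auto simp: residue_mat_def A(1) B(1) mod_eq_dvd_iff)
  hence "int N dvd (c - c') * d' - (d - d') * c'" by (simp only: dvd_mult2 dvd_diff)
  hence "int N dvd c * d' + d * (- c')" by (simp add: algebra_simps)
  moreover have "A ** minv B \<in> SL2Z" using assms SL2Z_minv by (intro SL2Z_mult) auto
  ultimately show ?thesis by (simp add: Gamma0_def A(1) B(1) mat2_mult)
qed

lemma finite_coset_reps:
  assumes "N > 0"
  obtains Reps where "finite Reps" "Reps \<subseteq> SL2Z" "\<And>A. A \<in> SL2Z \<Longrightarrow> \<exists>B\<in>Reps. A ** minv B \<in> Gamma0 N"
proof -
  have "residue_mat N ` SL2Z \<subseteq> {0..<int N} \<times> {0..<int N} \<times> {0..<int N} \<times> {0..<int N}"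
    using assms by (auto simp: residue_mat_def)
  hence "finite (residue_mat N ` SL2Z)" by (rule finite_subset) auto
  then obtain Reps where Reps: "Reps \<subseteq> SL2Z" "finite Reps" "residue_mat N ` SL2Z = residue_mat N ` Reps"
    using finite_subset_image[of "residue_mat N ` SL2Z" "residue_mat N" SL2Z] by blast
  have "\<exists>B\<in>Reps. A ** minv B \<in> Gamma0 N" if "A \<in> SL2Z" for A
  proof -
    have "residue_mat N A \<in> residue_mat N ` Reps" using that Reps(3) by blast
    then obtain B where "B \<in> Reps" "residue_mat N A = residue_mat N B" by blast
    thus ?thesis using residue_mat_eq_imp[OF that, of B N] Reps(1) by blast
  qed
  thus ?thesis using that Reps by blast
qed

lemma cusp_width_le:
  assumes "A \<in> SL2Z" "N > 0"
  shows "cusp_width N A \<le> N"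
  unfolding cusp_width_def translation_eq
  by (rule Least_le) (use exists_Gamma0_translation_iff[OF assms(1), of N "int N"] assms(2) in simp)

lemma invariant_coset:
  assumes "Gamma0_invariant N f" "A \<in> SL2Z" "B \<in> SL2Z" "A ** minv B \<in> Gamma0 N" "Im t > 0"
  shows "f (mobius A t) = f (mobius B t)"
proof -
  have "A = (A ** minv B) ** B" using SL2Z_minv[OF assms(3)] by (simp flip: matrix_mul_assoc)
  hence "mobius A t = mobius (A ** minv B) (mobius B t)" using mobius_mult[OF assms(3,5)] by metis
  thus ?thesis using assms(1,4) Im_mobius_pos[OF assms(3,5)] unfolding Gamma0_invariant_def by simp
qed

text \<open>Every orbit meets the region of imaginary part at least 1/2, and each coset turns this
  region into part of a fixed closed disc in a local coordinate. A maximum over these finitely many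
  compact discs therefore bounds f everywhere and is attained inside one of the open unit discs,
  where the expansion is then constant.\<close>

lemma invariant_holomorphic_constant:
  assumes N: "N > 0" and inv: "Gamma0_invariant N f" and hol: "f holomorphic_on upper_half_plane"
    and lim: "\<And>A. A \<in> SL2Z \<Longrightarrow> \<exists>L. ((\<lambda>t. f (mobius A t)) \<longlongrightarrow> L) at_i_inf"
  obtains C where "\<And>t. Im t > 0 \<Longrightarrow> f t = C"
proof -
  obtain L where L: "\<And>A. A \<in> SL2Z \<Longrightarrow> ((\<lambda>t. f (mobius A t)) \<longlongrightarrow> L A) at_i_inf" using lim by metis
  define G where "G = (\<lambda>A q. if q = 0 then L A else cusp_expansion N f A q)"
  have w: "cusp_width N A > 0" if "A \<in> SL2Z" for A using cusp_width_props[OF that N] by blast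
  have G: "G A holomorphic_on ball 0 1" if A: "A \<in> SL2Z" for A
  proof (rule no_isolated_singularity'[where K = "{0}"])
    have "cusp_expansion N f A holomorphic_on ball 0 1 - {0}" by (rule holomorphic_cusp_expansion[OF inv A N hol])
    thus "G A holomorphic_on ball 0 1 - {0}" by (rule holomorphic_transform) (auto simp: G_def)
    have "((\<lambda>q. cusp_expansion N f A q) \<longlongrightarrow> L A) (at 0)"
      unfolding cusp_expansion_def by (rule filterlim_compose[OF L[OF A] filterlim_cusp_param[OF w[OF A]]])
    hence "(G A \<longlongrightarrow> L A) (at 0)"
      by (rule Lim_transform_eventually) (auto simp: G_def eventually_at_filter)
    thus "(G A \<longlongrightarrow> G A z) (at z within ball 0 1)" if "z \<in> {0}" for z
      using that by (auto simp: G_def intro: tendsto_within_subset)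
  qed auto
  have Gee: "G A (ee (t / of_nat (cusp_width N A))) = f (mobius A t)" if "A \<in> SL2Z" "Im t > 0" for A t
    using cusp_expansion_ee[OF inv that(1) N that(2)] by (simp add: G_def)
  \<comment> \<open>The largest absolute value of the local coordinate when the imaginary part is at
    least 1/2 and the width at most N.\<close>
  define \<rho> where "\<rho> = exp (- (pi / real N))"
  have \<rho>: "0 < \<rho>" "\<rho> < 1" using N by (auto simp: \<rho>_def)
  have small: "cmod (ee (t / of_nat (cusp_width N A))) \<le> \<rho>" if "A \<in> SL2Z" "Im t \<ge> 1/2" for A t
  proof -
    have "real (cusp_width N A) \<le> real N" using cusp_width_le[OF that(1) N] by simp
    hence "pi / real N \<le> pi / real (cusp_width N A)" using w[OF that(1)] N by (intro divide_left_mono) auto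
    also have "\<dots> \<le> 2 * pi * Im t / real (cusp_width N A)" using that w[OF that(1)] by (intro divide_right_mono) auto
    finally show ?thesis by (simp add: norm_ee \<rho>_def)
  qed
  have "\<exists>q\<in>cball 0 \<rho>. \<forall>q'\<in>cball 0 \<rho>. cmod (G A q') \<le> cmod (G A q)" if "A \<in> SL2Z" for A
  proof (rule continuous_attains_sup)
    have "cball 0 \<rho> \<subseteq> ball (0::complex) 1" using \<rho> by auto
    thus "continuous_on (cball 0 \<rho>) (\<lambda>q. cmod (G A q))"
      using holomorphic_on_imp_continuous_on[OF G[OF that]] continuous_on_subset by (blast intro: continuous_on_norm)
  qed (use \<rho> in auto)
  then obtain Q where Q: "\<And>A. A \<in> SL2Z \<Longrightarrow> Q A \<in> cball 0 \<rho>" "\<And>A q. A \<in> SL2Z \<Longrightarrow> q \<in> cball 0 \<rho> \<Longrightarrow> cmod (G A q) \<le> cmod (G A (Q A))"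
    by metis
  obtain Reps where Reps: "finite Reps" "Reps \<subseteq> SL2Z" "\<And>A. A \<in> SL2Z \<Longrightarrow> \<exists>B\<in>Reps. A ** minv B \<in> Gamma0 N" using finite_coset_reps[OF N] by metis
  have one: "mat 1 \<in> SL2Z" using mat_1_in_Gamma0 Gamma0_SL2Z by blast
  hence "Reps \<noteq> {}" using Reps(3) by blast
  define m where "m = (\<lambda>A. cmod (G A (Q A)))"
  obtain A0 where A0: "A0 \<in> Reps" "\<And>A. A \<in> Reps \<Longrightarrow> m A \<le> m A0"
  proof -
    have "Max (m ` Reps) \<in> m ` Reps" using Reps(1) \<open>Reps \<noteq> {}\<close> by (intro Max_in) auto
    then obtain A0 where "A0 \<in> Reps" "m A0 = Max (m ` Reps)" by auto
    thus ?thesis using that[of A0] Max_ge[of "m ` Reps"] Reps(1) by auto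
  qed
  have A0S: "A0 \<in> SL2Z" using A0(1) Reps(2) by blast
  have bound: "cmod (f t) \<le> m A0" if t: "Im t > 0" for t
  proof -
    obtain B where B: "B \<in> SL2Z" "Im (mobius B t) \<ge> 1/2" using SL2Z_high_orbit[OF t] by blast
    obtain A where A: "A \<in> Reps" "minv B ** minv A \<in> Gamma0 N" using Reps(3) SL2Z_minv(1)[OF B(1)] by blast
    have AS: "A \<in> SL2Z" using A Reps(2) by blast
    have t': "Im (mobius B t) > 0" using B(2) by simp
    have "f t = f (mobius (minv B) (mobius B t))" by (simp add: mobius_minv[OF B(1) t])
    also have "\<dots> = f (mobius A (mobius B t))" by (rule invariant_coset[OF inv SL2Z_minv(1)[OF B(1)] AS A(2) t'])
    also have "\<dots> = G A (ee (mobius B t / of_nat (cusp_width N A)))" using Gee[OF AS t'] by simp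
    finally have "cmod (f t) \<le> m A" using Q(2)[OF AS] small[OF AS B(2)] by (simp add: m_def)
    thus ?thesis using A0(2)[OF A(1)] by simp
  qed
  \<comment> \<open>Every point of the punctured disc is the coordinate of a point of the
    half-plane, so \<open>bound\<close> applies to all of it and not only to the smaller disc over
    which the maximum was taken.\<close>
  have "G A0 constant_on ball 0 1"
  proof (rule maximum_modulus_principle[OF G[OF A0S], of "ball 0 1" "Q A0"])
    show "Q A0 \<in> ball 0 1" using Q(1)[OF A0S] \<rho> by auto
    fix q :: complex assume q: "q \<in> ball 0 1"
    show "cmod (G A0 q) \<le> cmod (G A0 (Q A0))"
    proof (cases "q = 0")
      case True
      thus ?thesis using Q(2)[OF A0S, of 0] \<rho> by simp
    next
      case False
      define t where "t = of_nat (cusp_width N A0) * Ln q / (2 * of_real pi * \<i>)"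
      have "Im t > 0" "ee (t / of_nat (cusp_width N A0)) = q"
        using cusp_param[OF False _ w[OF A0S]] q by (auto simp: t_def)
      hence "G A0 q = f (mobius A0 t)" using Gee[OF A0S] by force
      thus ?thesis using bound[OF Im_mobius_pos[OF A0S \<open>Im t > 0\<close>]] by (simp add: m_def)
    qed
  qed (auto intro: connected_ball)
  then obtain C where C: "\<And>q. q \<in> ball 0 1 \<Longrightarrow> G A0 q = C" unfolding constant_on_def by blast
  have "f t = C" if t: "Im t > 0" for t
  proof -
    define t' where "t' = mobius (minv A0) t"
    have t': "Im t' > 0" unfolding t'_def by (rule Im_mobius_pos[OF SL2Z_minv(1)[OF A0S] t])
    have "f t = f (mobius A0 t')" by (simp add: t'_def mobius_minv[OF A0S t])
    also have "\<dots> = G A0 (ee (t' / of_nat (cusp_width N A0)))" using Gee[OF A0S t'] by simp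
    also have "\<dots> = C" using w[OF A0S] t' by (intro C) (simp add: norm_ee_less_1)
    finally show ?thesis .
  qed
  thus ?thesis by (rule that)
qed

section \<open>Modular functions and the Jacobian\<close>

text \<open>The last conclusion is the identity theorem: on a connected domain a meromorphic
  function that is not zero off a sparse set avoids the value 0 near every point. It is the form in
  which the calculus of \<open>zorder\<close> uses nonvanishing.\<close>

lemma modular_functionsD:
  assumes "f \<in> modular_functions N"
  shows "f meromorphic_on upper_half_plane" "Gamma0_invariant N f"
    "\<And>A. A \<in> SL2Z \<Longrightarrow> cusp_expansion N f A meromorphic_on {0}"
    "\<And>z. Im z > 0 \<Longrightarrow> eventually (\<lambda>w. f w \<noteq> 0) (at z)"
proof -
  show mero: "f meromorphic_on upper_half_plane" and "Gamma0_invariant N f"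
    and "\<And>A. A \<in> SL2Z \<Longrightarrow> cusp_expansion N f A meromorphic_on {0}"
    using assms by (auto simp: modular_functions_def Gamma0_invariant_def)
  have "eventually (\<lambda>z. f z \<noteq> 0) (cosparse upper_half_plane)"
    using meromorphic_imp_constant_or_avoid[OF mero open_UHP connected_UHP, of 0] assms
    by (auto simp: modular_functions_def)
  thus "eventually (\<lambda>w. f w \<noteq> 0) (at z)" if "Im z > 0" for z
    by (rule eventually_cosparse_imp_eventually_at) (use that in simp)
qed

lemma modular_functionsI:
  assumes "f meromorphic_on upper_half_plane" "Gamma0_invariant N f"
    "\<And>A. A \<in> SL2Z \<Longrightarrow> cusp_expansion N f A meromorphic_on {0}"
    "\<And>z. Im z > 0 \<Longrightarrow> eventually (\<lambda>w. f w \<noteq> 0) (at z)"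
  shows "f \<in> modular_functions N"
proof -
  have "\<not> eventually (\<lambda>z. f z = 0) (cosparse upper_half_plane)"
  proof
    assume "eventually (\<lambda>z. f z = 0) (cosparse upper_half_plane)"
    hence "eventually (\<lambda>z. f z = 0) (at \<i>)" by (rule eventually_cosparse_imp_eventually_at) simp
    moreover have "eventually (\<lambda>w. f w \<noteq> 0) (at \<i>)" by (rule assms(4)) simp
    ultimately have "eventually (\<lambda>_. False) (at \<i>)" by eventually_elim auto
    thus False by simp
  qed
  thus ?thesis using assms(1-3) by (auto simp: modular_functions_def Gamma0_invariant_def)
qed

text \<open>An expansion vanishing near 0 would make f vanish on the image under A of some region of
  large imaginary part, which is open. The additivity of orders at cusps depends on this being
  excluded.\<close>

lemma cusp_expansion_frequently_nonzero:
  assumes "f \<in> modular_functions N" "A \<in> SL2Z" "N > 0"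
  shows "frequently (\<lambda>q. cusp_expansion N f A q \<noteq> 0) (at 0)"
proof (rule ccontr)
  note f = modular_functionsD[OF assms(1)]
  define w where "w = cusp_width N A"
  have w: "w > 0" using cusp_width_props[OF assms(2,3)] unfolding w_def by blast
  assume "\<not> ?thesis"
  hence "eventually (\<lambda>q. cusp_expansion N f A q = 0) (at 0)" by (simp add: frequently_def)
  then obtain d where d: "d > 0" "\<And>q. q \<noteq> 0 \<Longrightarrow> norm q < d \<Longrightarrow> cusp_expansion N f A q = 0"
    unfolding eventually_at by auto
  define y where "y = max 1 (- (real w * ln d) / (2 * pi))"
  have zero: "f (mobius A t) = 0" if "Im t > y" for t
  proof -
    have "- (2 * pi * Im t / real w) < ln d"
      using that w by (simp add: y_def field_simps)
    hence "norm (ee (t / of_nat w)) < d"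
      using d(1) by (simp add: norm_ee) (metis exp_less_cancel_iff exp_ln)
    hence "cusp_expansion N f A (ee (t / of_nat w)) = 0" by (intro d(2)) auto
    moreover have "Im t > 0" using that by (simp add: y_def)
    ultimately show ?thesis using cusp_expansion_ee[OF f(2) assms(2,3)] by (simp add: w_def)
  qed
  define t0 where "t0 = Complex 0 (y + 1)"
  have t0: "Im t0 > y" "Im t0 > 0" by (auto simp: t0_def y_def)
  define z0 where "z0 = mobius A t0"
  have z0: "Im z0 > 0" unfolding z0_def by (rule Im_mobius_pos[OF assms(2) t0(2)])
  have "isCont (mobius (minv A)) z0"
    using holomorphic_on_imp_continuous_on[OF holomorphic_mobius[OF SL2Z_minv(1)[OF assms(2)]]] z0
    by (simp add: continuous_on_eq_continuous_at[OF open_UHP])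
  hence "((\<lambda>z. Im (mobius (minv A) z)) \<longlongrightarrow> Im (mobius (minv A) z0)) (at z0)"
    by (intro tendsto_Im) (simp add: isCont_def)
  moreover have "Im (mobius (minv A) z0) > y" using t0 by (simp add: z0_def mobius_minv[OF assms(2) t0(2)])
  ultimately have "eventually (\<lambda>z. Im (mobius (minv A) z) > y) (at z0)" by (rule order_tendstoD)
  moreover have "eventually (\<lambda>z. z \<in> upper_half_plane) (at z0)"
    by (rule eventually_at_in_open'[OF open_UHP]) (use z0 in simp)
  moreover note f(4)[OF z0]
  ultimately have "eventually (\<lambda>_. False) (at z0)"
  proof eventually_elim
    case (elim z)
    have "f (mobius A (mobius (minv A) z)) = 0" by (rule zero) (use elim in simp)
    thus ?case using elim mobius_minv(1)[OF assms(2), of z] by simp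
  qed
  thus False by simp
qed

lemma modular_functions_mult:
  assumes f: "f \<in> modular_functions N" and g: "g \<in> modular_functions N"
  shows "(\<lambda>z. f z * g z) \<in> modular_functions N"
proof (rule modular_functionsI)
  note f' = modular_functionsD[OF f] and g' = modular_functionsD[OF g]
  show "(\<lambda>z. f z * g z) meromorphic_on upper_half_plane" by (intro meromorphic_intros f' g')
  show "Gamma0_invariant N (\<lambda>z. f z * g z)" using f'(2) g'(2) by (simp add: Gamma0_invariant_def)
  show "cusp_expansion N (\<lambda>z. f z * g z) A meromorphic_on {0}" if "A \<in> SL2Z" for A
    using meromorphic_on_mult[OF f'(3)[OF that] g'(3)[OF that]] by (simp add: cusp_expansion_def[abs_def])
  show "eventually (\<lambda>w. f w * g w \<noteq> 0) (at z)" if "Im z > 0" for z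
    using f'(4)[OF that] g'(4)[OF that] by eventually_elim simp
qed

lemma modular_functions_inverse:
  assumes f: "f \<in> modular_functions N"
  shows "(\<lambda>z. inverse (f z)) \<in> modular_functions N"
proof (rule modular_functionsI)
  note f' = modular_functionsD[OF f]
  show "(\<lambda>z. inverse (f z)) meromorphic_on upper_half_plane" by (intro meromorphic_intros f')
  show "Gamma0_invariant N (\<lambda>z. inverse (f z))" using f'(2) by (simp add: Gamma0_invariant_def)
  show "cusp_expansion N (\<lambda>z. inverse (f z)) A meromorphic_on {0}" if "A \<in> SL2Z" for A
    using meromorphic_on_inverse[OF f'(3)[OF that]] by (simp add: cusp_expansion_def[abs_def])
  show "eventually (\<lambda>w. inverse (f w) \<noteq> 0) (at z)" if "Im z > 0" for z
    using f'(4)[OF that] by eventually_elim simp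
qed

lemma modular_functions_const:
  assumes "N > 0" "c \<noteq> 0"
  shows "(\<lambda>z. c) \<in> modular_functions N"
  by (rule modular_functionsI) (use assms in \<open>auto simp: Gamma0_invariant_def cusp_expansion_def[abs_def]\<close>)

lemma mero_at: "f meromorphic_on upper_half_plane \<Longrightarrow> Im z > 0 \<Longrightarrow> f meromorphic_on {z}"
  by (erule meromorphic_on_subset) simp

lemma is_divisor_of_mult:
  assumes f: "f \<in> modular_functions N" and g: "g \<in> modular_functions N" and N: "N > 0"
    and D: "is_divisor_of N D f" and E: "is_divisor_of N E g"
  shows "is_divisor_of N (D + E) (\<lambda>z. f z * g z)"
proof -
  note f' = modular_functionsD[OF f] and g' = modular_functionsD[OF g]
  have "Poly_Mapping.keys (D + E) \<subseteq> X0 N"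
    using D E keys_add[of D E] unfolding is_divisor_of_def by blast
  moreover have "zorder (\<lambda>z. f z * g z) z = zorder f z + zorder g z" if "Im z > 0" for z
    using that by (intro zorder_mult mero_at f'(1) g'(1) eventually_frequently f'(4) g'(4)) auto
  moreover have "zorder (cusp_expansion N (\<lambda>z. f z * g z) A) 0 = zorder (cusp_expansion N f A) 0 + zorder (cusp_expansion N g A) 0"
    if A: "A \<in> SL2Z" for A
    using zorder_mult[OF f'(3)[OF A] cusp_expansion_frequently_nonzero[OF f A N] g'(3)[OF A] cusp_expansion_frequently_nonzero[OF g A N]]
    by (simp add: cusp_expansion_def[abs_def])
  ultimately show ?thesis using D E unfolding is_divisor_of_def by (simp add: lookup_add distrib_left)
qed

lemma is_divisor_of_inverse:
  assumes f: "f \<in> modular_functions N" and N: "N > 0" and D: "is_divisor_of N D f"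
  shows "is_divisor_of N (- D) (\<lambda>z. inverse (f z))"
proof -
  note f' = modular_functionsD[OF f]
  have "zorder (\<lambda>z. inverse (f z)) z = - zorder f z" if "Im z > 0" for z
    using mero_at[OF f'(1) that] f'(4)[OF that]
    by (intro zorder_inverse eventually_frequently) (auto simp: meromorphic_at_iff)
  moreover have "zorder (cusp_expansion N (\<lambda>z. inverse (f z)) A) 0 = - zorder (cusp_expansion N f A) 0"
    if A: "A \<in> SL2Z" for A
    using f'(3)[OF A] zorder_inverse[OF _ _ cusp_expansion_frequently_nonzero[OF f A N]]
    by (simp add: meromorphic_at_iff cusp_expansion_def[abs_def])
  ultimately show ?thesis using D unfolding is_divisor_of_def by simp
qed

lemma zorder_const: "c \<noteq> 0 \<Longrightarrow> zorder (\<lambda>z. c) z = 0"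
  by (rule zorder_eqI[of UNIV _ "\<lambda>_. c"]) auto

lemma is_divisor_of_const: "c \<noteq> 0 \<Longrightarrow> is_divisor_of N 0 (\<lambda>_. c)"
  by (simp add: is_divisor_of_def zorder_const cusp_expansion_def[abs_def])

section \<open>Degrees, divisors of degree 0 and their classes\<close>

lemma deg_alt:
  assumes "finite S" "Poly_Mapping.keys D \<subseteq> S"
  shows "deg D = (\<Sum>p\<in>S. Poly_Mapping.lookup D p)"
  unfolding deg_def by (rule sum.mono_neutral_left) (use assms in \<open>auto simp: in_keys_iff\<close>)

lemma deg_add: "deg (D + E) = deg D + deg E"
proof -
  have "deg (D + E) = (\<Sum>p\<in>Poly_Mapping.keys D \<union> Poly_Mapping.keys E. Poly_Mapping.lookup (D + E) p)"
    by (rule deg_alt) (use keys_add[of D E] in auto)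
  also have "\<dots> = (\<Sum>p\<in>Poly_Mapping.keys D \<union> Poly_Mapping.keys E. Poly_Mapping.lookup D p) + (\<Sum>p\<in>Poly_Mapping.keys D \<union> Poly_Mapping.keys E. Poly_Mapping.lookup E p)"
    by (simp add: lookup_add sum.distrib)
  also have "\<dots> = deg D + deg E" by (intro arg_cong2[where f = "(+)"] deg_alt[symmetric]) auto
  finally show ?thesis .
qed

lemma deg_0 [simp]: "deg 0 = 0" by (simp add: deg_def)

lemma deg_uminus: "deg (- D) = - deg D"
  using deg_add[of D "- D"] by simp

lemma carrier_Div0: "carrier (Div0 N) = {D. Poly_Mapping.keys D \<subseteq> X0 N \<and> deg D = 0}"
  by (auto simp: Div0_def)

lemma mult_Div0 [simp]: "x \<otimes>\<^bsub>Div0 N\<^esub> y = x + y"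
  by (simp add: Div0_def)

lemma one_Div0 [simp]: "\<one>\<^bsub>Div0 N\<^esub> = 0"
  by (simp add: Div0_def)

lemma comm_group_Div0: "comm_group (Div0 N)"
proof -
  interpret F: comm_group "free_Abelian_group (X0 N)" by (rule abelian_free_Abelian_group)
  have "subgroup {D \<in> carrier (free_Abelian_group (X0 N)). deg D = 0} (free_Abelian_group (X0 N))"
  proof (rule F.subgroupI)
    show "{D \<in> carrier (free_Abelian_group (X0 N)). deg D = 0} \<noteq> {}"
      by (auto intro!: exI[of _ 0])
  next
    fix D assume "D \<in> {D \<in> carrier (free_Abelian_group (X0 N)). deg D = 0}"
    thus "inv\<^bsub>free_Abelian_group (X0 N)\<^esub> D \<in> {D \<in> carrier (free_Abelian_group (X0 N)). deg D = 0}"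
      by (auto simp: deg_uminus)
  next
    fix D E assume "D \<in> {D \<in> carrier (free_Abelian_group (X0 N)). deg D = 0}" "E \<in> {D \<in> carrier (free_Abelian_group (X0 N)). deg D = 0}"
    thus "D \<otimes>\<^bsub>free_Abelian_group (X0 N)\<^esub> E \<in> {D \<in> carrier (free_Abelian_group (X0 N)). deg D = 0}"
      using keys_add[of D E] by (auto simp: deg_add)
  qed auto
  hence "group (Div0 N)" unfolding Div0_def by (rule F.subgroup_imp_group)
  thus ?thesis by (rule group.group_comm_groupI) (simp add: add.commute)
qed

lemma inv_Div0: "D \<in> carrier (Div0 N) \<Longrightarrow> inv\<^bsub>Div0 N\<^esub> D = - D"
proof -
  interpret comm_group "Div0 N" by (rule comm_group_Div0)
  assume D: "D \<in> carrier (Div0 N)"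
  show ?thesis by (rule inv_equality) (use D in \<open>auto simp: carrier_Div0 deg_uminus\<close>)
qed

lemma subgroup_principal_divisors:
  assumes N: "N > 0"
  shows "subgroup (principal_divisors N) (Div0 N)"
proof -
  interpret comm_group "Div0 N" by (rule comm_group_Div0)
  show ?thesis
  proof (rule subgroupI)
    show "principal_divisors N \<subseteq> carrier (Div0 N)" by (auto simp: principal_divisors_def)
    have "0 \<in> principal_divisors N"
      using modular_functions_const[OF N, of 1] is_divisor_of_const[of 1 N] one_closed
      by (auto simp: principal_divisors_def)
    thus "principal_divisors N \<noteq> {}" by blast
  next
    fix D assume D: "D \<in> principal_divisors N"
    hence c: "D \<in> carrier (Div0 N)" by (simp add: principal_divisors_def)
    have "- D \<in> carrier (Div0 N)" using inv_closed[OF c] by (simp add: inv_Div0[OF c])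
    thus "inv\<^bsub>Div0 N\<^esub> D \<in> principal_divisors N"
      using D modular_functions_inverse is_divisor_of_inverse[OF _ N] unfolding inv_Div0[OF c] principal_divisors_def by blast
  next
    fix D E assume DE: "D \<in> principal_divisors N" "E \<in> principal_divisors N"
    hence "D + E \<in> carrier (Div0 N)" using m_closed[of D E] by (simp add: principal_divisors_def)
    thus "D \<otimes>\<^bsub>Div0 N\<^esub> E \<in> principal_divisors N"
      using DE modular_functions_mult is_divisor_of_mult[OF _ _ N] unfolding principal_divisors_def mult_Div0 by blast
  qed
qed

lemma normal_principal_divisors: "N > 0 \<Longrightarrow> principal_divisors N \<lhd> Div0 N"
  using comm_group.subgroup_imp_normal[OF comm_group_Div0 subgroup_principal_divisors] .

lemma comm_group_J0: "N > 0 \<Longrightarrow> comm_group (J0 N)"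
  unfolding J0_def using comm_group.abelian_FactGroup[OF comm_group_Div0 subgroup_principal_divisors] .

lemma divisor_class_hom: "N > 0 \<Longrightarrow> divisor_class N \<in> hom (Div0 N) (J0 N)"
  unfolding J0_def divisor_class_def using normal.r_coset_hom_Mod[OF normal_principal_divisors] .

lemma divisor_class_eq_one_iff:
  assumes "N > 0" "D \<in> carrier (Div0 N)"
  shows "divisor_class N D = \<one>\<^bsub>J0 N\<^esub> \<longleftrightarrow> D \<in> principal_divisors N"
proof -
  interpret comm_group "Div0 N" by (rule comm_group_Div0)
  note s = subgroup_principal_divisors[OF assms(1)]
  have "\<one>\<^bsub>J0 N\<^esub> = principal_divisors N" by (simp add: J0_def)
  thus ?thesis unfolding divisor_class_def
    using coset_join1[OF _ assms(2) s] coset_join2[OF assms(2) s] by metis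
qed

section \<open>Cusps and cuspidal divisors\<close>

lemma act_Infty_mat2: "act (mat2 a b c d) Infty = (if c = 0 then Infty else Rational (of_int a / of_int c))"
  by simp

lemma act_mult_Infty:
  assumes "A \<in> SL2Z" "B \<in> SL2Z"
  shows "act (A ** B) Infty = act A (act B Infty)"
proof -
  obtain a b c d where A: "A = mat2 a b c d" "a * d - b * c = 1" by (rule SL2Z_cases[OF assms(1)])
  obtain a' b' c' d' where B: "B = mat2 a' b' c' d'" "a' * d' - b' * c' = 1" by (rule SL2Z_cases[OF assms(2)])
  show ?thesis
  proof (cases "c' = 0")
    case True
    hence "a' \<noteq> 0" using B(2) by auto
    thus ?thesis using True by (simp add: A(1) B(1) mat2_mult)
  next
    case False
    have e: "of_int c * (of_int a' / of_int c') + of_int d = (of_int (c * a' + d * c') / of_int c' :: rat)"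
      using False by (simp add: field_simps)
    have e': "of_int a * (of_int a' / of_int c') + of_int b = (of_int (a * a' + b * c') / of_int c' :: rat)"
      using False by (simp add: field_simps)
    have "act A (act B Infty) = (if of_int (c * a' + d * c') / of_int c' = (0::rat) then Infty
       else Rational ((of_int (a * a' + b * c') / of_int c') / (of_int (c * a' + d * c') / of_int c')))"
      using False unfolding A(1) B(1) by (simp only: act_Infty_mat2 if_False act.simps mat2_nth e e')
    also have "\<dots> = act (A ** B) Infty"
      using False unfolding A(1) B(1) mat2_mult act_Infty_mat2 by (simp del: of_int_add of_int_mult)
    finally show ?thesis ..
  qed
qed

declare act.simps [simp del]

text \<open>The first columns are proportional and primitive, so they differ by a unit. The factors
  between them in both directions, \<open>e\<close> and \<open>e'\<close>, are read off from the two
  determinant relations.\<close>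

lemma act_Infty_eq_iff:
  assumes "a * d - b * c = (1::int)" "a' * d' - b' * c' = 1"
  shows "act (mat2 a b c d) Infty = act (mat2 a' b' c' d') Infty \<longleftrightarrow> (a = a' \<and> c = c') \<or> (a = - a' \<and> c = - c')"
proof
  assume eq: "act (mat2 a b c d) Infty = act (mat2 a' b' c' d') Infty"
  have cross: "a * c' = a' * c"
  proof (cases "c = 0 \<or> c' = 0")
    case True
    thus ?thesis using eq by (auto simp: act_Infty_mat2 split: if_splits)
  next
    case False
    hence "(of_int a / of_int c :: rat) = of_int a' / of_int c'" using eq by (simp add: act_Infty_mat2)
    hence "(of_int (a * c') :: rat) = of_int (a' * c)" using False by (simp add: field_simps)
    thus ?thesis by (simp only: of_int_eq_iff)
  qed
  define e where "e = a' * d - b * c'"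
  define e' where "e' = a * d' - b' * c"
  have e: "a * e = a'" "c * e = c'"
  proof -
    have "a * e = a' * (a * d) - b * (a * c')" by (simp add: e_def algebra_simps)
    also have "\<dots> = a' * (a * d - b * c)" unfolding cross by (simp add: algebra_simps)
    finally show "a * e = a'" by (simp add: assms(1))
    have "c * e = (a' * c) * d - b * c * c'" by (simp add: e_def algebra_simps)
    also have "\<dots> = c' * (a * d - b * c)" unfolding cross[symmetric] by (simp add: algebra_simps)
    finally show "c * e = c'" by (simp add: assms(1))
  qed
  have e': "a' * e' = a" "c' * e' = c"
  proof -
    have "a' * e' = a * (a' * d') - b' * (a' * c)" by (simp add: e'_def algebra_simps)
    also have "\<dots> = a * (a' * d' - b' * c')" unfolding cross[symmetric] by (simp add: algebra_simps)
    finally show "a' * e' = a" by (simp add: assms(2))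
    have "c' * e' = (a * c') * d' - b' * c * c'" by (simp add: e'_def algebra_simps)
    also have "\<dots> = c * (a' * d' - b' * c')" unfolding cross by (simp add: algebra_simps)
    finally show "c' * e' = c" by (simp add: assms(2))
  qed
  have "a * (e * e' - 1) = 0" "c * (e * e' - 1) = 0"
    using e e' by (simp_all add: right_diff_distrib mult.assoc[symmetric])
  moreover have "a \<noteq> 0 \<or> c \<noteq> 0" using assms(1) by auto
  ultimately have "e * e' = 1" by auto
  hence "e = 1 \<or> e = -1" by (auto simp: zmult_eq_1_iff)
  thus "(a = a' \<and> c = c') \<or> (a = - a' \<and> c = - c')" using e by auto
next
  assume "(a = a' \<and> c = c') \<or> (a = - a' \<and> c = - c')"
  thus "act (mat2 a b c d) Infty = act (mat2 a' b' c' d') Infty" by (auto simp: act_Infty_mat2)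
qed

lemma orbit0_Gamma0:
  assumes "G \<in> Gamma0 N" "A \<in> SL2Z"
  shows "orbit0 N (act (G ** A) Infty) = orbit0 N (act A Infty)"
proof -
  note GS = Gamma0_SL2Z[OF assms(1)]
  have 1: "act H (act (G ** A) Infty) = act (H ** G) (act A Infty)" if "H \<in> Gamma0 N" for H
    using that GS assms(2) by (simp add: Gamma0_SL2Z SL2Z_mult matrix_mul_assoc flip: act_mult_Infty)
  have 2: "act H (act A Infty) = act (H ** minv G) (act (G ** A) Infty)" if "H \<in> Gamma0 N" for H
  proof -
    have "H ** minv G ** (G ** A) = H ** (minv G ** G) ** A" by (simp only: matrix_mul_assoc)
    also have "\<dots> = H ** A" by (simp add: SL2Z_minv[OF GS])
    finally have "H ** minv G ** (G ** A) = H ** A" .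
    moreover have "H ** minv G \<in> SL2Z" using that GS by (intro SL2Z_mult SL2Z_minv) (auto simp: Gamma0_SL2Z)
    ultimately show ?thesis using that GS assms(2) by (simp add: Gamma0_SL2Z SL2Z_mult flip: act_mult_Infty)
  qed
  show ?thesis
  proof (intro equalityI subsetI)
    fix p assume "p \<in> orbit0 N (act (G ** A) Infty)"
    then obtain H where "H \<in> Gamma0 N" "p = act H (act (G ** A) Infty)" by (auto simp: orbit0_def)
    thus "p \<in> orbit0 N (act A Infty)" using 1[of H] Gamma0_mult[of H N G] assms(1) unfolding orbit0_def by blast
  next
    fix p assume "p \<in> orbit0 N (act A Infty)"
    then obtain H where "H \<in> Gamma0 N" "p = act H (act A Infty)" by (auto simp: orbit0_def)
    thus "p \<in> orbit0 N (act (G ** A) Infty)" using 2[of H] Gamma0_mult[of H N "minv G"] Gamma0_minv[OF assms(1)] unfolding orbit0_def by blast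
  qed
qed

lemma orbit0_eq_iff:
  assumes "A \<in> SL2Z" "B \<in> SL2Z"
  shows "orbit0 N (act A Infty) = orbit0 N (act B Infty) \<longleftrightarrow> (\<exists>G\<in>Gamma0 N. act (G ** A) Infty = act B Infty)"
proof
  assume eq: "orbit0 N (act A Infty) = orbit0 N (act B Infty)"
  have "act (mat 1) (act B Infty) \<in> orbit0 N (act B Infty)" using mat_1_in_Gamma0 unfolding orbit0_def by blast
  moreover have "act (mat 1) (act B Infty) = act B Infty"
    using assms(2) Gamma0_SL2Z[OF mat_1_in_Gamma0] by (simp flip: act_mult_Infty)
  ultimately obtain G where "G \<in> Gamma0 N" "act B Infty = act G (act A Infty)" using eq unfolding orbit0_def by auto
  thus "\<exists>G\<in>Gamma0 N. act (G ** A) Infty = act B Infty"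
    using act_mult_Infty[OF Gamma0_SL2Z assms(1)] by metis
next
  assume "\<exists>G\<in>Gamma0 N. act (G ** A) Infty = act B Infty"
  thus "orbit0 N (act A Infty) = orbit0 N (act B Infty)" using orbit0_Gamma0[OF _ assms(1)] by metis
qed

lemma is_level_uminus [simp]: "is_level r (- c) k \<longleftrightarrow> is_level r c k"
  by (simp add: is_level_def)

text \<open>Modulo \<open>2 ^ r\<close> the group multiplies the denominator of a cusp by an odd
  number, which preserves the capped exponent of 2.\<close>

lemma is_level_Gamma0:
  assumes "\<alpha> * \<delta> - \<beta> * (2 ^ r * \<gamma>) = (1::int)" "is_level r c k"
  shows "is_level r (2 ^ r * \<gamma> * a + \<delta> * c) k"
proof (cases "r = 0")
  case True
  thus ?thesis using assms(2) by (simp add: is_level_def)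
next
  case False
  have "odd \<delta>" using det_odd(2)[OF assms(1)] False by simp
  have *: "2 ^ j dvd 2 ^ r * \<gamma> * a + \<delta> * c \<longleftrightarrow> 2 ^ j dvd c" if "j \<le> r" for j
  proof -
    have "(2::int) ^ j dvd 2 ^ r * \<gamma> * a" using that by (simp add: le_imp_power_dvd)
    hence "2 ^ j dvd 2 ^ r * \<gamma> * a + \<delta> * c \<longleftrightarrow> 2 ^ j dvd \<delta> * c" by (rule dvd_add_right_iff)
    also have "\<dots> \<longleftrightarrow> 2 ^ j dvd c"
      using \<open>odd \<delta>\<close> by (intro coprime_dvd_mult_right_iff) (simp add: coprime_power_left_iff coprime_left_2_iff_odd)
    finally show ?thesis .
  qed
  show ?thesis using assms(2) *[of k] *[of "Suc k"] unfolding is_level_def by auto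
qed

lemma orbit0_same_level:
  assumes "A \<in> SL2Z" "B \<in> SL2Z" "orbit0 (2 ^ r) (act A Infty) = orbit0 (2 ^ r) (act B Infty)"
    and "is_level r (entry A 2 1) k" "is_level r (entry B 2 1) l"
  shows "k = l"
proof -
  obtain G where G: "G \<in> Gamma0 (2 ^ r)" "act (G ** A) Infty = act B Infty"
    using assms(3) orbit0_eq_iff[OF assms(1,2)] by blast
  obtain a b c d where A: "A = mat2 a b c d" "a * d - b * c = 1" by (rule SL2Z_cases[OF assms(1)])
  obtain a' b' c' d' where B: "B = mat2 a' b' c' d'" "a' * d' - b' * c' = 1" by (rule SL2Z_cases[OF assms(2)])
  obtain \<alpha> \<beta> g \<delta> where G': "G = mat2 \<alpha> \<beta> g \<delta>" "\<alpha> * \<delta> - \<beta> * g = 1" "int (2 ^ r) dvd g" by (rule Gamma0_cases[OF G(1)])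
  obtain \<gamma> where \<gamma>: "g = 2 ^ r * \<gamma>" using G'(3) by auto
  have GA: "G ** A \<in> SL2Z" using G(1) assms(1) by (intro SL2Z_mult) (auto simp: Gamma0_SL2Z)
  hence det: "(\<alpha> * a + \<beta> * c) * (g * b + \<delta> * d) - (\<alpha> * b + \<beta> * d) * (g * a + \<delta> * c) = 1"
    by (simp add: G'(1) A(1) mat2_mult mat2_in_SL2Z)
  have "c' = g * a + \<delta> * c \<or> c' = - (g * a + \<delta> * c)"
    using G(2) act_Infty_eq_iff[OF det B(2)] unfolding G'(1) A(1) B(1) mat2_mult by auto
  moreover have "is_level r (g * a + \<delta> * c) k"
    using is_level_Gamma0[OF G'(2)[unfolded \<gamma>], of c k a] assms(4) by (simp add: A(1) \<gamma>)
  ultimately have "is_level r c' k" using is_level_uminus[of r "g * a + \<delta> * c" k] by auto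
  thus ?thesis using assms(5) is_level_unique by (simp add: B(1))
qed

section \<open>Classification and number of the cusps of a given level\<close>

lemma rational_cusp:
  assumes "coprime x ((2::int) ^ k)"
  obtains b d where "x * d - b * 2 ^ k = 1" "act (mat2 x b (2 ^ k) d) Infty = Rational (of_int x / 2 ^ k)"
proof -
  have "coprime (2 ^ k) x" using assms by (simp add: coprime_commute)
  then obtain u v where "u * 2 ^ k + v * x = 1" using bezout_int[of "2 ^ k" x] by auto
  hence "x * v - (- u) * 2 ^ k = 1" by (simp add: algebra_simps)
  moreover have "act (mat2 x (-u) (2 ^ k) v) Infty = Rational (of_int x / 2 ^ k)" by (simp add: act_Infty_mat2)
  ultimately show ?thesis by (rule that)
qed

lemma is_level_power: "k \<le> r \<Longrightarrow> is_level r (2 ^ k) k"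
  unfolding is_level_def by (auto dest: zdvd_imp_le)

lemma cusps_of_levelE:
  assumes "p \<in> cusps_of_level r k" "k \<le> r"
  obtains A where "A \<in> SL2Z" "is_level r (entry A 2 1) k" "p = orbit0 (2 ^ r) (act A Infty)"
proof -
  obtain x where x: "coprime x ((2::int) ^ k)" "p = orbit0 (2 ^ r) (Rational (of_int x / 2 ^ k))"
    using assms(1) unfolding cusps_of_level_def by auto
  obtain b d where bd: "x * d - b * 2 ^ k = 1" "act (mat2 x b (2 ^ k) d) Infty = Rational (of_int x / 2 ^ k)"
    using rational_cusp[OF x(1)] by blast
  show ?thesis
    by (rule that[of "mat2 x b (2 ^ k) d"]) (use bd x assms(2) in \<open>auto simp: mat2_in_SL2Z is_level_power\<close>)
qed

text \<open>A cusp has to be moved to one whose denominator is exactly \<open>2 ^ k\<close>. For k <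
  r, Bezout's identity for \<open>2 ^ (r - k) * a\<close> and the odd number u produces the bottom
  row of the required group element, whose last entry is automatically odd. For k = r, A itself lies
  in the group and can be replaced by (1, 0; \<open>2 ^ r\<close>, 1).\<close>

lemma orbit0_in_cusps_of_level:
  assumes "A \<in> SL2Z" "is_level r (entry A 2 1) k"
  shows "orbit0 (2 ^ r) (act A Infty) \<in> cusps_of_level r k"
proof -
  obtain a b c d where A: "A = mat2 a b c d" "a * d - b * c = 1" by (rule SL2Z_cases[OF assms(1)])
  have lev: "is_level r c k" using assms(2) by (simp add: A(1))
  have "\<exists>G\<in>Gamma0 (2 ^ r). \<exists>x y z. G ** A = mat2 x y (2 ^ k) z"
  proof (cases "k < r")
    case True
    obtain u where u: "c = 2 ^ k * u" using lev unfolding is_level_def by blast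
    have "odd u" using lev True unfolding is_level_def u by simp
    have r: "(2::int) ^ r = 2 ^ k * 2 ^ (r - k)" using True by (simp flip: power_add)
    have "coprime a u"
    proof (rule coprimeI)
      fix e assume "e dvd a" "e dvd u"
      hence "e dvd a * d - b * c" unfolding u by (intro dvd_diff dvd_mult2 dvd_mult) auto
      thus "is_unit e" by (simp add: A(2))
    qed
    moreover have "coprime (2 ^ (r - k)) u" using \<open>odd u\<close> by (simp add: coprime_power_left_iff coprime_left_2_iff_odd)
    ultimately have "coprime (2 ^ (r - k) * a) u" by (simp add: coprime_mult_left_iff)
    then obtain \<gamma> \<delta> where \<gamma>\<delta>: "\<gamma> * (2 ^ (r - k) * a) + \<delta> * u = 1" using bezout_int[of "2 ^ (r - k) * a" u] by auto
    have "odd \<delta>"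
    proof
      assume "even \<delta>"
      moreover have "even ((2::int) ^ (r - k))" using True by simp
      ultimately have "even (\<gamma> * (2 ^ (r - k) * a) + \<delta> * u)" by simp
      thus False by (simp add: \<gamma>\<delta>)
    qed
    have "coprime \<gamma> \<delta>"
    proof (rule coprimeI)
      fix e assume "e dvd \<gamma>" "e dvd \<delta>"
      hence "e dvd \<gamma> * (2 ^ (r - k) * a) + \<delta> * u" by (intro dvd_add dvd_mult2) auto
      thus "is_unit e" by (simp add: \<gamma>\<delta>)
    qed
    hence "coprime (2 ^ r * \<gamma>) \<delta>" using \<open>odd \<delta>\<close> by (simp add: coprime_mult_left_iff coprime_power_left_iff coprime_left_2_iff_odd)
    then obtain \<alpha> \<beta> where "\<alpha> * \<delta> - \<beta> * (2 ^ r * \<gamma>) = 1" by (rule coprime_row_completion)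
    hence G: "mat2 \<alpha> \<beta> (2 ^ r * \<gamma>) \<delta> \<in> Gamma0 (2 ^ r)" by (simp add: mat2_in_Gamma0)
    have "2 ^ r * \<gamma> * a + \<delta> * c = 2 ^ k * (\<gamma> * (2 ^ (r - k) * a) + \<delta> * u)" by (simp add: r u algebra_simps)
    hence "2 ^ r * \<gamma> * a + \<delta> * c = 2 ^ k" by (simp add: \<gamma>\<delta>)
    hence "mat2 \<alpha> \<beta> (2 ^ r * \<gamma>) \<delta> ** A = mat2 (\<alpha> * a + \<beta> * c) (\<alpha> * b + \<beta> * d) (2 ^ k) (2 ^ r * \<gamma> * b + \<delta> * d)"
      unfolding A(1) mat2_mult by simp
    thus ?thesis using G by blast
  next
    case False
    hence k: "k = r" using lev by (simp add: is_level_def)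
    hence AG: "A \<in> Gamma0 (2 ^ r)" using lev A(2) unfolding A(1) by (simp add: mat2_in_Gamma0 is_level_def)
    have B: "mat2 1 0 (2 ^ r) 1 \<in> Gamma0 (2 ^ r)" by (simp add: mat2_in_Gamma0)
    have "mat2 1 0 (2 ^ r) 1 ** minv A ** A = mat2 1 0 (2 ^ r) 1"
      using SL2Z_minv[OF assms(1)] by (simp flip: matrix_mul_assoc)
    thus ?thesis using Gamma0_mult[OF B Gamma0_minv[OF AG]] k by blast
  qed
  then obtain G x y z where G: "G \<in> Gamma0 (2 ^ r)" "G ** A = mat2 x y (2 ^ k) z" by blast
  have "G ** A \<in> SL2Z" using G(1) assms(1) by (intro SL2Z_mult) (auto simp: Gamma0_SL2Z)
  hence det: "x * z - y * 2 ^ k = 1" by (simp add: G(2) mat2_in_SL2Z)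
  have "coprime x (2 ^ k)"
  proof (rule coprimeI)
    fix e assume "e dvd x" "e dvd 2 ^ k"
    hence "e dvd x * z - y * 2 ^ k" by (intro dvd_diff dvd_mult2 dvd_mult) auto
    thus "is_unit e" by (simp add: det)
  qed
  moreover have "orbit0 (2 ^ r) (act A Infty) = orbit0 (2 ^ r) (Rational (of_int x / 2 ^ k))"
    using orbit0_Gamma0[OF G(1) assms(1)] unfolding G(2) by (simp add: act_Infty_mat2)
  ultimately show ?thesis unfolding cusps_of_level_def by blast
qed

lemma cusp_of_level_iff:
  assumes "A \<in> SL2Z" "is_level r (entry A 2 1) k" "l \<le> r"
  shows "orbit0 (2 ^ r) (act A Infty) \<in> cusps_of_level r l \<longleftrightarrow> k = l"
proof
  assume "orbit0 (2 ^ r) (act A Infty) \<in> cusps_of_level r l"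
  from cusps_of_levelE[OF this assms(3)] show "k = l"
    using orbit0_same_level[OF assms(1) _ _ assms(2)] by metis
qed (use orbit0_in_cusps_of_level[OF assms(1,2)] in simp)

text \<open>A group element linking two cusps of denominator \<open>2 ^ k\<close> is congruent to a
  sign on the diagonal modulo \<open>2 ^ min k (r - k)\<close>. Conversely,
  \<open>B ** mat2 1 h 0 1 ** minv A\<close> links them for every h, and h can be adjusted such that
  it lies in the group.\<close>

lemma Rational_orbit_eq_iff:
  assumes k: "k \<le> r" and x: "coprime x ((2::int) ^ k)" and x': "coprime x' (2 ^ k)"
  shows "orbit0 (2 ^ r) (Rational (of_int x / 2 ^ k)) = orbit0 (2 ^ r) (Rational (of_int x' / 2 ^ k)) \<longleftrightarrow>
    2 ^ min k (r - k) dvd x' - x"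
proof -
  define m where "m = min k (r - k)"
  obtain b d where bd: "x * d - b * 2 ^ k = 1" "act (mat2 x b (2 ^ k) d) Infty = Rational (of_int x / 2 ^ k)"
    using rational_cusp[OF x] by blast
  obtain b' d' where bd': "x' * d' - b' * 2 ^ k = 1" "act (mat2 x' b' (2 ^ k) d') Infty = Rational (of_int x' / 2 ^ k)"
    using rational_cusp[OF x'] by blast
  define A B where "A = mat2 x b (2 ^ k) d" "B = mat2 x' b' (2 ^ k) d'"
  have AB: "A \<in> SL2Z" "B \<in> SL2Z" using bd bd' by (auto simp: A_B_def mat2_in_SL2Z)
  have rk: "(2::int) ^ r = 2 ^ k * 2 ^ (r - k)" using k by (simp flip: power_add)
  have mk: "(2::int) ^ m dvd 2 ^ k" "(2::int) ^ m dvd 2 ^ (r - k)" by (auto simp: m_def intro: le_imp_power_dvd)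
  have "orbit0 (2 ^ r) (act A Infty) = orbit0 (2 ^ r) (act B Infty) \<longleftrightarrow> 2 ^ m dvd x' - x"
  proof
    assume "orbit0 (2 ^ r) (act A Infty) = orbit0 (2 ^ r) (act B Infty)"
    then obtain G where G: "G \<in> Gamma0 (2 ^ r)" "act (G ** A) Infty = act B Infty" using orbit0_eq_iff[OF AB] by blast
    obtain \<alpha> \<beta> g \<delta> where G': "G = mat2 \<alpha> \<beta> g \<delta>" "\<alpha> * \<delta> - \<beta> * g = 1" "int (2 ^ r) dvd g" by (rule Gamma0_cases[OF G(1)])
    obtain \<gamma> where \<gamma>: "g = 2 ^ r * \<gamma>" using G'(3) by auto
    have GA: "G ** A \<in> SL2Z" using G(1) AB(1) by (intro SL2Z_mult) (auto simp: Gamma0_SL2Z)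
    hence det: "(\<alpha> * x + \<beta> * 2 ^ k) * (g * b + \<delta> * d) - (\<alpha> * b + \<beta> * d) * (g * x + \<delta> * 2 ^ k) = 1"
      by (simp add: G'(1) A_B_def mat2_mult mat2_in_SL2Z)
    have "(\<alpha> * x + \<beta> * 2 ^ k = x' \<and> g * x + \<delta> * 2 ^ k = 2 ^ k) \<or> (\<alpha> * x + \<beta> * 2 ^ k = - x' \<and> g * x + \<delta> * 2 ^ k = - (2 ^ k))"
      using G(2) act_Infty_eq_iff[OF det bd'(1)] unfolding G'(1) A_B_def mat2_mult by auto
    then obtain s where s: "s = 1 \<or> s = -1" "\<alpha> * x + \<beta> * 2 ^ k = s * x'" "g * x + \<delta> * 2 ^ k = s * 2 ^ k" by force
    have "2 ^ k * (2 ^ (r - k) * (\<gamma> * x) + \<delta>) = g * x + \<delta> * 2 ^ k"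
      unfolding \<gamma> rk by (simp only: distrib_left mult_ac)
    also have "\<dots> = 2 ^ k * s" using s(3) by (simp only: mult.commute)
    finally have "\<delta> = s - 2 ^ (r - k) * (\<gamma> * x)" by simp
    hence \<delta>: "2 ^ m dvd \<delta> - s" using mk(2) by simp
    have "2 ^ m dvd g" using mk(1) by (simp add: \<gamma> rk)
    moreover have ss: "s * s = 1" using s(1) by auto
    have "\<alpha> - s = - s * (\<alpha> * (\<delta> - s)) + s * (\<beta> * g)"
    proof -
      have "- s * (\<alpha> * (\<delta> - s)) + s * (\<beta> * g) = - s * (\<alpha> * \<delta> - \<beta> * g) + (s * s) * \<alpha>" by (simp add: algebra_simps)
      thus ?thesis by (simp add: G'(2) ss)
    qed
    ultimately have "2 ^ m dvd \<alpha> - s" using \<delta> by (metis dvd_add dvd_mult)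
    moreover have "s * (x' - x) = (\<alpha> - s) * x + \<beta> * 2 ^ k" using s(2) by (simp add: algebra_simps)
    ultimately have "2 ^ m dvd s * (x' - x)" using mk(1) by simp
    thus "2 ^ m dvd x' - x" using s(1) by (auto simp: dvd_diff_commute)
  next
    assume dvd: "2 ^ m dvd x' - x"
    have "d - d' = d * (x' * d' - b' * 2 ^ k) - d' * (x * d - b * 2 ^ k)" unfolding bd bd' by simp
    also have "\<dots> = (x' - x) * (d * d') + 2 ^ k * (b * d' - b' * d)" by (simp add: algebra_simps)
    finally have dd: "2 ^ m dvd d - d'" using dvd mk(1) by simp
    \<comment> \<open>The lower left entry of the candidate is
      \<open>2 ^ k * (d - d' - h * 2 ^ k)\<close>. The shift h is useful only if k is the smaller of
      the two exponents; otherwise the congruence of d and d' already suffices.\<close>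
    obtain h where h: "2 ^ (r - k) dvd d - d' - h * 2 ^ k"
    proof (cases "k \<le> r - k")
      case True
      hence "m = k" by (simp add: m_def)
      then obtain h where "d - d' = 2 ^ k * h" using dd by auto
      thus ?thesis by (intro that[of h]) simp
    next
      case False
      thus ?thesis using dd by (intro that[of 0]) (simp add: m_def)
    qed
    define G where "G = B ** mat2 1 h 0 1 ** minv A"
    have GS: "G \<in> SL2Z" unfolding G_def using AB SL2Z_minv by (intro SL2Z_mult) (auto simp: mat2_in_SL2Z)
    have "entry G 2 1 = 2 ^ k * (d - d' - h * 2 ^ k)" by (simp add: G_def A_B_def mat2_mult algebra_simps)
    hence "2 ^ r dvd entry G 2 1" unfolding rk using h by (simp add: mult_dvd_mono)
    hence G: "G \<in> Gamma0 (2 ^ r)" using GS by (simp add: Gamma0_def)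
    have "G ** A = B ** mat2 1 h 0 1 ** (minv A ** A)" by (simp add: G_def matrix_mul_assoc)
    hence "G ** A = B ** mat2 1 h 0 1" using SL2Z_minv(3)[OF AB(1)] by simp
    also have "\<dots> = mat2 x' (x' * h + b') (2 ^ k) (2 ^ k * h + d')" unfolding A_B_def mat2_mult by simp
    finally have "G ** A = mat2 x' (x' * h + b') (2 ^ k) (2 ^ k * h + d')" .
    hence "act (G ** A) Infty = act B Infty" by (simp add: A_B_def act_Infty_mat2)
    thus "orbit0 (2 ^ r) (act A Infty) = orbit0 (2 ^ r) (act B Infty)" using orbit0_eq_iff[OF AB] G by blast
  qed
  thus ?thesis using bd(2) bd'(2) by (simp add: A_B_def m_def)
qed

text \<open>Euler's totient of \<open>2 ^ min k (r - k)\<close>.\<close>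

definition num_cusps :: "nat \<Rightarrow> nat \<Rightarrow> nat" where
  "num_cusps r k = (if min k (r - k) = 0 then 1 else 2 ^ (min k (r - k) - 1))"

lemma bij_betw_images:
  assumes "\<And>x y. x \<in> S \<Longrightarrow> y \<in> S \<Longrightarrow> f x = f y \<longleftrightarrow> g x = g y"
  shows "\<exists>h. bij_betw h (g ` S) (f ` S)"
proof -
  have "\<forall>y\<in>g ` S. \<exists>x. x \<in> S \<and> g x = y" by auto
  from bchoice[OF this] obtain p where p: "\<And>y. y \<in> g ` S \<Longrightarrow> p y \<in> S \<and> g (p y) = y" by blast
  have "inj_on (\<lambda>y. f (p y)) (g ` S)"
  proof (rule inj_onI)
    fix y z assume yz: "y \<in> g ` S" "z \<in> g ` S" "f (p y) = f (p z)"
    hence "g (p y) = g (p z)" using assms[of "p y" "p z"] p by simp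
    thus "y = z" using p[OF yz(1)] p[OF yz(2)] by simp
  qed
  moreover have "(\<lambda>y. f (p y)) ` g ` S = f ` S"
  proof (intro equalityI subsetI)
    fix z assume "z \<in> (\<lambda>y. f (p y)) ` g ` S"
    thus "z \<in> f ` S" using p by auto
  next
    fix z assume "z \<in> f ` S"
    then obtain x where x: "x \<in> S" "z = f x" by auto
    hence "f (p (g x)) = f x" using assms[of "p (g x)" x] p[of "g x"] by simp
    thus "z \<in> (\<lambda>y. f (p y)) ` g ` S" using x by force
  qed
  ultimately show ?thesis unfolding bij_betw_def by blast
qed

lemma cusps_of_level_finite_card:
  assumes "k \<le> r"
  shows "finite (cusps_of_level r k)" "card (cusps_of_level r k) = num_cusps r k"
proof -
  define m where "m = min k (r - k)"
  define S where "S = {x::int. coprime x (2 ^ k)}"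
  define f where "f = (\<lambda>x::int. orbit0 (2 ^ r) (Rational (of_int x / 2 ^ k)))"
  define g where "g = (\<lambda>x::int. x mod 2 ^ m)"
  have "f x = f y \<longleftrightarrow> g x = g y" if "x \<in> S" "y \<in> S" for x y
    using Rational_orbit_eq_iff[OF assms, of x y] that unfolding f_def g_def S_def m_def mod_eq_dvd_iff
    by (simp add: dvd_diff_commute)
  then obtain h where bij: "bij_betw h (g ` S) (f ` S)" using bij_betw_images[of S f g] by blast
  have fS: "f ` S = cusps_of_level r k" by (auto simp: f_def S_def cusps_of_level_def)
  have "finite (g ` S) \<and> card (g ` S) = num_cusps r k"
  proof (cases "m = 0")
    case True
    have "1 \<in> S" by (simp add: S_def)
    hence "g ` S = {0}" using True by (auto simp: g_def)
    thus ?thesis using True by (simp add: num_cusps_def m_def)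
  next
    case False
    hence k: "k > 0" by (auto simp: m_def)
    have S: "S = {x. odd x}" using k by (auto simp: S_def coprime_power_right_iff coprime_right_2_iff_odd)
    have m2: "(2::int) ^ m = 2 * 2 ^ (m - 1)" using False by (cases m) auto
    have "g ` S = (\<lambda>i. 2 * i + 1) ` {0..<2 ^ (m - 1)}"
    proof (intro equalityI subsetI)
      fix y assume "y \<in> g ` S"
      then obtain x where x: "odd x" "y = x mod 2 ^ m" by (auto simp: g_def S)
      have "odd y" using x False by (simp add: dvd_mod_iff)
      then obtain i where i: "y = 2 * i + 1" by (elim oddE)
      have "0 \<le> y" "y < 2 ^ m" by (auto simp: x(2))
      thus "y \<in> (\<lambda>i. 2 * i + 1) ` {0..<2 ^ (m - 1)}" unfolding i m2 by auto
    next
      fix y :: int assume "y \<in> (\<lambda>i. 2 * i + 1) ` {0..<2 ^ (m - 1)}"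
      then obtain i where i: "y = 2 * i + 1" "0 \<le> i" "i < 2 ^ (m - 1)" by auto
      have "y mod 2 ^ m = y" by (rule mod_pos_pos_trivial) (use i m2 in auto)
      hence "y = g y" by (simp add: g_def)
      moreover have "y \<in> S" by (simp add: S i)
      ultimately show "y \<in> g ` S" by blast
    qed
    moreover have "card ((\<lambda>i::int. 2 * i + 1) ` {0..<2 ^ (m - 1)}) = 2 ^ (m - 1)"
      by (subst card_image) (auto simp: inj_on_def)
    ultimately show ?thesis using False by (simp add: num_cusps_def m_def)
  qed
  thus "finite (cusps_of_level r k)" "card (cusps_of_level r k) = num_cusps r k"
    using bij_betw_finite[OF bij] bij_betw_same_card[OF bij] by (auto simp: fS)
qed

section \<open>Coefficients and degrees of cuspidal divisors\<close>

lemma lookup_level_divisor: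
  assumes "k \<le> r"
  shows "Poly_Mapping.lookup (level_divisor r k) p = (if p \<in> cusps_of_level r k then 1 else 0)"
proof -
  have "Poly_Mapping.lookup (level_divisor r k) p = (\<Sum>q\<in>cusps_of_level r k. if q = p then 1 else 0)"
    unfolding level_divisor_def lookup_sum
    by (intro sum.cong refl) (auto simp: lookup_frag_of)
  thus ?thesis using cusps_of_level_finite_card(1)[OF assms] by (simp add: sum.delta)
qed

lemma lookup_cuspidal_divisor:
  "Poly_Mapping.lookup (cuspidal_divisor r a) p = (\<Sum>k\<le>r. if p \<in> cusps_of_level r k then a k else 0)"
  unfolding cuspidal_divisor_def lookup_sum
  by (intro sum.cong refl) (simp add: lookup_level_divisor lookup_frag_cmul)

lemma lookup_cuspidal_divisor_cusp:
  assumes "A \<in> SL2Z" "is_level r (entry A 2 1) k"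
  shows "Poly_Mapping.lookup (cuspidal_divisor r a) (orbit0 (2 ^ r) (act A Infty)) = a k"
proof -
  have "k \<le> r" using assms(2) by (simp add: is_level_def)
  have "Poly_Mapping.lookup (cuspidal_divisor r a) (orbit0 (2 ^ r) (act A Infty)) = (\<Sum>l\<le>r. if k = l then a l else 0)"
    unfolding lookup_cuspidal_divisor
    by (intro sum.cong refl if_cong cusp_of_level_iff[OF assms]) auto
  thus ?thesis using \<open>k \<le> r\<close> by (simp add: sum.delta')
qed

lemma orbit0_Inner_not_cusp:
  assumes "k \<le> r"
  shows "orbit0 (2 ^ r) (Inner z) \<notin> cusps_of_level r k"
proof
  assume "orbit0 (2 ^ r) (Inner z) \<in> cusps_of_level r k"
  then obtain x :: int where x: "orbit0 (2 ^ r) (Inner z) = orbit0 (2 ^ r) (Rational (of_int x / 2 ^ k))"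
    by (auto simp: cusps_of_level_def)
  have "act (mat 1) (Inner z) \<in> orbit0 (2 ^ r) (Inner z)" using mat_1_in_Gamma0 unfolding orbit0_def by blast
  then obtain G where "act (mat 1) (Inner z) = act G (Rational (of_int x / 2 ^ k))" unfolding x by (auto simp: orbit0_def)
  thus False by (simp add: act.simps split: if_splits)
qed

lemma lookup_cuspidal_divisor_Inner:
  "Poly_Mapping.lookup (cuspidal_divisor r a) (orbit0 (2 ^ r) (Inner z)) = 0"
  unfolding lookup_cuspidal_divisor by (intro sum.neutral) (simp add: orbit0_Inner_not_cusp)

lemma keys_cuspidal_divisor: "Poly_Mapping.keys (cuspidal_divisor r a) \<subseteq> X0 (2 ^ r)"
proof
  fix p assume "p \<in> Poly_Mapping.keys (cuspidal_divisor r a)"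
  hence "(\<Sum>k\<le>r. if p \<in> cusps_of_level r k then a k else 0) \<noteq> 0"
    by (simp add: in_keys_iff lookup_cuspidal_divisor)
  then obtain k where "p \<in> cusps_of_level r k" by (metis (mono_tags, lifting) sum.neutral)
  thus "p \<in> X0 (2 ^ r)" by (auto simp: cusps_of_level_def X0_def ext_upper_half_plane_def)
qed

lemma deg_frag_of [simp]: "deg (frag_of p) = 1"
  by (simp add: deg_def lookup_frag_of)

lemma deg_sum: "deg (\<Sum>i\<in>S. f i) = (\<Sum>i\<in>S. deg (f i))"
  by (induction S rule: infinite_finite_induct) (auto simp: deg_add)

lemma deg_frag_cmul: "deg (frag_cmul c D) = c * deg D"
proof -
  have "deg (frag_cmul c D) = (\<Sum>p\<in>Poly_Mapping.keys D. Poly_Mapping.lookup (frag_cmul c D) p)"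
    by (rule deg_alt[OF finite_keys keys_cmul])
  thus ?thesis by (simp add: lookup_frag_cmul deg_def sum_distrib_left)
qed

lemma deg_cuspidal_divisor: "deg (cuspidal_divisor r a) = (\<Sum>k\<le>r. a k * int (num_cusps r k))"
  unfolding cuspidal_divisor_def deg_sum deg_frag_cmul
  by (intro sum.cong refl) (simp add: level_divisor_def deg_sum cusps_of_level_finite_card)

lemma cuspidal_divisor_add: "cuspidal_divisor r (\<lambda>k. a k + b k) = cuspidal_divisor r a + cuspidal_divisor r b"
  unfolding cuspidal_divisor_def frag_cmul_distrib by (rule sum.distrib)

lemma cuspidal_divisor_cong: "(\<And>k. k \<le> r \<Longrightarrow> a k = b k) \<Longrightarrow> cuspidal_divisor r a = cuspidal_divisor r b"
  unfolding cuspidal_divisor_def by (intro sum.cong) auto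

section \<open>Principal cuspidal divisors\<close>

text \<open>With \<open>\<gamma>\<^sub>k = gam r a k\<close> the exponents \<open>r\<^sub>k\<close> of \<open>\<eta>(2\<^sup>k \<tau>)\<close> in an eta quotient with divisor
  \<open>a\<close> are given by \<open>r\<^sub>k = 5 \<gamma>\<^sub>k - 2 \<gamma>\<^sub>k\<^sub>-\<^sub>1 - 2 \<gamma>\<^sub>k\<^sub>+\<^sub>1\<close> for \<open>0 < k < r\<close>; the exponent of
  \<open>\<eta>(2\<^sup>k\<^sup>+\<^sup>1 \<tau>) / \<eta>(2\<^sup>k \<tau>)\<close> is the sum of the \<open>r\<^sub>i\<close> with \<open>i > k\<close>.\<close>

definition gam :: "nat \<Rightarrow> (nat \<Rightarrow> int) \<Rightarrow> nat \<Rightarrow> real" where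
  "gam r a k = 8 * of_int (a k) / 2 ^ max k (r - k)"

definition gdiff :: "nat \<Rightarrow> (nat \<Rightarrow> int) \<Rightarrow> nat \<Rightarrow> real" where
  "gdiff r a j = 2 * gam r a (Suc j) - gam r a j"

definition qexp :: "nat \<Rightarrow> (nat \<Rightarrow> int) \<Rightarrow> nat \<Rightarrow> real" where
  "qexp r a k = 2 * gdiff r a k + (\<Sum>j\<in>{Suc k..<r}. gdiff r a j)"

text \<open>\<open>qexp\<close> is built such that this tail, which enters
  \<open>quot_order_split\<close>, collapses to a plain sum of the \<open>gdiff\<close>.\<close>

lemma qexp_tail:
  assumes "k \<le> r"
  shows "(\<Sum>i\<in>{k..<r}. qexp r a i / 2 ^ i) = 2 * (\<Sum>j\<in>{k..<r}. gdiff r a j) / 2 ^ k"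
  using assms
proof (induction k rule: inc_induct)
  case (step k)
  have "(\<Sum>i\<in>{k..<r}. qexp r a i / 2 ^ i) = qexp r a k / 2 ^ k + 2 * (\<Sum>j\<in>{Suc k..<r}. gdiff r a j) / 2 ^ Suc k"
    using step by (simp add: sum.atLeast_Suc_lessThan)
  also have "\<dots> = (2 * gdiff r a k + 2 * (\<Sum>j\<in>{Suc k..<r}. gdiff r a j)) / 2 ^ k"
    by (simp add: qexp_def field_simps)
  also have "2 * gdiff r a k + 2 * (\<Sum>j\<in>{Suc k..<r}. gdiff r a j) = 2 * (\<Sum>j\<in>{k..<r}. gdiff r a j)"
    using step by (simp add: sum.atLeast_Suc_lessThan)
  finally show ?case .
qed simp

lemma quot_order_split:
  assumes "k \<le> r"
  shows "24 * quot_order r s k = (\<Sum>i<k. s i * 2 ^ i) - 4 ^ k / 2 * (\<Sum>i\<in>{k..<r}. s i / 2 ^ i)"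
proof -
  have "24 * quot_order r s k = (\<Sum>i\<in>{..<k} \<union> {k..<r}. s i * order_coeff k i)"
    using assms by (simp add: quot_order_def ivl_disj_un)
  also have "\<dots> = (\<Sum>i<k. s i * order_coeff k i) + (\<Sum>i\<in>{k..<r}. s i * order_coeff k i)"
    by (rule sum.union_disjoint) auto
  also have "(\<Sum>i<k. s i * order_coeff k i) = (\<Sum>i<k. s i * 2 ^ i)"
    by (intro sum.cong) (auto simp: order_coeff_def)
  also have "(\<Sum>i\<in>{k..<r}. s i * order_coeff k i) = - (4 ^ k / 2 * (\<Sum>i\<in>{k..<r}. s i / 2 ^ i))"
    unfolding sum_distrib_left sum_negf[symmetric]
    by (intro sum.cong) (auto simp: order_coeff_def)
  finally show ?thesis by simp
qed

lemma sum_gdiff: "k \<le> r \<Longrightarrow> (\<Sum>j\<in>{k..<r}. gdiff r a j) = (\<Sum>j\<in>{k..<r}. gam r a j) + 2 * (gam r a r - gam r a k)"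
proof (induction k rule: inc_induct)
  case (step k)
  thus ?case by (simp add: sum.atLeast_Suc_lessThan gdiff_def)
qed simp

definition deg_zero :: "nat \<Rightarrow> (nat \<Rightarrow> int) \<Rightarrow> bool" where
  "deg_zero r a \<longleftrightarrow> deg (cuspidal_divisor r a) = 0"

lemma gam_num_cusps:
  assumes "k \<le> r"
  shows "real_of_int (a k) * real (num_cusps r k) = 2 ^ r / 16 * (if min k (r - k) = 0 then 2 * gam r a k else gam r a k)"
proof -
  have "min k (r - k) + max k (r - k) = r" using assms by simp
  hence p: "(2::real) ^ r = 2 ^ min k (r - k) * 2 ^ max k (r - k)" by (simp flip: power_add)
  show ?thesis
  proof (cases "min k (r - k) = 0")
    case True
    thus ?thesis using p by (simp add: num_cusps_def gam_def)
  next
    case False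
    then obtain m where m: "min k (r - k) = Suc m" using not0_implies_Suc by blast
    show ?thesis using p unfolding m by (simp add: num_cusps_def gam_def m)
  qed
qed

text \<open>The levels 1 and \<open>2\<^sup>r\<close> have one cusp each, twice the number that the
  formula \<open>2 ^ (m - 1)\<close> of the intermediate levels would suggest for m = 0. This
  explains the extra terms at both ends.\<close>

lemma deg_zero_iff:
  assumes "r \<ge> 1"
  shows "deg_zero r a \<longleftrightarrow> (\<Sum>j<r. gam r a j) + gam r a 0 + 2 * gam r a r = 0"
proof -
  have "real_of_int (deg (cuspidal_divisor r a)) = (\<Sum>k\<le>r. real_of_int (a k) * real (num_cusps r k))"
    by (simp add: deg_cuspidal_divisor)
  also have "\<dots> = (\<Sum>k\<le>r. 2 ^ r / 16 * (if min k (r - k) = 0 then 2 * gam r a k else gam r a k))"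
    by (intro sum.cong refl gam_num_cusps) auto
  also have "\<dots> = 2 ^ r / 16 * (\<Sum>k\<le>r. gam r a k + (if k = 0 then gam r a 0 else 0) + (if k = r then gam r a r else 0))"
    unfolding sum_distrib_left by (intro sum.cong refl) (use assms in \<open>auto simp: min_def\<close>)
  also have "(\<Sum>k\<le>r. gam r a k + (if k = 0 then gam r a 0 else 0) + (if k = r then gam r a r else 0))
      = (\<Sum>j<r. gam r a j) + gam r a 0 + 2 * gam r a r"
    unfolding sum.distrib by (simp add: lessThan_Suc_atMost[symmetric])
  finally have "real_of_int (deg (cuspidal_divisor r a)) = 2 ^ r / 16 * ((\<Sum>j<r. gam r a j) + gam r a 0 + 2 * gam r a r)" .
  thus ?thesis unfolding deg_zero_def by (metis divide_eq_0_iff mult_eq_0_iff of_int_eq_0_iff power_not_zero zero_neq_numeral)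
qed

text \<open>Checks that \<open>qexp\<close> inverts the matrix of orders. The step from k to k + 1
  is an identity; the degree condition enters through the base case k = 0.\<close>

lemma quot_order_qexp_aux:
  assumes "deg_zero r a" "r \<ge> 1" "k \<le> r"
  shows "24 * quot_order r (qexp r a) k = 3 * 2 ^ k * gam r a k"
proof -
  define Z where "Z = (\<lambda>k. \<Sum>j\<in>{k..<r}. gdiff r a j)"
  have v: "24 * quot_order r (qexp r a) k = (\<Sum>i<k. qexp r a i * 2 ^ i) - 2 ^ k * Z k" if "k \<le> r" for k
  proof -
    have "(4::real) ^ k = 2 ^ k * 2 ^ k" by (simp flip: power_mult_distrib)
    thus ?thesis unfolding quot_order_split[OF that] qexp_tail[OF that] Z_def by (simp add: field_simps)
  qed
  have "(\<Sum>i<k. qexp r a i * 2 ^ i) - 2 ^ k * Z k = 3 * 2 ^ k * gam r a k"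
    using assms(3)
  proof (induction k)
    case 0
    have "Z 0 = (\<Sum>j<r. gam r a j) + 2 * (gam r a r - gam r a 0)"
      unfolding Z_def using sum_gdiff[of 0 r a] by (simp add: atLeast0LessThan)
    also have "\<dots> = - 3 * gam r a 0" using assms(1) unfolding deg_zero_iff[OF assms(2)] by simp
    finally show ?case by simp
  next
    case (Suc k)
    have Zk: "Z k = gdiff r a k + Z (Suc k)" unfolding Z_def using Suc.prems by (simp add: sum.atLeast_Suc_lessThan)
    have q: "qexp r a k = 2 * gdiff r a k + Z (Suc k)" by (simp add: qexp_def Z_def)
    have IH: "(\<Sum>i<k. qexp r a i * 2 ^ i) = 3 * 2 ^ k * gam r a k + 2 ^ k * Z k" using Suc by simp
    have "(\<Sum>i<Suc k. qexp r a i * 2 ^ i) - 2 ^ Suc k * Z (Suc k) = 3 * 2 ^ k * gam r a k + 3 * 2 ^ k * gdiff r a k"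
      unfolding sum.lessThan_Suc IH q Zk by (simp add: algebra_simps)
    also have "\<dots> = 3 * 2 ^ Suc k * gam r a (Suc k)" by (simp add: gdiff_def algebra_simps)
    finally show ?case .
  qed
  thus ?thesis using v[OF assms(3)] by simp
qed

lemma quot_order_qexp:
  assumes "deg_zero r a" "k \<le> r"
  shows "quot_order r (qexp r a) k = a k / 2 ^ (r - 2 * k)"
proof (cases "r = 0")
  case True
  have "a 0 = 0" using assms(1) by (simp add: deg_zero_def deg_cuspidal_divisor True num_cusps_def)
  thus ?thesis using assms(2) by (simp add: True quot_order_def)
next
  case False
  have "24 * quot_order r (qexp r a) k = 3 * 2 ^ k * gam r a k" using False by (intro quot_order_qexp_aux assms) auto
  also have "\<dots> = 3 * (gam r a k * 2 ^ k)" by simp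
  also have "max k (r - k) = k + (r - 2 * k)" by auto
  hence "gam r a k * 2 ^ k = 8 * (a k / 2 ^ (r - 2 * k))" by (simp add: gam_def power_add)
  finally show ?thesis by linarith
qed

text \<open>The two weighted sums in Ligozat's criterion are the orders at the cusps infinity and 0
  up to a factor. Their divisibility by 24 is thus automatic once the divisor is integral.\<close>

lemma sums_from_orders:
  "(\<Sum>i<r. 2 ^ i * s i) = 24 * quot_order r s r"
  "(\<Sum>i<r. 2 ^ (r - 1 - i) * s i) = - 24 * 2 ^ r * quot_order r s 0"
proof -
  show "(\<Sum>i<r. 2 ^ i * s i) = 24 * quot_order r s r"
    unfolding quot_order_split[OF order.refl] by (simp add: mult.commute)
  have "(\<Sum>i<r. 2 ^ (r - 1 - i) * s i) = (\<Sum>i<r. 2 ^ r / 2 * (s i / 2 ^ i))"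
  proof (intro sum.cong refl)
    fix i assume "i \<in> {..<r}"
    hence "r = Suc (r - 1 - i) + i" by simp
    hence "(2::real) ^ r = 2 ^ Suc (r - 1 - i) * 2 ^ i" by (metis power_add)
    thus "2 ^ (r - 1 - i) * s i = 2 ^ r / 2 * (s i / 2 ^ i)" by simp
  qed
  also have "\<dots> = 2 ^ r / 2 * (\<Sum>i<r. s i / 2 ^ i)" by (rule sum_distrib_left[symmetric])
  also have "(\<Sum>i<r. s i / 2 ^ i) = - 48 * quot_order r s 0"
    using quot_order_split[of 0 r s] by (simp add: atLeast0LessThan)
  also have "2 ^ r / 2 * (- 48 * quot_order r s 0) = - 24 * 2 ^ r * quot_order r s 0" by simp
  finally show "(\<Sum>i<r. 2 ^ (r - 1 - i) * s i) = - 24 * 2 ^ r * quot_order r s 0" .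
qed

lemma cuspidal_in_Div0_iff: "cuspidal_divisor r a \<in> carrier (Div0 (2 ^ r)) \<longleftrightarrow> deg_zero r a"
  using keys_cuspidal_divisor by (auto simp: carrier_Div0 deg_zero_def)

section \<open>Principal divisors from eta quotients, and conversely\<close>

lemma principal_if:
  fixes s :: "nat \<Rightarrow> int"
  assumes deg: "deg_zero r a" and even: "even (\<Sum>i<r. s i)"
    and ord: "\<And>k. k \<le> r \<Longrightarrow> quot_order r (\<lambda>i. of_int (s i)) k = a k / 2 ^ (r - 2 * k)"
  shows "cuspidal_divisor r a \<in> principal_divisors (2 ^ r)"
proof -
  define f where "f = (\<lambda>t. exp (lquot r (\<lambda>i. of_int (s i)) t))"
  have hol: "f holomorphic_on upper_half_plane"
    unfolding f_def by (intro holomorphic_on_exp' holomorphic_lquot holomorphic_intros) auto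
  have f0: "f t \<noteq> 0" for t by (simp add: f_def)
  have "real_of_int (\<Sum>i<r. 2 ^ i * s i) = of_int (24 * a r)"
    using sums_from_orders(1)[where s = "\<lambda>i. of_int (s i)" and r = r] ord[of r] by simp
  hence s1: "24 dvd (\<Sum>i<r. 2 ^ i * s i)" unfolding of_int_eq_iff by simp
  have "real_of_int (\<Sum>i<r. 2 ^ (r - 1 - i) * s i) = of_int (- 24 * a 0)"
    using sums_from_orders(2)[where s = "\<lambda>i. of_int (s i)" and r = r] ord[of 0] by simp
  hence s2: "24 dvd (\<Sum>i<r. 2 ^ (r - 1 - i) * s i)" unfolding of_int_eq_iff by simp
  have inv: "Gamma0_invariant (2 ^ r) f"
    unfolding Gamma0_invariant_def
  proof (intro ballI allI impI)
    fix A z assume A: "A \<in> Gamma0 (2 ^ r)" and z: "Im z > 0"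
    obtain k where k: "(\<Sum>i<r. s i * periodM (dil i A)) = 24 * k"
      using sum_period_dvd[OF s1 s2 even A] by blast
    have "(\<Sum>i<r. real_of_int (s i) * real_of_int (periodM (dil i A))) = of_int (24 * k)"
      unfolding k[symmetric] by simp
    hence "lquot r (\<lambda>i. of_int (s i)) (mobius A z) = lquot r (\<lambda>i. of_int (s i)) z + 2 * pi * \<i> * of_int k"
      unfolding lquot_Gamma0[OF A z] by simp
    hence "f (mobius A z) = f z * ee (of_int k)" by (simp add: f_def exp_add ee_def)
    thus "f (mobius A z) = f z" by simp
  qed
  have cusp: "zorder (cusp_expansion (2 ^ r) f A) 0 = a k \<and> cusp_expansion (2 ^ r) f A meromorphic_on {0}"
    if A: "A \<in> SL2Z" and k: "is_level r (entry A 2 1) k" for A k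
  proof -
    obtain C where C: "((\<lambda>t. lquot r (\<lambda>i. of_int (s i)) (mobius A t) - 2 * pi * \<i> * (of_real (quot_order r (\<lambda>i. of_int (s i)) k) * t)) \<longlongrightarrow> C) at_i_inf"
      using lquot_cusp[OF A k] by blast
    have "k \<le> r" using k by (simp add: is_level_def)
    have e: "exp (lquot r (\<lambda>i. of_int (s i)) (mobius A t) - 2 * pi * \<i> * (of_real (quot_order r (\<lambda>i. of_int (s i)) k) * t))
       = f (mobius A t) * ee (- (of_int (a k) * t / of_nat (cusp_width (2 ^ r) A)))" for t
      unfolding ord[OF \<open>k \<le> r\<close>] cusp_width_eq[OF A k] f_def ee_def exp_diff exp_minus mult_minus_right
      by (simp add: field_simps)
    have "((\<lambda>t. f (mobius A t) * ee (- (of_int (a k) * t / of_nat (cusp_width (2 ^ r) A)))) \<longlongrightarrow> exp C) at_i_inf"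
      unfolding e[symmetric] by (intro tendsto_exp C)
    from zorder_cusp_expansion[OF inv A _ hol this] show ?thesis by simp
  qed
  have mod: "f \<in> modular_functions (2 ^ r)"
  proof (rule modular_functionsI)
    show "f meromorphic_on upper_half_plane"
      using hol by (intro analytic_on_imp_meromorphic_on) (simp add: analytic_on_open open_UHP)
    show "cusp_expansion (2 ^ r) f A meromorphic_on {0}" if "A \<in> SL2Z" for A
      using cusp[OF that] is_level_exists by blast
  qed (use inv f0 in auto)
  have "is_divisor_of (2 ^ r) (cuspidal_divisor r a) f"
    unfolding is_divisor_of_def
  proof (intro conjI ballI)
    show "Poly_Mapping.keys (cuspidal_divisor r a) \<subseteq> X0 (2 ^ r)" by (rule keys_cuspidal_divisor)
    fix z assume z: "z \<in> upper_half_plane"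
    have "zorder f z = 0" by (rule zorder_eqI[OF open_UHP z hol f0]) simp
    thus "int (ram_index (2 ^ r) z) * Poly_Mapping.lookup (cuspidal_divisor r a) (orbit0 (2 ^ r) (Inner z)) = zorder f z"
      by (simp add: lookup_cuspidal_divisor_Inner)
  next
    fix A assume A: "A \<in> SL2Z"
    obtain k where k: "is_level r (entry A 2 1) k" using is_level_exists by blast
    show "Poly_Mapping.lookup (cuspidal_divisor r a) (orbit0 (2 ^ r) (act A Infty)) = zorder (cusp_expansion (2 ^ r) f A) 0"
      using lookup_cuspidal_divisor_cusp[OF A k] cusp[OF A k] by simp
  qed
  thus ?thesis using mod deg cuspidal_in_Div0_iff by (auto simp: principal_divisors_def)
qed

lemma filterlim_mobius:
  assumes "A \<in> SL2Z" "Im z > 0"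
  shows "filterlim (mobius A) (at (mobius A z)) (at z)"
proof -
  have "isCont (mobius A) z"
    using holomorphic_on_imp_continuous_on[OF holomorphic_mobius[OF assms(1)]] assms(2)
    by (simp add: continuous_on_eq_continuous_at[OF open_UHP])
  moreover have "eventually (\<lambda>w. mobius A w \<noteq> mobius A z) (at z)"
  proof -
    have "eventually (\<lambda>w. w \<in> upper_half_plane \<and> w \<noteq> z) (at z)"
      using eventually_at_in_open[OF open_UHP, of z] assms(2) by (simp add: eventually_conj_iff)
    thus ?thesis
      by eventually_elim (metis UHP_iff assms mobius_minv(2))
  qed
  ultimately show ?thesis by (simp add: filterlim_at isCont_def)
qed

lemma remove_sings_zorder_0:
  assumes "f meromorphic_on {z}" "frequently (\<lambda>w. f w \<noteq> 0) (at z)" "zorder f z = 0"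
  shows "remove_sings f analytic_on {z}" "remove_sings f z \<noteq> 0" "(f \<longlongrightarrow> remove_sings f z) (at z)"
proof -
  have iso: "isolated_singularity_at f z" "not_essential f z" using assms(1) by (auto simp: meromorphic_at_iff)
  obtain d where d: "zor_poly f z z \<noteq> 0" "d > 0" "zor_poly f z holomorphic_on cball z d"
    "\<And>w. w \<in> cball z d - {z} \<Longrightarrow> f w = zor_poly f z w * (w - z) powi zorder f z"
    using zorder_exist[OF iso assms(2)] by blast
  have "continuous_on (ball z d) (zor_poly f z)"
    using holomorphic_on_imp_continuous_on[OF d(3)] by (rule continuous_on_subset) auto
  hence "isCont (zor_poly f z) z" using d(2) by (simp add: continuous_on_eq_continuous_at)
  hence "(zor_poly f z \<longlongrightarrow> zor_poly f z z) (at z)" by (simp add: isCont_def)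
  moreover have "eventually (\<lambda>w. zor_poly f z w = f w) (at z)"
    unfolding eventually_at using d(2,4) assms(3) by (intro exI[of _ d]) (auto simp: dist_commute)
  ultimately have lim: "(f \<longlongrightarrow> zor_poly f z z) (at z)" by (rule Lim_transform_eventually)
  hence eq: "remove_sings f z = zor_poly f z z" by (rule remove_sings_eqI)
  show "remove_sings f analytic_on {z}" by (rule remove_sings_analytic_at[OF iso(1) lim])
  show "remove_sings f z \<noteq> 0" using d(1) by (simp add: eq)
  show "(f \<longlongrightarrow> remove_sings f z) (at z)" using lim by (simp add: eq)
qed

text \<open>The values of f on a sparse set are arbitrary, so the comparison with an eta quotient
  uses \<open>remove_sings f\<close>. Near a cusp f agrees with the continuous function
  \<open>h\<close>, whence removing singularities changes nothing there and the leading term of the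
  expansion persists.\<close>

lemma modular_function_cusp:
  assumes f: "f \<in> modular_functions N" and N: "N > 0" and A: "A \<in> SL2Z"
    and ord: "zorder (cusp_expansion N f A) 0 = n"
  obtains L where "L \<noteq> 0" "((\<lambda>t. remove_sings f (mobius A t) * ee (- (of_int n * t / of_nat (cusp_width N A)))) \<longlongrightarrow> L) at_i_inf"
proof -
  note f' = modular_functionsD[OF f]
  define w where "w = cusp_width N A"
  have w: "w > 0" using cusp_width_props[OF A N] unfolding w_def by blast
  define F where "F = cusp_expansion N f A"
  define g where "g = zor_poly F 0"
  have iso: "isolated_singularity_at F 0" "not_essential F 0" using f'(3)[OF A] by (auto simp: meromorphic_at_iff F_def)
  have fr: "frequently (\<lambda>q. F q \<noteq> 0) (at 0)" unfolding F_def by (rule cusp_expansion_frequently_nonzero[OF f A N])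
  obtain d where d: "g 0 \<noteq> 0" "d > 0" "g holomorphic_on cball 0 d"
    "\<And>q. q \<in> cball 0 d - {0} \<Longrightarrow> F q = g q * (q - 0) powi zorder F 0"
    using zorder_exist[OF iso fr] unfolding g_def by blast
  have contg: "isCont g q" if "q \<in> ball 0 d" for q
    using holomorphic_on_imp_continuous_on[OF d(3)] that continuous_on_subset[of "cball 0 d" g "ball 0 d"]
    by (simp add: continuous_on_eq_continuous_at ball_subset_cball)
  have lim0: "((\<lambda>t. ee (t / of_nat w)) \<longlongrightarrow> 0) at_i_inf"
  proof -
    define p where "p = 2 * pi / real w"
    have p: "p > 0" using w by (simp add: p_def)
    have "((\<lambda>t. exp (- (p * Im t))) \<longlongrightarrow> 0) at_i_inf"
    proof (rule filterlim_compose[of "\<lambda>x. exp (-(p * x))" _ _ Im])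
      show "filterlim Im at_top at_i_inf" by (rule filterlim_filtercomap)
      show "((\<lambda>x. exp (-(p * x))) \<longlongrightarrow> 0) at_top" using p by real_asymp
    qed
    thus ?thesis by (subst tendsto_norm_zero_iff[symmetric]) (simp add: norm_ee p_def)
  qed
  have "eventually (\<lambda>t. ee (t / of_nat w) \<in> ball 0 d) at_i_inf"
    using order_tendstoD(2)[OF tendsto_norm_zero[OF lim0] d(2)] by eventually_elim simp
  then obtain y0 where y0: "\<And>t. Im t > y0 \<Longrightarrow> ee (t / of_nat w) \<in> ball 0 d" unfolding eventually_at_i_inf by blast
  define y where "y = max y0 0"
  define h where "h = (\<lambda>t. g (ee (t / of_nat w)) * ee (of_int n * t / of_nat w))"
  have ftoh: "f (mobius A t) = h t" if "Im t > y" for t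
  proof -
    have "f (mobius A t) = F (ee (t / of_nat w))"
      using cusp_expansion_ee[OF f'(2) A N, of t] that by (simp add: F_def w_def y_def)
    also have "\<dots> = g (ee (t / of_nat w)) * ee (t / of_nat w) powi n"
      using d(4)[of "ee (t / of_nat w)"] y0[of t] that ord by (simp add: y_def F_def)
    also have "ee (t / of_nat w) powi n = ee (of_int n * t / of_nat w)"
      unfolding ee_def by (subst exp_power_int) (simp add: mult_ac)
    finally show ?thesis by (simp add: h_def)
  qed
  have conth: "isCont h t" if "Im t > y" for t
  proof -
    have "isCont (\<lambda>t. g (ee (t / of_nat w))) t"
      by (rule isCont_o2[of _ "\<lambda>t. ee (t / of_nat w)" g])
        (use y0[of t] that contg w in \<open>auto simp: y_def ee_def intro!: continuous_intros\<close>)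
    thus ?thesis unfolding h_def ee_def using w by (intro continuous_intros) auto
  qed
  have rem: "remove_sings f (mobius A t) = h t" if t: "Im t > y" for t
  proof -
    have t0: "Im t > 0" using t by (simp add: y_def)
    define z where "z = mobius A t"
    have z: "Im z > 0" unfolding z_def by (rule Im_mobius_pos[OF A t0])
    have zt: "mobius (minv A) z = t" by (simp add: z_def mobius_minv[OF A t0])
    have "filterlim (mobius (minv A)) (at t) (at z)" using filterlim_mobius[OF SL2Z_minv(1)[OF A] z] by (simp add: zt)
    moreover have "(h \<longlongrightarrow> h t) (at t)" using conth[OF t] by (simp add: isCont_def)
    ultimately have "((\<lambda>z. h (mobius (minv A) z)) \<longlongrightarrow> h t) (at z)" by (rule filterlim_compose[rotated])
    moreover have "eventually (\<lambda>z. h (mobius (minv A) z) = f z) (at z)"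
    proof -
      have "eventually (\<lambda>t. Im t > y) (at t)"
        by (rule eventually_at_in_open'[of "{t. Im t > y}", simplified]) (use t open_halfspace_Im_gt in auto)
      hence "eventually (\<lambda>z. Im (mobius (minv A) z) > y) (at z)"
        using \<open>filterlim (mobius (minv A)) (at t) (at z)\<close> unfolding filterlim_iff by blast
      moreover have "eventually (\<lambda>z. z \<in> upper_half_plane) (at z)"
        by (rule eventually_at_in_open'[OF open_UHP]) (use z in simp)
      ultimately show ?thesis
        by eventually_elim (metis UHP_iff ftoh mobius_minv(1)[OF A])
    qed
    ultimately have "(f \<longlongrightarrow> h t) (at z)" by (rule Lim_transform_eventually)
    thus ?thesis unfolding z_def by (rule remove_sings_eqI)
  qed
  have "((\<lambda>t. g (ee (t / of_nat w))) \<longlongrightarrow> g 0) at_i_inf"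
    by (rule isCont_tendsto_compose[OF contg lim0]) (use d(2) in simp)
  moreover have "eventually (\<lambda>t. g (ee (t / of_nat w)) = remove_sings f (mobius A t) * ee (- (of_int n * t / of_nat w))) at_i_inf"
    unfolding eventually_at_i_inf using rem by (intro exI[of _ y]) (simp add: h_def ee_minus)
  ultimately have "((\<lambda>t. remove_sings f (mobius A t) * ee (- (of_int n * t / of_nat w))) \<longlongrightarrow> g 0) at_i_inf"
    by (rule Lim_transform_eventually)
  thus ?thesis using that d(1) by (simp add: w_def)
qed

lemma of_real_eq_of_intD: "complex_of_real x = of_int k \<Longrightarrow> x = of_int k"
  using of_real_eq_iff[of x "of_int k", where ?'a = complex] by simp

lemma of_nat_mult_of_real_eq: "real m * x = of_int k \<Longrightarrow> of_nat m * complex_of_real x = of_int k"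
proof -
  assume a: "real m * x = of_int k"
  have "complex_of_real (real m * x) = complex_of_real (of_int k)" by (simp only: a)
  thus ?thesis by (simp only: of_real_mult of_real_of_nat_eq of_real_of_int_eq)
qed

text \<open>A modular function with cuspidal divisor is an eta quotient with rational exponents, since a
  power of the quotient of the two is constant by the maximum principle; periods then
  restrict the exponents.\<close>

lemma principal_imp:
  assumes deg: "deg_zero r a" and prin: "cuspidal_divisor r a \<in> principal_divisors (2 ^ r)"
  obtains s :: "nat \<Rightarrow> int" where "\<And>k. k < r \<Longrightarrow> qexp r a k = of_int (s k)" "even (\<Sum>k<r. s k)"
proof -
  define N :: nat where "N = 2 ^ r"
  have N: "N > 0" by (simp add: N_def)
  obtain f where f: "f \<in> modular_functions N" and D: "is_divisor_of N (cuspidal_divisor r a) f"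
    using prin unfolding principal_divisors_def N_def by blast
  note f' = modular_functionsD[OF f]
  define \<phi> where "\<phi> = remove_sings f"
  have zo: "zorder f z = 0" if "Im z > 0" for z
    using D that unfolding is_divisor_of_def N_def by (auto simp: lookup_cuspidal_divisor_Inner)
  have \<phi>: "\<phi> analytic_on {z}" "\<phi> z \<noteq> 0" "(f \<longlongrightarrow> \<phi> z) (at z)" if "Im z > 0" for z
    using remove_sings_zorder_0[OF mero_at[OF f'(1) that] _ zo[OF that]] eventually_frequently[OF _ f'(4)[OF that]]
    by (auto simp: \<phi>_def)
  have hol\<phi>: "\<phi> holomorphic_on upper_half_plane"
    using \<phi>(1) by (intro analytic_imp_holomorphic) (subst analytic_on_analytic_at, simp)
  \<comment> \<open>Invariance survives the removal of singularities because both sides are limits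
    of the same function at z.\<close>
  have inv\<phi>: "\<phi> (mobius A z) = \<phi> z" if A: "A \<in> Gamma0 N" and z: "Im z > 0" for A z
  proof -
    note AS = Gamma0_SL2Z[OF A]
    have "((\<lambda>w. f (mobius A w)) \<longlongrightarrow> \<phi> (mobius A z)) (at z)"
      by (rule filterlim_compose[OF \<phi>(3)[OF Im_mobius_pos[OF AS z]] filterlim_mobius[OF AS z]])
    moreover have "eventually (\<lambda>w. f (mobius A w) = f w) (at z)"
    proof -
      have "eventually (\<lambda>z. z \<in> upper_half_plane) (at z)"
        by (rule eventually_at_in_open'[OF open_UHP]) (use z in simp)
      thus ?thesis by eventually_elim (use f'(2) A in \<open>auto simp: Gamma0_invariant_def\<close>)
    qed
    ultimately have "(f \<longlongrightarrow> \<phi> (mobius A z)) (at z)" by (rule Lim_transform_eventually)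
    thus ?thesis using \<phi>(3)[OF z] tendsto_unique by force
  qed
  define s where "s = qexp r a"
  define g where "g = (\<lambda>t. exp (lquot r s t))"
  have holg: "g holomorphic_on upper_half_plane"
    unfolding g_def by (intro holomorphic_on_exp' holomorphic_lquot holomorphic_intros) auto
  define h where "h = (\<lambda>t. \<phi> t / g t)"
  have holh: "h holomorphic_on upper_half_plane"
    unfolding h_def by (intro holomorphic_intros hol\<phi> holg) (simp add: g_def)
  have dyadic: "2 ^ r * s i \<in> \<int>" if "i < r" for i
  proof -
    have G: "2 ^ r * gam r a k \<in> \<int>" if "k \<le> r" for k
    proof -
      have "max k (r - k) \<le> r" using that by simp
      hence "(2::real) ^ r = 2 ^ max k (r - k) * 2 ^ (r - max k (r - k))" by (simp flip: power_add)
      hence "2 ^ r * gam r a k = of_int (8 * a k * 2 ^ (r - max k (r - k)))" by (simp add: gam_def)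
      thus ?thesis by (metis Ints_of_int)
    qed
    have G': "2 ^ r * gdiff r a j \<in> \<int>" if "j < r" for j
    proof -
      have "2 ^ r * gdiff r a j = 2 * (2 ^ r * gam r a (Suc j)) - 2 ^ r * gam r a j" by (simp add: gdiff_def algebra_simps)
      thus ?thesis using that G by (auto intro!: Ints_diff Ints_mult)
    qed
    have "2 ^ r * s i = 2 * (2 ^ r * gdiff r a i) + (\<Sum>j\<in>{Suc i..<r}. 2 ^ r * gdiff r a j)"
      by (simp add: s_def qexp_def sum_distrib_left algebra_simps)
    also have "\<dots> \<in> \<int>" by (intro Ints_add[OF Ints_mult[OF _ G'] Ints_sum[OF G']]) (use that in auto)
    finally show ?thesis .
  qed
  \<comment> \<open>\<open>2 ^ r\<close> clears the denominators of the exponents and 24 those of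
    the periods, so the m-th power of the quotient is invariant although the quotient is not yet
    known to be.\<close>
  define m :: nat where "m = 24 * 2 ^ r"
  have m: "m > 0" by (simp add: m_def)
  have gA: "g (mobius A t) = g t * ee (of_real ((\<Sum>i<r. s i * periodM (dil i A)) / 24))" if "A \<in> Gamma0 N" "Im t > 0" for A t
    using lquot_Gamma0[of A r t s] that by (simp add: g_def N_def exp_add ee_def mult_ac)
  have "Gamma0_invariant N (\<lambda>t. h t ^ m)"
    unfolding Gamma0_invariant_def
  proof (intro ballI allI impI)
    fix A t assume A: "A \<in> Gamma0 N" and t: "Im t > 0"
    have "(\<Sum>i<r. (2 ^ r * s i) * of_int (periodM (dil i A))) \<in> \<int>" by (intro Ints_sum Ints_mult[OF dyadic]) auto
    then obtain k :: int where k: "(\<Sum>i<r. (2 ^ r * s i) * of_int (periodM (dil i A))) = of_int k" by (elim Ints_cases)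
    have "real m * ((\<Sum>i<r. s i * periodM (dil i A)) / 24) = (\<Sum>i<r. (2 ^ r * s i) * of_int (periodM (dil i A)))"
    proof -
      have "real m * ((\<Sum>i<r. s i * periodM (dil i A)) / 24) = 2 ^ r * (\<Sum>i<r. s i * periodM (dil i A))"
        by (simp add: m_def)
      thus ?thesis by (simp only: sum_distrib_left mult.assoc)
    qed
    hence "of_nat m * (of_real ((\<Sum>i<r. s i * periodM (dil i A)) / 24) :: complex) = of_int k"
      unfolding k by (rule of_nat_mult_of_real_eq)
    hence "ee (of_real ((\<Sum>i<r. s i * periodM (dil i A)) / 24)) ^ m = 1"
      unfolding ee_of_nat[symmetric] by simp
    thus "h (mobius A t) ^ m = h t ^ m"
      by (simp add: h_def gA[OF A t] inv\<phi>[OF A t] power_divide power_mult_distrib)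
  qed
  moreover have "(\<lambda>t. h t ^ m) holomorphic_on upper_half_plane" by (intro holomorphic_intros holh)
  moreover have "\<exists>L. ((\<lambda>t. h (mobius A t) ^ m) \<longlongrightarrow> L) at_i_inf" if A: "A \<in> SL2Z" for A
  proof -
    obtain k where k: "is_level r (entry A 2 1) k" using is_level_exists by blast
    hence "k \<le> r" by (simp add: is_level_def)
    have "zorder (cusp_expansion N f A) 0 = Poly_Mapping.lookup (cuspidal_divisor r a) (orbit0 N (act A Infty))"
      using D A unfolding is_divisor_of_def by simp
    also have "\<dots> = a k" unfolding N_def by (rule lookup_cuspidal_divisor_cusp[OF A k])
    finally have "zorder (cusp_expansion N f A) 0 = a k" .
    then obtain L where L: "((\<lambda>t. \<phi> (mobius A t) * ee (- (of_int (a k) * t / of_nat (cusp_width N A)))) \<longlongrightarrow> L) at_i_inf"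
      using modular_function_cusp[OF f N A] unfolding \<phi>_def by metis
    obtain C where C: "((\<lambda>t. lquot r s (mobius A t) - 2 * pi * \<i> * (of_real (quot_order r s k) * t)) \<longlongrightarrow> C) at_i_inf"
      using lquot_cusp[OF A k] by blast
    have e: "\<phi> (mobius A t) * ee (- (of_int (a k) * t / of_nat (cusp_width N A))) /
        exp (lquot r s (mobius A t) - 2 * pi * \<i> * (of_real (quot_order r s k) * t)) = h (mobius A t)" for t
      unfolding quot_order_qexp[OF deg \<open>k \<le> r\<close>, folded s_def] N_def cusp_width_eq[OF A k] h_def g_def ee_def exp_diff exp_minus mult_minus_right
      by (simp add: field_simps)
    have "((\<lambda>t. h (mobius A t)) \<longlongrightarrow> L / exp C) at_i_inf"
      unfolding e[symmetric] by (intro tendsto_divide tendsto_exp L C) simp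
    from tendsto_power[OF this, of m] show ?thesis by (rule exI)
  qed
  ultimately obtain c where c: "\<And>t. Im t > 0 \<Longrightarrow> h t ^ m = c"
    using invariant_holomorphic_constant[OF N, of "\<lambda>t. h t ^ m"] by metis
  \<comment> \<open>A continuous function with constant m-th power takes finitely many values, hence
    is constant on a connected domain.\<close>
  have "h ` upper_half_plane \<subseteq> {z. z ^ m = c}" using c by auto
  hence "finite (h ` upper_half_plane)" by (rule finite_subset) (rule finite_nth_roots[OF m])
  hence "h constant_on upper_half_plane"
    by (intro continuous_finite_range_constant connected_UHP holomorphic_on_imp_continuous_on holh)
  then obtain c0 where c0: "\<And>t. Im t > 0 \<Longrightarrow> h t = c0" unfolding constant_on_def by auto
  have "\<exists>k::int. (\<Sum>i<r. s i * periodM (dil i A)) = 24 * k" if A: "A \<in> Gamma0 (2 ^ r)" for A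
  proof -
    have AN: "A \<in> Gamma0 N" using A by (simp add: N_def)
    have i: "Im \<i> > 0" by simp
    have i': "Im (mobius A \<i>) > 0" by (rule Im_mobius_pos[OF Gamma0_SL2Z[OF A] i])
    have "h (mobius A \<i>) = h \<i>" using c0 i i' by simp
    hence "g (mobius A \<i>) = g \<i>"
      using \<phi>(2)[OF i] unfolding h_def inv\<phi>[OF AN i] by (simp add: g_def divide_simps split: if_splits)
    hence "ee (of_real ((\<Sum>i<r. s i * periodM (dil i A)) / 24)) = 1"
      unfolding gA[OF AN i] by (simp add: g_def)
    then obtain k :: int where "complex_of_real ((\<Sum>i<r. s i * periodM (dil i A)) / 24) = of_int k"
      unfolding ee_eq_1_iff by (elim Ints_cases)
    hence "(\<Sum>i<r. s i * periodM (dil i A)) / 24 = of_int k" by (rule of_real_eq_of_intD)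
    thus ?thesis by (intro exI[of _ k]) simp
  qed
  note per = this
  have int: "s k \<in> \<int>" if "k < r" for k
    by (rule exponents_integral[OF per _ that]) (use dyadic in auto)
  define \<sigma> where "\<sigma> = (\<lambda>k. \<lfloor>s k\<rfloor>)"
  have \<sigma>: "s k = of_int (\<sigma> k)" if "k < r" for k
    using int[OF that] by (auto simp: \<sigma>_def elim: Ints_cases)
  have "even (\<Sum>i<r. \<sigma> i)"
  proof (rule exponents_even)
    fix A assume "A \<in> Gamma0 (2 ^ r)"
    from per[OF this] obtain k :: int where k: "(\<Sum>i<r. s i * periodM (dil i A)) = 24 * real_of_int k" by blast
    have "real_of_int (\<Sum>i<r. \<sigma> i * periodM (dil i A)) = (\<Sum>i<r. s i * periodM (dil i A))"
      by (simp add: \<sigma>)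
    hence "real_of_int (\<Sum>i<r. \<sigma> i * periodM (dil i A)) = real_of_int (24 * k)" unfolding k by simp
    hence "(\<Sum>i<r. \<sigma> i * periodM (dil i A)) = 24 * k" by (simp only: of_int_eq_iff)
    thus "24 dvd (\<Sum>i<r. \<sigma> i * periodM (dil i A))" by simp
  qed
  thus ?thesis using that \<sigma> by (simp add: s_def)
qed

lemma principal_iff:
  assumes "deg_zero r a"
  shows "cuspidal_divisor r a \<in> principal_divisors (2 ^ r) \<longleftrightarrow>
    (\<exists>s :: nat \<Rightarrow> int. (\<forall>k<r. qexp r a k = of_int (s k)) \<and> even (\<Sum>k<r. s k))"
proof
  assume "\<exists>s :: nat \<Rightarrow> int. (\<forall>k<r. qexp r a k = of_int (s k)) \<and> even (\<Sum>k<r. s k)"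
  then obtain s :: "nat \<Rightarrow> int" where s: "\<And>k. k < r \<Longrightarrow> qexp r a k = of_int (s k)" "even (\<Sum>k<r. s k)" by blast
  have "quot_order r (\<lambda>i. of_int (s i)) k = quot_order r (qexp r a) k" for k
    unfolding quot_order_def using s(1) by simp
  thus "cuspidal_divisor r a \<in> principal_divisors (2 ^ r)"
    using principal_if[OF assms s(2)] quot_order_qexp[OF assms] by simp
qed (use principal_imp[OF assms] in metis)

section \<open>Explicit conditions on the vector of a principal divisor\<close>

lemma sum_qexp: "(\<Sum>k<n. 2 * x k + (\<Sum>j\<in>{Suc k..<n}. x j)) = (\<Sum>j<n. (real j + 2) * x j)"
proof (induction n)
  case (Suc n)
  have "(\<Sum>k<Suc n. 2 * x k + (\<Sum>j\<in>{Suc k..<Suc n}. x j)) = (\<Sum>k<n. (2 * x k + (\<Sum>j\<in>{Suc k..<n}. x j)) + x n) + 2 * x n"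
    by (simp add: sum.distrib algebra_simps)
  also have "(\<Sum>k<n. (2 * x k + (\<Sum>j\<in>{Suc k..<n}. x j)) + x n) = (\<Sum>k<n. 2 * x k + (\<Sum>j\<in>{Suc k..<n}. x j)) + real n * x n"
    by (subst sum.distrib) simp
  also note Suc
  also have "(\<Sum>j<n. (real j + 2) * x j) + real n * x n + 2 * x n = (\<Sum>j<n. (real j + 2) * x j) + (real n + 2) * x n"
    by (simp add: algebra_simps)
  finally show ?case by simp
qed simp

lemma sum_weighted_gdiff:
  "(\<Sum>j<n. (real j + 2) * gdiff r a j) = (\<Sum>j<n. real j * gam r a j) + (2 * real n + 2) * gam r a n - 2 * gam r a 0"
  by (induction n) (simp_all add: gdiff_def algebra_simps)

text \<open>The sum of all \<open>qexp r a k\<close>. In terms of the exponents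
  \<open>r\<^sub>i\<close> of \<open>\<eta>(2\<^sup>i \<tau>)\<close> it is the sum of the
  \<open>i r\<^sub>i\<close>, whose parity decides whether the product of the
  \<open>(2\<^sup>i)\<close> to the powers \<open>r\<^sub>i\<close> is a square, as in Ligozat's
  criterion.\<close>

definition weight_sum :: "nat \<Rightarrow> (nat \<Rightarrow> int) \<Rightarrow> real" where
  "weight_sum r a = (\<Sum>j<r. real j * gam r a j) + (2 * real r + 2) * gam r a r - 2 * gam r a 0"

definition eta_exp :: "nat \<Rightarrow> (nat \<Rightarrow> int) \<Rightarrow> nat \<Rightarrow> real" where
  "eta_exp r a k = (if k = r then 4 * gam r a r - 2 * gam r a (r - 1)
     else 5 * gam r a k - 2 * gam r a (k - 1) - 2 * gam r a (Suc k))"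

lemma qexp_diff:
  assumes "k \<ge> 1" "k < r"
  shows "qexp r a (k - 1) = qexp r a k + eta_exp r a k"
proof -
  have "Suc (k - 1) = k" using assms by simp
  thus ?thesis using assms
    by (simp add: qexp_def eta_exp_def gdiff_def sum.atLeast_Suc_lessThan[of k r])
qed

lemma qexp_last: "r \<ge> 1 \<Longrightarrow> qexp r a (r - 1) = eta_exp r a r"
  by (simp add: qexp_def eta_exp_def gdiff_def)

text \<open>Each \<open>qexp\<close> is a sum of later \<open>eta_exp\<close>, so the two families
  are integral simultaneously. In contrast to \<open>qexp\<close>, an \<open>eta_exp\<close>
  involves only neighbouring levels.\<close>

lemma principal_iff_eta_exp:
  assumes "deg_zero r a" "r \<ge> 1"
  shows "cuspidal_divisor r a \<in> principal_divisors (2 ^ r) \<longleftrightarrow>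
    (\<forall>k. 1 \<le> k \<and> k \<le> r \<longrightarrow> eta_exp r a k \<in> \<int>) \<and> weight_sum r a / 2 \<in> \<int>"
proof -
  have ws: "(\<Sum>k<r. qexp r a k) = weight_sum r a"
    unfolding qexp_def sum_qexp sum_weighted_gdiff weight_sum_def ..
  show ?thesis
    unfolding principal_iff[OF assms(1)]
  proof
    assume "\<exists>s :: nat \<Rightarrow> int. (\<forall>k<r. qexp r a k = of_int (s k)) \<and> even (\<Sum>k<r. s k)"
    then obtain s :: "nat \<Rightarrow> int" where s: "\<And>k. k < r \<Longrightarrow> qexp r a k = of_int (s k)" "even (\<Sum>k<r. s k)" by blast
    obtain m where m: "(\<Sum>k<r. s k) = 2 * m" using s(2) by (elim evenE)
    have "weight_sum r a = of_int (\<Sum>k<r. s k)" unfolding ws[symmetric] by (simp add: s(1))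
    hence "weight_sum r a / 2 = of_int m" unfolding m by simp
    moreover have "eta_exp r a k \<in> \<int>" if "1 \<le> k" "k \<le> r" for k
    proof (cases "k = r")
      case True
      have "eta_exp r a k = of_int (s (r - 1))" using qexp_last[OF assms(2), of a] s(1)[of "r - 1"] assms(2) True by simp
      thus ?thesis by simp
    next
      case False
      hence "k < r" using that by simp
      hence "k - 1 < r" by simp
      have "eta_exp r a k = of_int (s (k - 1)) - of_int (s k)"
        using qexp_diff[OF that(1) \<open>k < r\<close>, of a] s(1)[OF \<open>k < r\<close>] s(1)[OF \<open>k - 1 < r\<close>] by simp
      thus ?thesis by simp
    qed
    ultimately show "(\<forall>k. 1 \<le> k \<and> k \<le> r \<longrightarrow> eta_exp r a k \<in> \<int>) \<and> weight_sum r a / 2 \<in> \<int>" by simp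
  next
    assume *: "(\<forall>k. 1 \<le> k \<and> k \<le> r \<longrightarrow> eta_exp r a k \<in> \<int>) \<and> weight_sum r a / 2 \<in> \<int>"
    have "k \<le> r - 1 \<Longrightarrow> qexp r a k \<in> \<int>" for k
    proof (induction k rule: inc_induct)
      case base
      show ?case using qexp_last[OF assms(2), of a] * assms(2) by simp
    next
      case (step k)
      have "qexp r a (Suc k) + eta_exp r a (Suc k) \<in> \<int>" using step * by (intro Ints_add) auto
      thus ?case using qexp_diff[of "Suc k" r a] step by simp
    qed
    hence I: "qexp r a k \<in> \<int>" if "k < r" for k using that by simp
    define s where "s = (\<lambda>k. \<lfloor>qexp r a k\<rfloor>)"
    have s: "qexp r a k = of_int (s k)" if "k < r" for k using I[OF that] by (auto simp: s_def elim: Ints_cases)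
    obtain m where "weight_sum r a / 2 = of_int m" using * by (auto elim: Ints_cases)
    hence "real_of_int (\<Sum>k<r. s k) = of_int (2 * m)" using ws by (simp add: s)
    hence "(\<Sum>k<r. s k) = 2 * m" by (simp only: of_int_eq_iff)
    thus "\<exists>s :: nat \<Rightarrow> int. (\<forall>k<r. qexp r a k = of_int (s k)) \<and> even (\<Sum>k<r. s k)"
      using s by (intro exI[of _ s]) simp
  qed
qed

text \<open>The conditions are integral combinations of the entries, with no denominators left. For
  r = 4 the weight becomes even only after one entry is eliminated by means of the degree.\<close>

lemma principal_small:
  assumes "r \<le> 4" "deg_zero r a"
  shows "cuspidal_divisor r a \<in> principal_divisors (2 ^ r)"
proof -
  have "r = 0 \<or> r = 1 \<or> r = 2 \<or> r = 3 \<or> r = 4" using assms(1) by auto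
  moreover have k1: "(\<forall>k. 1 \<le> k \<and> k \<le> Suc 0 \<longrightarrow> P k) \<longleftrightarrow> P 1" for P :: "nat \<Rightarrow> bool" by (auto simp: le_Suc_eq)
  moreover have k2: "(\<forall>k. 1 \<le> k \<and> k \<le> 2 \<longrightarrow> P k) \<longleftrightarrow> P 1 \<and> P 2" for P :: "nat \<Rightarrow> bool" by (auto simp: le_Suc_eq numeral_eq_Suc)
  moreover have k3: "(\<forall>k. 1 \<le> k \<and> k \<le> 3 \<longrightarrow> P k) \<longleftrightarrow> P 1 \<and> P 2 \<and> P 3" for P :: "nat \<Rightarrow> bool" by (auto simp: le_Suc_eq numeral_eq_Suc)
  moreover have k4: "(\<forall>k. 1 \<le> k \<and> k \<le> 4 \<longrightarrow> P k) \<longleftrightarrow> P 1 \<and> P 2 \<and> P 3 \<and> P 4" for P :: "nat \<Rightarrow> bool" by (auto simp: le_Suc_eq numeral_eq_Suc)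
  ultimately show ?thesis
  proof (elim disjE)
    assume r: "r = 0"
    show ?thesis unfolding principal_iff[OF assms(2)] by (simp add: r)
  next
    assume r: "r = 1"
    have "weight_sum r a / 2 = of_int (8 * a 1 - 4 * a 0)" "eta_exp r a 1 = of_int (16 * a 1 - 8 * a 0)"
      by (simp_all add: r weight_sum_def eta_exp_def gam_def)
    hence "weight_sum r a / 2 \<in> \<int>" "eta_exp r a 1 \<in> \<int>" by (simp_all only: Ints_of_int)
    thus ?thesis using principal_iff_eta_exp[OF assms(2)] k1 by (simp add: r)
  next
    assume r: "r = 2"
    have d: "a 2 = - a 0 - a 1" using assms(2) by (simp add: r deg_zero_def deg_cuspidal_divisor num_cusps_def numeral_eq_Suc)
    have "weight_sum r a / 2 = of_int (2 * a 1 + 6 * a 2 - 2 * a 0)" "eta_exp r a 1 = of_int (20 * a 1 - 4 * a 0 - 4 * a 2)"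
      "eta_exp r a 2 = of_int (8 * a 2 - 8 * a 1)"
      by (simp_all add: r weight_sum_def eta_exp_def gam_def numeral_eq_Suc)
    hence "weight_sum r a / 2 \<in> \<int>" "eta_exp r a 1 \<in> \<int>" "eta_exp r a 2 \<in> \<int>" by (simp_all only: Ints_of_int)
    thus ?thesis using principal_iff_eta_exp[OF assms(2)] k2 by (simp add: r)
  next
    assume r: "r = 3"
    have "weight_sum r a / 2 = of_int (a 1 + 2 * a 2 + 4 * a 3 - a 0)" "eta_exp r a 1 = of_int (10 * a 1 - 2 * a 0 - 4 * a 2)"
      "eta_exp r a 2 = of_int (10 * a 2 - 4 * a 1 - 2 * a 3)" "eta_exp r a 3 = of_int (4 * a 3 - 4 * a 2)"
      by (simp_all add: r weight_sum_def eta_exp_def gam_def numeral_eq_Suc)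
    hence "weight_sum r a / 2 \<in> \<int>" "eta_exp r a 1 \<in> \<int>" "eta_exp r a 2 \<in> \<int>" "eta_exp r a 3 \<in> \<int>" by (simp_all only: Ints_of_int)
    thus ?thesis using principal_iff_eta_exp[OF assms(2)] k3 by (simp add: r)
  next
    assume r: "r = 4"
    have "a 0 + a 1 + 2 * a 2 + a 3 + a 4 = 0" using assms(2) by (simp add: r deg_zero_def deg_cuspidal_divisor num_cusps_def numeral_eq_Suc)
    hence d: "a 0 = - a 1 - 2 * a 2 - a 3 - a 4" by simp
    have "weight_sum r a = of_int (a 1 + 4 * a 2 + 3 * a 3 + 5 * a 4 - a 0)"
      by (simp add: r weight_sum_def gam_def numeral_eq_Suc)
    also have "a 1 + 4 * a 2 + 3 * a 3 + 5 * a 4 - a 0 = 2 * (a 1 + 3 * a 2 + 2 * a 3 + 3 * a 4)" by (simp add: d)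
    finally have "weight_sum r a / 2 = of_int (a 1 + 3 * a 2 + 2 * a 3 + 3 * a 4)" by simp
    moreover have "eta_exp r a 1 = of_int (5 * a 1 - a 0 - 4 * a 2)"
      "eta_exp r a 2 = of_int (10 * a 2 - 2 * a 1 - 2 * a 3)" "eta_exp r a 3 = of_int (5 * a 3 - 4 * a 2 - a 4)"
      "eta_exp r a 4 = of_int (2 * a 4 - 2 * a 3)"
      by (simp_all add: r eta_exp_def gam_def numeral_eq_Suc)
    ultimately have "weight_sum r a / 2 \<in> \<int>" "eta_exp r a 1 \<in> \<int>" "eta_exp r a 2 \<in> \<int>" "eta_exp r a 3 \<in> \<int>" "eta_exp r a 4 \<in> \<int>" by (simp_all only: Ints_of_int)
    thus ?thesis using principal_iff_eta_exp[OF assms(2)] k4 by (simp add: r)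
  qed
qed

text \<open>A \<open>\<gamma>\<^sub>k\<close> with maximal denominator would contradict the integrality of
  \<open>5 \<gamma>\<^sub>k - 2 \<gamma>\<^sub>k\<^sub>-\<^sub>1 - 2 \<gamma>\<^sub>k\<^sub>+\<^sub>1\<close>.\<close>

lemma gam_integral:
  assumes r: "r \<ge> 5" and e: "\<And>k. 1 \<le> k \<Longrightarrow> k \<le> r \<Longrightarrow> eta_exp r a k \<in> \<int>"
    and z: "a 2 = 0" "a (r - 1) = 0"
  shows "\<And>k. 3 \<le> k \<Longrightarrow> k \<le> r - 2 \<Longrightarrow> gam r a k \<in> \<int>" "2 * gam r a 1 \<in> \<int>" "2 * gam r a r \<in> \<int>"
proof -
  have z': "gam r a 2 = 0" "gam r a (r - 1) = 0" using z by (simp_all add: gam_def)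
  have *: "(\<And>k. 3 \<le> k \<Longrightarrow> k \<le> r - 2 \<Longrightarrow> 2 ^ n * gam r a k \<in> \<int>) \<Longrightarrow> 3 \<le> k \<Longrightarrow> k \<le> r - 2 \<Longrightarrow> gam r a k \<in> \<int>" for n k
  proof (induction n)
    case (Suc n)
    have "2 ^ n * gam r a k \<in> \<int>" if k: "3 \<le> k" "k \<le> r - 2" for k
    proof -
      have 1: "2 ^ Suc n * gam r a (k - 1) \<in> \<int>"
      proof (cases "k = 3")
        case True
        thus ?thesis using z' by simp
      next
        case False
        thus ?thesis using Suc.prems(1)[of "k - 1"] k by simp
      qed
      have 2: "2 ^ Suc n * gam r a (Suc k) \<in> \<int>"
      proof (cases "k = r - 2")
        case True
        hence "Suc k = r - 1" using r by simp
        thus ?thesis using z' by simp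
      next
        case False
        thus ?thesis using Suc.prems(1)[of "Suc k"] k by simp
      qed
      have "5 * (2 ^ n * gam r a k) = 2 ^ n * eta_exp r a k + 2 ^ Suc n * gam r a (k - 1) + 2 ^ Suc n * gam r a (Suc k)"
      proof -
        have "k \<noteq> r" using k r by auto
        thus ?thesis by (simp add: eta_exp_def algebra_simps)
      qed
      \<comment> \<open>Since 5 - 2 * 2 = 1, subtracting twice the known integer
        \<open>2 ^ Suc n * gam r a k\<close> lowers the power of 2 by one.\<close>
      also have "\<dots> \<in> \<int>" using 1 2 e[of k] k by (intro Ints_add Ints_mult[of "2 ^ n"]) auto
      finally have "5 * (2 ^ n * gam r a k) - 2 * (2 ^ Suc n * gam r a k) \<in> \<int>"
        using Suc.prems(1)[OF k] by (intro Ints_diff Ints_mult[of 2]) auto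
      moreover have "5 * (2 ^ n * gam r a k) - 2 * (2 ^ Suc n * gam r a k) = 2 ^ n * gam r a k" by simp
      ultimately show ?thesis by (simp only:)
    qed
    thus ?case using Suc.IH Suc.prems(2,3) by blast
  qed simp
  have "2 ^ r * gam r a k \<in> \<int>" if "k \<le> r - 2" for k
  proof -
    have "max k (r - k) \<le> r" using that by simp
    hence "(2::real) ^ r = 2 ^ max k (r - k) * 2 ^ (r - max k (r - k))" by (simp flip: power_add)
    hence "2 ^ r * gam r a k = of_int (8 * a k * 2 ^ (r - max k (r - k)))" by (simp add: gam_def)
    thus ?thesis by (metis Ints_of_int)
  qed
  thus G: "gam r a k \<in> \<int>" if "3 \<le> k" "k \<le> r - 2" for k using *[of r k] that by blast
  have "2 * gam r a 1 = - eta_exp r a 2 - 2 * gam r a 3"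
    using r z' by (simp add: eta_exp_def numeral_eq_Suc)
  also have "\<dots> \<in> \<int>" using e[of 2] G[of 3] r by (intro Ints_diff Ints_minus Ints_mult) auto
  finally show "2 * gam r a 1 \<in> \<int>" .
  have "r - 1 - 1 = r - 2" "Suc (r - 1) = r" "r - 1 \<noteq> r" using r by auto
  hence "2 * gam r a r = - eta_exp r a (r - 1) - 2 * gam r a (r - 2)"
    using r z' by (simp add: eta_exp_def)
  also have "\<dots> \<in> \<int>" using e[of "r - 1"] G[of "r - 2"] r by (intro Ints_diff Ints_minus Ints_mult) auto
  finally show "2 * gam r a r \<in> \<int>" .
qed

text \<open>A sum of three terms rather than an updated function, so that linear combinations are
  again of this form, see \<open>vec3_combine\<close>.\<close>

definition vec3 :: "int \<Rightarrow> int \<Rightarrow> nat \<Rightarrow> int \<Rightarrow> nat \<Rightarrow> int" where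
  "vec3 x y g z k = (if k = 0 then x else 0) + (if k = 1 then y else 0) + (if k = g then z else 0)"

lemma num_cusps_0: "num_cusps r 0 = 1" by (simp add: num_cusps_def)
lemma num_cusps_1: "r \<ge> 2 \<Longrightarrow> num_cusps r 1 = 1" by (auto simp: num_cusps_def min_def)
lemma num_cusps_r: "num_cusps r r = 1" by (simp add: num_cusps_def)

lemma deg_zero_vec3:
  assumes "2 \<le> g" "g \<le> r"
  shows "deg_zero r (vec3 x y g z) \<longleftrightarrow> x + y + z * int (num_cusps r g) = 0"
proof -
  have "(\<Sum>k\<le>r. vec3 x y g z k * int (num_cusps r k)) =
    (\<Sum>k\<le>r. (if k = 0 then x * int (num_cusps r 0) else 0) + (if k = 1 then y * int (num_cusps r 1) else 0) + (if k = g then z * int (num_cusps r g) else 0))"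
    by (intro sum.cong refl) (use assms in \<open>auto simp: vec3_def distrib_right\<close>)
  also have "\<dots> = x + y + z * int (num_cusps r g)"
    unfolding sum.distrib using assms num_cusps_1[of r] by (simp add: num_cusps_0)
  finally show ?thesis by (simp add: deg_zero_def deg_cuspidal_divisor)
qed

lemma gam_vec3: "2 \<le> g \<Longrightarrow> gam r (vec3 x y g z) k = (if k = 0 then 8 * x / 2 ^ r else if k = 1 then 8 * y / 2 ^ max 1 (r - 1) else
    if k = g then 8 * z / 2 ^ max g (r - g) else 0)"
  by (simp add: gam_def vec3_def)

lemma weight_sum_vec3:
  assumes "2 \<le> g" "g \<le> r" and a_def: "a = vec3 x y g z"
  shows "weight_sum r a = gam r a 1 - 2 * gam r a 0 + (if g = r then 2 * real r + 2 else real g) * gam r a g"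
proof -
  have "(\<Sum>j<r. real j * gam r a j) = (\<Sum>j<r. (if j = 1 then gam r a 1 else 0) + (if j = g then real g * gam r a g else 0))"
    unfolding a_def by (intro sum.cong refl) (use assms in \<open>auto simp: gam_vec3\<close>)
  also have "\<dots> = gam r a 1 + (if g = r then 0 else real g * gam r a g)"
    unfolding sum.distrib using assms by simp
  finally show ?thesis using assms(1,2) unfolding weight_sum_def a_def by (auto simp: gam_vec3)
qed

text \<open>Every integrality condition is met term by term. The values of \<open>gam\<close> enter
  as parameters because after scaling by the order they become fixed fractions, independent of
  r.\<close>

lemma principal_vec3:
  assumes r: "r \<ge> 5" and g: "3 \<le> g" "g \<le> r" "g \<noteq> r - 1"
    and d: "deg_zero r (vec3 x y g z)"
    and A: "gam r (vec3 x y g z) 0 = A" and B: "gam r (vec3 x y g z) 1 = B" and G: "gam r (vec3 x y g z) g = G"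
    and ints: "5 * B - 2 * A \<in> \<int>" "2 * B \<in> \<int>" "if g = r then 2 * G \<in> \<int> else G \<in> \<int>"
    and par: "(B - 2 * A + (if g = r then 2 * real r + 2 else real g) * G) / 2 \<in> \<int>"
  shows "cuspidal_divisor r (vec3 x y g z) \<in> principal_divisors (2 ^ r)"
proof -
  define a where "a = vec3 x y g z"
  have ga: "gam r a 0 = A" "gam r a 1 = B" "gam r a (Suc 0) = B" "gam r a g = G" using A B G by (simp_all add: a_def)
  have g0: "gam r a k = 0" if "k \<noteq> 0" "k \<noteq> 1" "k \<noteq> g" for k
    using g that by (simp add: a_def gam_vec3)
  have G2: "2 * G \<in> \<int>" using ints(3) Ints_mult[of 2 G] by (auto split: if_splits)
  have G5: "5 * G \<in> \<int>" if "g < r" using ints(3) that Ints_mult[of 5 G] by auto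
  have G4: "4 * G \<in> \<int>" using Ints_mult[OF _ G2, of 2] by simp
  have "eta_exp r a k \<in> \<int>" if k: "1 \<le> k" "k \<le> r" for k
  proof -
    consider "k = 1" | "k = 2" | "k \<ge> 3" "k = g" | "k \<ge> 3" "k = Suc g" | "k \<ge> 3" "Suc k = g" | "k \<ge> 3" "k \<noteq> g" "k \<noteq> Suc g" "Suc k \<noteq> g"
      using k by linarith
    thus ?thesis
    proof cases
      case 1
      have "gam r a 2 = 0" using g by (intro g0) auto
      thus ?thesis using ints(1) 1 r by (simp add: eta_exp_def ga numeral_2_eq_2)
    next
      case 2
      have "gam r a 2 = 0" using g by (intro g0) auto
      moreover have "2 * gam r a 3 \<in> \<int>" using G2 ga(4) g0[of 3] by (cases "g = 3") auto
      ultimately show ?thesis using ints(2) 2 r Ints_minus[OF Ints_add[OF ints(2) \<open>2 * gam r a 3 \<in> \<int>\<close>]]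
        by (simp add: eta_exp_def ga numeral_eq_Suc)
    next
      case 3
      have "gam r a (k - 1) = 0" "k < r \<Longrightarrow> gam r a (Suc k) = 0" using 3 g by (auto intro!: g0)
      thus ?thesis using 3 g G4 G5 ga(4) by (auto simp: eta_exp_def)
    next
      case 4
      have "k \<noteq> r" using 4 g k by auto
      moreover have "gam r a k = 0" "gam r a (Suc k) = 0" using 4 g by (auto intro!: g0)
      ultimately show ?thesis using 4 G2 ga(4) by (simp add: eta_exp_def)
    next
      case 5
      have "k \<noteq> r" using 5 g k by auto
      moreover have "gam r a k = 0" "gam r a (k - 1) = 0" using 5 g by (auto intro!: g0)
      ultimately show ?thesis using 5 G2 ga(4) by (simp add: eta_exp_def)
    next
      case 6
      have "gam r a k = 0" "gam r a (k - 1) = 0" "gam r a (Suc k) = 0" using 6 g by (auto intro!: g0)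
      thus ?thesis using 6 by (auto simp: eta_exp_def)
    qed
  qed
  moreover have "weight_sum r a / 2 \<in> \<int>"
    using par weight_sum_vec3[OF _ g(2) a_def] g(1) unfolding ga by simp
  ultimately show ?thesis using principal_iff_eta_exp[OF d] r unfolding a_def by simp
qed

section \<open>The cuspidal class group\<close>

lemma cuspidal_divisor_scale: "cuspidal_divisor r (\<lambda>k. c * a k) = frag_cmul c (cuspidal_divisor r a)"
  unfolding cuspidal_divisor_def by (simp add: frag_cmul_sum)

lemma deg_zero_add: "deg_zero r a \<Longrightarrow> deg_zero r b \<Longrightarrow> deg_zero r (\<lambda>k. a k + b k)"
  by (simp add: deg_zero_def cuspidal_divisor_add deg_add)

lemma deg_zero_scale: "deg_zero r a \<Longrightarrow> deg_zero r (\<lambda>k. c * a k)"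
  by (simp add: deg_zero_def cuspidal_divisor_scale deg_frag_cmul)

lemma deg_zero_sum: "(\<And>i. i \<in> I \<Longrightarrow> deg_zero r (b i)) \<Longrightarrow> deg_zero r (\<lambda>k. \<Sum>i\<in>I. x i * b i k)"
proof (induction I rule: infinite_finite_induct)
  case (insert i I)
  thus ?case using deg_zero_add[OF deg_zero_scale[of r "b i" "x i"], of "\<lambda>k. \<Sum>i\<in>I. x i * b i k"] by simp
qed (simp_all add: deg_zero_def deg_cuspidal_divisor)

definition cusp_class :: "nat \<Rightarrow> (nat \<Rightarrow> int) \<Rightarrow> divisor set" where
  "cusp_class r a = divisor_class (2 ^ r) (cuspidal_divisor r a)"

lemma cusp_class_closed: "deg_zero r a \<Longrightarrow> cusp_class r a \<in> carrier (J0 (2 ^ r))"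
  using hom_in_carrier[OF divisor_class_hom] cuspidal_in_Div0_iff unfolding cusp_class_def by simp

lemma cusp_class_add:
  assumes "deg_zero r a" "deg_zero r b"
  shows "cusp_class r (\<lambda>k. a k + b k) = cusp_class r a \<otimes>\<^bsub>J0 (2 ^ r)\<^esub> cusp_class r b"
  using hom_mult[OF divisor_class_hom[of "2 ^ r"], of "cuspidal_divisor r a" "cuspidal_divisor r b"] assms
  unfolding cusp_class_def cuspidal_divisor_add by (simp add: cuspidal_in_Div0_iff)

lemma cusp_class_eq_one_iff:
  "deg_zero r a \<Longrightarrow> cusp_class r a = \<one>\<^bsub>J0 (2 ^ r)\<^esub> \<longleftrightarrow> cuspidal_divisor r a \<in> principal_divisors (2 ^ r)"
  unfolding cusp_class_def by (intro divisor_class_eq_one_iff) (auto simp: cuspidal_in_Div0_iff)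

lemma principal_deg_zero: "cuspidal_divisor r a \<in> principal_divisors (2 ^ r) \<Longrightarrow> deg_zero r a"
  unfolding cuspidal_in_Div0_iff[symmetric] by (simp add: principal_divisors_def)

lemma cusp_class_zero: "cusp_class r (\<lambda>_. 0) = \<one>\<^bsub>J0 (2 ^ r)\<^esub>"
proof -
  have "cuspidal_divisor r (\<lambda>_. 0) = 0" by (simp add: cuspidal_divisor_def)
  thus ?thesis using subgroup.one_closed[OF subgroup_principal_divisors[of "2 ^ r"]]
    by (subst cusp_class_eq_one_iff) (simp_all add: deg_zero_def)
qed

lemma cusp_class_scale:
  assumes "deg_zero r a"
  shows "cusp_class r (\<lambda>k. c * a k) = cusp_class r a [^]\<^bsub>J0 (2 ^ r)\<^esub> (c :: int)"
proof -
  interpret J: comm_group "J0 (2 ^ r)" by (rule comm_group_J0) simp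
  note cl = cusp_class_closed[OF assms]
  have step: "cusp_class r (\<lambda>k. (i + 1) * a k) = cusp_class r (\<lambda>k. i * a k) \<otimes>\<^bsub>J0 (2 ^ r)\<^esub> cusp_class r a" for i
    using cusp_class_add[OF deg_zero_scale[OF assms] assms, of i] by (simp add: distrib_right)
  have pstep: "cusp_class r a [^]\<^bsub>J0 (2 ^ r)\<^esub> (i + 1) = cusp_class r a [^]\<^bsub>J0 (2 ^ r)\<^esub> i \<otimes>\<^bsub>J0 (2 ^ r)\<^esub> cusp_class r a" for i :: int
    using J.int_pow_mult[OF cl, of i 1] cl by simp
  show ?thesis
  proof (induction c rule: int_induct[where k = 0])
    case base
    show ?case by (simp add: cusp_class_zero)
  next
    case (step1 i)
    thus ?case unfolding step pstep by simp
  next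
    case (step2 i)
    have "cusp_class r (\<lambda>k. (i - 1) * a k) \<otimes>\<^bsub>J0 (2 ^ r)\<^esub> cusp_class r a = cusp_class r a [^]\<^bsub>J0 (2 ^ r)\<^esub> (i - 1) \<otimes>\<^bsub>J0 (2 ^ r)\<^esub> cusp_class r a"
      using step[of "i - 1"] pstep[of "i - 1"] step2 by simp
    thus ?case using cl cusp_class_closed[OF deg_zero_scale[OF assms]] by (subst (asm) J.r_cancel) auto
  qed
qed

lemma cusp_class_finprod:
  assumes "finite I" "\<And>i. i \<in> I \<Longrightarrow> deg_zero r (b i)"
  shows "finprod (J0 (2 ^ r)) (\<lambda>i. cusp_class r (b i) [^]\<^bsub>J0 (2 ^ r)\<^esub> (x i :: int)) I = cusp_class r (\<lambda>k. \<Sum>i\<in>I. x i * b i k)"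
  using assms
proof (induction I rule: finite_induct)
  case empty
  interpret J: comm_group "J0 (2 ^ r)" by (rule comm_group_J0) simp
  show ?case by (simp add: cusp_class_zero)
next
  case (insert i I)
  interpret J: comm_group "J0 (2 ^ r)" by (rule comm_group_J0) simp
  have "finprod (J0 (2 ^ r)) (\<lambda>i. cusp_class r (b i) [^]\<^bsub>J0 (2 ^ r)\<^esub> x i) (insert i I)
     = cusp_class r (b i) [^]\<^bsub>J0 (2 ^ r)\<^esub> x i \<otimes>\<^bsub>J0 (2 ^ r)\<^esub> finprod (J0 (2 ^ r)) (\<lambda>i. cusp_class r (b i) [^]\<^bsub>J0 (2 ^ r)\<^esub> x i) I"
    using insert by (intro J.finprod_insert) (auto intro!: J.int_pow_closed cusp_class_closed)
  also have "\<dots> = cusp_class r (\<lambda>k. x i * b i k) \<otimes>\<^bsub>J0 (2 ^ r)\<^esub> cusp_class r (\<lambda>k. \<Sum>i\<in>I. x i * b i k)"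
    using insert by (simp add: cusp_class_scale)
  also have "\<dots> = cusp_class r (\<lambda>k. x i * b i k + (\<Sum>i\<in>I. x i * b i k))"
    using insert by (intro cusp_class_add[symmetric] deg_zero_scale deg_zero_sum) auto
  finally show ?case using insert by simp
qed

lemma cusp_class_eqI:
  assumes "deg_zero r b" "cuspidal_divisor r p \<in> principal_divisors (2 ^ r)" "\<And>k. k \<le> r \<Longrightarrow> a k = b k + p k"
  shows "cusp_class r a = cusp_class r b"
proof -
  interpret J: comm_group "J0 (2 ^ r)" by (rule comm_group_J0) simp
  note p = principal_deg_zero[OF assms(2)]
  have "cusp_class r a = cusp_class r (\<lambda>k. b k + p k)"
    unfolding cusp_class_def using cuspidal_divisor_cong[of r a "\<lambda>k. b k + p k"] assms(3) by simp
  also have "\<dots> = cusp_class r b \<otimes>\<^bsub>J0 (2 ^ r)\<^esub> cusp_class r p" by (rule cusp_class_add[OF assms(1) p])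
  also have "cusp_class r p = \<one>\<^bsub>J0 (2 ^ r)\<^esub>" using assms(2) cusp_class_eq_one_iff[OF p] by simp
  finally show ?thesis using cusp_class_closed[OF assms(1)] by simp
qed

lemma principal_add:
  assumes "cuspidal_divisor r a \<in> principal_divisors (2 ^ r)" "cuspidal_divisor r b \<in> principal_divisors (2 ^ r)"
  shows "cuspidal_divisor r (\<lambda>k. a k + b k) \<in> principal_divisors (2 ^ r)"
  using subgroup.m_closed[OF subgroup_principal_divisors[of "2 ^ r"] assms] by (simp add: cuspidal_divisor_add)

lemma principal_scale:
  assumes "cuspidal_divisor r a \<in> principal_divisors (2 ^ r)"
  shows "cuspidal_divisor r (\<lambda>k. c * a k) \<in> principal_divisors (2 ^ r)"
proof -
  interpret J: comm_group "J0 (2 ^ r)" by (rule comm_group_J0) simp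
  note d = principal_deg_zero[OF assms]
  have "cusp_class r (\<lambda>k. c * a k) = \<one>\<^bsub>J0 (2 ^ r)\<^esub>"
    unfolding cusp_class_scale[OF d] using assms cusp_class_eq_one_iff[OF d] by simp
  thus ?thesis using cusp_class_eq_one_iff[OF deg_zero_scale[OF d]] by simp
qed

text \<open>The classes of vectors of degree 0 are closed under the group operations, so the
  generated subgroup consists of nothing else.\<close>

lemma carrier_cuspidal_class_group:
  "carrier (cuspidal_class_group r) = {cusp_class r a | a. deg_zero r a}"
proof -
  interpret J: comm_group "J0 (2 ^ r)" by (rule comm_group_J0) simp
  define S where "S = {cusp_class r a | a. deg_zero r a}"
  have S: "divisor_class (2 ^ r) ` {D \<in> rational_cuspidal_divisors r. deg D = 0} = S"
    unfolding S_def rational_cuspidal_divisors_def cusp_class_def deg_zero_def by auto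
  have "subgroup S (J0 (2 ^ r))"
  proof (rule J.subgroupI)
    show "S \<subseteq> carrier (J0 (2 ^ r))" using cusp_class_closed by (auto simp: S_def)
    have "deg_zero r (\<lambda>_. 0)" by (simp add: deg_zero_def deg_cuspidal_divisor)
    thus "S \<noteq> {}" by (auto simp: S_def)
  next
    fix x assume "x \<in> S"
    then obtain a where a: "deg_zero r a" "x = cusp_class r a" by (auto simp: S_def)
    have "inv\<^bsub>J0 (2 ^ r)\<^esub> x = x [^]\<^bsub>J0 (2 ^ r)\<^esub> (- 1 :: int)"
      using cusp_class_closed[OF a(1)] a(2) by (simp add: J.int_pow_neg)
    also have "\<dots> = cusp_class r (\<lambda>k. (- 1) * a k)" unfolding a(2) by (rule cusp_class_scale[OF a(1), symmetric])
    finally show "inv\<^bsub>J0 (2 ^ r)\<^esub> x \<in> S" using deg_zero_scale[OF a(1)] unfolding S_def by blast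
  next
    fix x y assume "x \<in> S" "y \<in> S"
    then obtain a b where "deg_zero r a" "x = cusp_class r a" "deg_zero r b" "y = cusp_class r b" by (auto simp: S_def)
    thus "x \<otimes>\<^bsub>J0 (2 ^ r)\<^esub> y \<in> S" using cusp_class_add[of r a b] deg_zero_add[of r a b] unfolding S_def by auto
  qed
  thus ?thesis unfolding cuspidal_class_group_def S S_def[symmetric]
    by (rule subgroup.carrier_subgroup_generated_subgroup)
qed

section \<open>Eta quotients with two prescribed exponents\<close>

lemma order_coeff_balance:
  assumes "i < r"
  shows "(\<Sum>k<r. order_coeff k i / 2 ^ k) + order_coeff 0 i + 2 * order_coeff r i / 2 ^ r = 0"
proof -
  have *: "(\<Sum>k<r. order_coeff k i / 2 ^ k) + 2 * order_coeff r i / 2 ^ r = 1 / 2 ^ Suc i" if "Suc i \<le> r"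
    using that
  proof (induction r rule: dec_induct)
    case base
    have *: "(\<Sum>k<n. (2::real) ^ k) = 2 ^ n - 1" for n by (induction n) auto
    have "(\<Sum>k<Suc i. order_coeff k i / 2 ^ k) = (\<Sum>k<Suc i. - (2 ^ k / 2 ^ Suc i))"
    proof (intro sum.cong refl)
      fix k assume "k \<in> {..<Suc i}"
      moreover have "(4::real) ^ k = 2 ^ k * 2 ^ k" by (simp flip: power_mult_distrib)
      ultimately show "order_coeff k i / 2 ^ k = - (2 ^ k / 2 ^ Suc i)" by (simp add: order_coeff_def)
    qed
    also have "\<dots> = - ((2 ^ Suc i - 1) / 2 ^ Suc i)"
      by (simp only: sum_negf sum_divide_distrib[symmetric] *)
    also have "\<dots> = 1 / 2 ^ Suc i - 2 * order_coeff (Suc i) i / 2 ^ Suc i"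
      by (simp add: order_coeff_def diff_divide_distrib)
    finally show ?case by linarith
  next
    case (step n)
    thus ?case by (simp add: order_coeff_def)
  qed
  show ?thesis using * assms by (simp add: order_coeff_def)
qed

text \<open>Each factor \<open>\<eta>(2\<^sup>i\<^sup>+\<^sup>1 \<tau>) / \<eta>(2\<^sup>i
  \<tau>)\<close> has balanced orders by \<open>order_coeff_balance\<close>. Degree 0 is thus
  computed from the orders, without an appeal to a general theorem on principal divisors.\<close>

lemma deg_zero_of_orders:
  assumes "r \<ge> 1" "\<And>k. k \<le> r \<Longrightarrow> quot_order r s k = a k / 2 ^ (r - 2 * k)"
  shows "deg_zero r a"
proof -
  have g: "gam r a k = (\<Sum>i<r. s i / 3 * (order_coeff k i / 2 ^ k))" if "k \<le> r" for k
  proof -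
    have "max k (r - k) = k + (r - 2 * k)" by auto
    hence "gam r a k = 8 * quot_order r s k / 2 ^ k" using assms(2)[OF that] by (simp add: gam_def power_add)
    also have "\<dots> = (1 / 3 / 2 ^ k) * (\<Sum>i<r. s i * order_coeff k i)" by (simp add: quot_order_def)
    finally show ?thesis unfolding sum_distrib_left by (simp add: mult_ac)
  qed
  have "(\<Sum>j<r. gam r a j) + gam r a 0 + 2 * gam r a r
     = (\<Sum>j<r. \<Sum>i<r. s i / 3 * (order_coeff j i / 2 ^ j)) + (\<Sum>i<r. s i / 3 * order_coeff 0 i) + 2 * (\<Sum>i<r. s i / 3 * (order_coeff r i / 2 ^ r))"
    using g by simp
  also have "(\<Sum>j<r. \<Sum>i<r. s i / 3 * (order_coeff j i / 2 ^ j)) = (\<Sum>i<r. s i / 3 * (\<Sum>j<r. order_coeff j i / 2 ^ j))"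
    by (subst sum.swap) (simp only: sum_distrib_left)
  also have "(\<Sum>i<r. s i / 3 * (\<Sum>j<r. order_coeff j i / 2 ^ j)) + (\<Sum>i<r. s i / 3 * order_coeff 0 i) + 2 * (\<Sum>i<r. s i / 3 * (order_coeff r i / 2 ^ r))
     = (\<Sum>i<r. s i / 3 * ((\<Sum>k<r. order_coeff k i / 2 ^ k) + order_coeff 0 i + 2 * order_coeff r i / 2 ^ r))"
    by (simp add: sum_distrib_left sum.distrib distrib_left mult_ac)
  also have "\<dots> = 0" by (intro sum.neutral ballI) (simp add: order_coeff_balance)
  finally show ?thesis using deg_zero_iff[OF assms(1)] by simp
qed

lemma principal_two_exponents:
  fixes p q :: int
  assumes "i < j" "j < r" "even p" "even q"
    and ord: "\<And>k. k \<le> r \<Longrightarrow> (p * order_coeff k i + q * order_coeff k j) / 24 = a k / 2 ^ (r - 2 * k)"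
  shows "cuspidal_divisor r a \<in> principal_divisors (2 ^ r)"
proof -
  define s where "s = (\<lambda>l. (if l = i then p else 0) + (if l = j then q else 0))"
  have "(\<Sum>l<r. real_of_int (s l) * order_coeff k l) = (\<Sum>l<r. (if l = i then p * order_coeff k i else 0) + (if l = j then q * order_coeff k j else 0))" for k
    by (intro sum.cong refl) (use assms(1) in \<open>auto simp: s_def\<close>)
  hence q: "quot_order r (\<lambda>l. of_int (s l)) k = (p * order_coeff k i + q * order_coeff k j) / 24" for k
    using assms(1,2) by (simp add: quot_order_def sum.distrib)
  have o: "quot_order r (\<lambda>l. of_int (s l)) k = a k / 2 ^ (r - 2 * k)" if "k \<le> r" for k unfolding q by (rule ord[OF that])
  have "(\<Sum>l<r. s l) = p + q" using assms(1,2) by (simp add: s_def sum.distrib)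
  hence "even (\<Sum>l<r. s l)" using assms(3,4) by simp
  moreover have "deg_zero r a" by (rule deg_zero_of_orders[OF _ o]) (use assms(2) in auto)
  ultimately show ?thesis using o by (intro principal_if[of r a s])
qed

text \<open>Divisors of two eta quotients, used to clear the entries at the levels \<open>2\<^sup>2\<close> and
  \<open>2\<^sup>r\<^sup>-\<^sup>1\<close>, at which no \<open>E_vec\<close> is available.\<close>

definition triv1 :: "nat \<Rightarrow> nat \<Rightarrow> int" where
  "triv1 r k = (if k \<le> 2 then 0 else if k = 3 then - (2 ^ (r - 6)) else 2 ^ (r - 2 * k))"

definition triv2 :: "nat \<Rightarrow> nat \<Rightarrow> int" where
  "triv2 r k = (if k \<le> r - 4 then - (2 ^ (2 * k - r)) else if k = r - 3 then 2 ^ (r - 6) else 0)"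

lemma four_power: "(4::real) ^ k = 2 ^ k * 2 ^ k"
  by (simp flip: power_mult_distrib)

text \<open>The divisor of \<open>\<eta>(4\<tau>)\<^sup>2 \<eta>(16\<tau>)\<^sup>4 /
  \<eta>(8\<tau>)\<^sup>6\<close>. The exponents -2 and 4 make the orders at levels 1, 2 and 4
  cancel, and give -1 and 1 at the next levels before multiplication by the width.\<close>

lemma principal_triv1:
  assumes "r \<ge> 5"
  shows "cuspidal_divisor r (triv1 r) \<in> principal_divisors (2 ^ r)"
proof (rule principal_two_exponents[of 2 3 r "-2" 4])
  fix k assume k: "k \<le> r"
  consider "k \<le> 2" | "k = 3" | "k \<ge> 4" by linarith
  thus "(of_int (-2) * order_coeff k 2 + of_int 4 * order_coeff k 3) / 24 = of_int (triv1 r k) / 2 ^ (r - 2 * k)"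
    by cases (auto simp: order_coeff_def triv1_def numeral_eq_Suc)
qed (use assms in auto)

text \<open>Up to sign the mirror image of \<open>triv1\<close> under k to r - k, that is, under the
  Fricke involution.\<close>

lemma principal_triv2:
  assumes "r \<ge> 5"
  shows "cuspidal_divisor r (triv2 r) \<in> principal_divisors (2 ^ r)"
proof (rule principal_two_exponents[of "r - 4" "r - 3" r 4 "-2"])
  fix k assume k: "k \<le> r"
  define n where "n = r - 4"
  have r: "r = n + 4" "r - 3 = Suc n" using assms by (auto simp: n_def)
  consider "k \<le> n" | "k = Suc n" | "k \<ge> Suc (Suc n)" by linarith
  thus "(of_int 4 * order_coeff k (r - 4) + of_int (-2) * order_coeff k (r - 3)) / 24 = of_int (triv2 r k) / 2 ^ (r - 2 * k)"
  proof cases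
    case 1
    have p: "(2::real) ^ r * 2 ^ (2 * k - r) = 2 ^ k * 2 ^ k * 2 ^ (r - 2 * k)" by (simp flip: power_add)
    have "(of_int 4 * order_coeff k (r - 4) + of_int (-2) * order_coeff k (r - 3)) / 24 = - (2 ^ k * 2 ^ k / 2 ^ r)"
      using 1 by (simp add: order_coeff_def r four_power power_add)
    also have "\<dots> = - (2 ^ (2 * k - r) / 2 ^ (r - 2 * k))" using p by (simp add: divide_simps mult_ac)
    also have "\<dots> = of_int (triv2 r k) / 2 ^ (r - 2 * k)" using 1 by (simp add: triv2_def n_def)
    finally show ?thesis .
  next
    case 2
    have p: "(2::real) ^ n * 2 ^ (r - 2 * k) = 4 * 2 ^ (r - 6)"
    proof (cases "n = 1")
      case False
      hence "n = (r - 6) + 2" "r - 2 * k = 0" using assms by (auto simp: r 2)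
      hence "(2::real) ^ n = 4 * 2 ^ (r - 6)" "(2::real) ^ (r - 2 * k) = 1" by (simp_all only: power_add) simp_all
      thus ?thesis by simp
    qed (simp add: r 2)
    have "(of_int 4 * order_coeff k (r - 4) + of_int (-2) * order_coeff k (r - 3)) / 24 = 2 ^ n / 4"
      by (simp add: order_coeff_def r 2 four_power)
    also have "\<dots> = 2 ^ (r - 6) / 2 ^ (r - 2 * k)" using p by (simp add: divide_simps mult_ac)
    also have "\<dots> = of_int (triv2 r k) / 2 ^ (r - 2 * k)" using 2 assms by (simp add: triv2_def r)
    finally show ?thesis .
  next
    case 3
    thus ?thesis using assms by (simp add: order_coeff_def triv2_def r)
  qed
qed (use assms in auto)

text \<open>On the levels \<open>2\<^sup>2\<close> and \<open>2\<^sup>r\<^sup>-\<^sup>1\<close> the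
  two vectors form a diagonal matrix of units. The entry of \<open>triv2\<close> at level
  \<open>2\<^sup>2\<close> is 1 for r = 5 and -1 otherwise, which the square covers
  uniformly.\<close>

lemma triv_values:
  assumes "r \<ge> 5"
  shows "triv1 r 2 = 0" "triv1 r (r - 1) = 1" "triv2 r (r - 1) = 0" "triv2 r 2 * triv2 r 2 = 1"
  using assms by (auto simp: triv1_def triv2_def)

text \<open>The isomorphism multiplies the components. Independence is phrased in terms of powers
  being trivial rather than exponents being 0, since the generators are torsion elements.\<close>

lemma (in comm_group) direct_sum_of_cyclic:
  assumes fin: "finite I" and b: "\<And>i. i \<in> I \<Longrightarrow> b i \<in> carrier G"
    and gen: "carrier (subgroup_generated G S) = {finprod G (\<lambda>i. b i [^] x i) I | x :: 'i \<Rightarrow> int. True}"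
    and indep: "\<And>x :: 'i \<Rightarrow> int. finprod G (\<lambda>i. b i [^] x i) I = \<one> \<Longrightarrow> (\<forall>i\<in>I. b i [^] x i = \<one>)"
  shows "subgroup_generated G S \<cong> sum_group I (\<lambda>i. subgroup_generated G {b i})"
proof -
  define A where "A = (\<lambda>i. subgroup_generated G {b i})"
  define H where "H = sum_group I A"
  define h where "h = (\<lambda>x. gfinprod G (\<lambda>i. x i) I)"
  have A: "group (A i)" for i unfolding A_def by (rule group_subgroup_generated)
  have carA: "carrier (A i) = range (\<lambda>n::int. b i [^] n)" if "i \<in> I" for i
    unfolding A_def using b[OF that] by (rule carrier_subgroup_generated_by_singleton)
  have "(\<lambda>x. x) \<in> hom (A i) G" if "i \<in> I" for i
    unfolding A_def by (rule homI) (use carrier_subgroup_generated_subset in auto)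
  from hom_group_sum[of I "\<lambda>_ x. x" A, OF this A]
  have h_hom: "h \<in> hom H G" by (simp add: h_def H_def)
  have H: "group H" unfolding H_def by (rule sum_group) (rule A)
  have carH: "carrier H = (\<Pi>\<^sub>E i\<in>I. range (\<lambda>n::int. b i [^] n))"
    unfolding H_def carrier_sum_group[of I A, OF A] using fin carA by (auto intro!: PiE_cong)
  have rep: "\<exists>n :: 'i \<Rightarrow> int. \<forall>i\<in>I. x i = b i [^] n i" if "x \<in> carrier H" for x
  proof -
    have "\<forall>i\<in>I. \<exists>n::int. x i = b i [^] n" using that unfolding carH by (auto simp: PiE_iff)
    thus ?thesis by (rule bchoice)
  qed
  have h_eq: "h x = finprod G (\<lambda>i. b i [^] n i) I" if "\<forall>i\<in>I. x i = b i [^] (n i :: int)" for x n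
  proof -
    have "x \<in> I \<rightarrow> carrier G" using that b by auto
    hence "h x = finprod G x I" unfolding h_def using fin by simp
    also have "\<dots> = finprod G (\<lambda>i. b i [^] n i) I" using that b by (intro finprod_cong') auto
    finally show ?thesis .
  qed
  have img: "h ` carrier H = carrier (subgroup_generated G S)"
  proof (rule equalityI; rule subsetI)
    fix y assume "y \<in> h ` carrier H"
    thus "y \<in> carrier (subgroup_generated G S)" unfolding gen using rep h_eq by blast
  next
    fix y assume "y \<in> carrier (subgroup_generated G S)"
    then obtain n :: "'i \<Rightarrow> int" where y: "y = finprod G (\<lambda>i. b i [^] n i) I" unfolding gen by blast
    define x where "x = restrict (\<lambda>i. b i [^] n i) I"
    have "x \<in> carrier H" unfolding carH x_def by auto
    moreover have "h x = y" unfolding y by (rule h_eq) (simp add: x_def)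
    ultimately show "y \<in> h ` carrier H" by blast
  qed
  have "inj_on h (carrier H)"
    unfolding inj_on_one_iff'[OF h_hom H is_group]
  proof (intro allI impI)
    fix x assume x: "x \<in> carrier H" "h x = \<one>"
    then obtain n :: "'i \<Rightarrow> int" where n: "\<forall>i\<in>I. x i = b i [^] n i" using rep by blast
    hence "\<forall>i\<in>I. x i = \<one>" using indep[of n] x(2) h_eq[OF n] by simp
    thus "x = \<one>\<^bsub>H\<^esub>" using x(1) unfolding carH by (auto simp: H_def A_def PiE_iff extensional_def)
  qed
  moreover have "h \<in> hom H (subgroup_generated G S)"
    using h_hom img unfolding hom_def by auto
  ultimately have "h \<in> iso H (subgroup_generated G S)" using img by (intro isoI) (auto simp: bij_betw_def)
  hence "inv_into (carrier H) h \<in> iso (subgroup_generated G S) H" by (rule group.iso_set_sym[OF H])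
  thus ?thesis unfolding H_def A_def by (rule is_isoI)
qed

section \<open>The generators: pivots, degrees and orders\<close>

text \<open>The level exponent g of the \<open>E_vec\<close> from which the generator with index f
  is made.\<close>

definition piv :: "nat \<Rightarrow> nat \<Rightarrow> nat" where
  "piv r f = (if even (r - f) then (r + f - 2) div 2 else (r - f + 3) div 2)"

definition ord_exp :: "nat \<Rightarrow> nat \<Rightarrow> nat" where
  "ord_exp r f = (if f = r + 1 - gcd 2 r then r - 3 - (r + 1 - f) div 2 else r - 4 - (r + 1 - f) div 2)"

text \<open>The entry -1 at the pivot g contributes -8 divided by \<open>2 ^ max g (r - g)\<close>
  to \<open>gam\<close>, so the exponent of the order has to be
  \<open>max g (r - g) - 3\<close>.\<close>

lemma piv_props:
  assumes "3 \<le> f" "f \<le> r - 2"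
  shows "3 \<le> piv r f" "piv r f \<le> r - 2" "ord_exp r f = max (piv r f) (r - piv r f) - 3"
proof -
  have f: "f \<noteq> r + 1 - gcd 2 r" using assms by (cases "even r") (auto simp: gcd_nat.absorb1 gcd.commute coprime_imp_gcd_eq_1)
  have "3 \<le> piv r f \<and> piv r f \<le> r - 2 \<and> max (piv r f) (r - piv r f) - 3 = r - 4 - (r + 1 - f) div 2"
  proof (cases "even (r - f)")
    case True
    then obtain m where m: "r - f = 2 * m" by (elim evenE)
    hence r: "r = f + 2 * m" "m \<ge> 1" using assms by auto
    have "(r + f - 2) div 2 = f + m - 1" using r by simp
    hence "piv r f = f + m - 1" using True by (simp add: piv_def)
    thus ?thesis using assms r by (auto simp: max_def)
  next
    case False
    then obtain m where m: "r - f = 2 * m + 1" by (elim oddE)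
    hence "r = f + 2 * m + 1" "m \<ge> 1" using assms by auto
    thus ?thesis using assms by (auto simp: piv_def max_def)
  qed
  thus "3 \<le> piv r f" "piv r f \<le> r - 2" "ord_exp r f = max (piv r f) (r - piv r f) - 3"
    using f by (auto simp: ord_exp_def)
qed

text \<open>For r - f even, twice the pivot is r + f - 2 > r; for r - f odd it is r - f + 3 \<le> r.
  The two kinds of pivots thus lie in different halves of the range.\<close>

lemma piv_inj: "inj_on (piv r) {3..r-2}"
proof (rule inj_onI)
  fix f g assume fg: "f \<in> {3..r-2}" "g \<in> {3..r-2}" "piv r f = piv r g"
  have 1: "2 * piv r f = r + f - 2 \<and> even (r - f) \<or> 2 * piv r f = r - f + 3 \<and> odd (r - f)" if "f \<in> {3..r-2}" for f
    using that by (cases "even (r - f)") (auto simp: piv_def elim!: evenE oddE)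
  show "f = g" using 1[OF fg(1)] 1[OF fg(2)] fg by auto
qed

lemma piv_bij: "piv r ` {3..r-2} = {3..r-2}"
  by (rule endo_inj_surj) (use piv_inj piv_props in auto)

lemma E_vec_vec3:
  "2 \<le> g \<Longrightarrow> E_vec r g = vec3 (if odd g then 0 else 3 * 2 ^ (min g (r - g) - 2))
     (if odd g then 2 ^ (min g (r - g) - 1) else - (2 ^ (min g (r - g) - 2))) g (- 1)"
  by (rule ext) (auto simp: E_vec_def vec3_def Let_def)

lemma B2_vec_low: "f \<le> r - 2 \<Longrightarrow> 3 \<le> f \<Longrightarrow> B2_vec r f = E_vec r (piv r f)"
  by (auto simp: B2_vec_def piv_def)

lemma B2_vec_last: "r \<ge> 2 \<Longrightarrow> B2_vec r r = vec3 1 0 r (- 1)"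
  by (rule ext) (auto simp: B2_vec_def vec3_def)

lemma B2_vec_penultimate:
  assumes "r \<ge> 3"
  shows "B2_vec r (r - Suc 0) = (if even r then vec3 1 (- 1) r 0 else vec3 (- 1) (- 1) r 2)"
proof -
  have "r - 1 \<noteq> r" using assms by simp
  thus ?thesis using assms by (intro ext) (auto simp: B2_vec_def vec3_def)
qed

lemma vec3_scale: "(\<lambda>k. n * vec3 x y g z k) = vec3 (n * x) (n * y) g (n * z)"
  by (rule ext) (simp add: vec3_def algebra_simps)

lemma B2_vec_mid:
  assumes "3 \<le> f" "f \<le> r" "2 \<le> k" "k \<le> r - 1"
  shows "B2_vec r f k = (if f \<le> r - 2 \<and> k = piv r f then - 1 else 0)"
proof -
  consider "f \<le> r - 2" | "f = r - 1" | "f = r" "\<not> f \<le> r - 2" using assms by linarith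
  thus ?thesis
  proof cases
    case 1
    thus ?thesis using assms piv_props(1)[of f r] by (auto simp: B2_vec_low E_vec_vec3 vec3_def)
  next
    case 2
    have "\<not> f \<le> r - 2" "k \<noteq> r" "r \<ge> 3" using 2 assms by auto
    thus ?thesis using 2 assms by (simp add: B2_vec_penultimate vec3_def)
  next
    case 3
    thus ?thesis using assms by (auto simp: B2_vec_last vec3_def)
  qed
qed

lemma B2_combination_piv:
  assumes "3 \<le> f" "f \<le> r - 2"
  shows "(\<Sum>g\<in>{3..r}. x g * B2_vec r g (piv r f)) = - x f"
proof -
  have "(\<Sum>g\<in>{3..r}. x g * B2_vec r g (piv r f)) = (\<Sum>g\<in>{3..r}. if g = f then - x f else 0)"
  proof (intro sum.cong refl)
    fix g assume "g \<in> {3..r}"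
    moreover have "piv r f = piv r g \<longleftrightarrow> g = f" if "g \<le> r - 2" "3 \<le> g"
      using inj_on_eq_iff[OF piv_inj[of r], of f g] assms that by auto
    ultimately show "x g * B2_vec r g (piv r f) = (if g = f then - x f else 0)"
      using assms piv_props(1,2)[OF assms] by (auto simp: B2_vec_mid)
  qed
  thus ?thesis using assms by simp
qed

lemma B2_combination_zero:
  assumes "k \<in> {2, r - 1}" "r \<ge> 5"
  shows "(\<Sum>g\<in>{3..r}. x g * B2_vec r g k) = 0"
proof (intro sum.neutral ballI)
  fix g assume "g \<in> {3..r}"
  moreover from this have "k \<noteq> piv r g" if "g \<le> r - 2" using assms piv_props(1,2)[of g r] that by auto
  ultimately show "x g * B2_vec r g k = 0" using assms by (auto simp: B2_vec_mid)
qed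

lemma deg_zero_B2:
  assumes "r \<ge> 5" "f \<in> {3..r}"
  shows "deg_zero r (B2_vec r f)"
proof -
  consider "f \<le> r - 2" | "f = r - 1" | "f = r" using assms by fastforce
  thus ?thesis
  proof cases
    case 1
    define g where "g = piv r f"
    have g: "3 \<le> g" "g \<le> r - 2" using piv_props[of f r] 1 assms by (auto simp: g_def)
    define m where "m = min g (r - g) - 2"
    have m: "min g (r - g) = m + 2" using g assms by (auto simp: m_def)
    have "B2_vec r f = E_vec r g" using 1 assms by (simp add: B2_vec_low g_def)
    thus ?thesis using g by (simp add: E_vec_vec3 deg_zero_vec3 num_cusps_def m)
  next
    case 2
    thus ?thesis using assms by (auto simp: B2_vec_penultimate deg_zero_vec3 num_cusps_r)
  next
    case 3
    thus ?thesis using assms by (auto simp: B2_vec_last deg_zero_vec3 num_cusps_r)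
  qed
qed

lemma ord_exp_last: "r \<ge> 5 \<Longrightarrow> ord_exp r r = (if even r then r - 4 else r - 3)"
  "r \<ge> 5 \<Longrightarrow> ord_exp r (r - Suc 0) = (if even r then r - 4 else r - 5)"
  by (cases "even r"; force simp: ord_exp_def gcd_nat.absorb1 coprime_imp_gcd_eq_1)+

text \<open>After scaling, the only nonzero values of \<open>gam\<close> are the fractions A, B and
  G below, at the levels 1, 2 and \<open>2\<^sup>g\<close> (with g = r for the last two
  generators).\<close>

lemma principal_B2:
  assumes r: "r \<ge> 5" and f: "f \<in> {3..r}"
  shows "cuspidal_divisor r (\<lambda>k. 2 ^ ord_exp r f * B2_vec r f k) \<in> principal_divisors (2 ^ r)"
proof -
  have d: "deg_zero r (\<lambda>k. 2 ^ ord_exp r f * B2_vec r f k)" by (intro deg_zero_scale deg_zero_B2 assms)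
  obtain l where l: "r = l + 5" using le_Suc_ex[OF r] by (metis add.commute)
  have p3: "(2::real) ^ r = 8 * 2 ^ (r - 3)"
    and p4: "(2::real) ^ r = 16 * 2 ^ (r - 4)" "(2::real) ^ (r - Suc 0) = 8 * 2 ^ (r - 4)"
    and p5: "(2::real) ^ r = 32 * 2 ^ (r - 5)" "(2::real) ^ (r - Suc 0) = 16 * 2 ^ (r - 5)"
    unfolding l by (simp_all add: power_add)
  consider "f \<le> r - 2" | "f = r - 1" | "f = r" using assms by fastforce
  thus ?thesis
  proof cases
    case 1
    define g where "g = piv r f"
    have g: "3 \<le> g" "g \<le> r - 2" "ord_exp r f = max g (r - g) - 3" using piv_props[of f r] 1 assms by (auto simp: g_def)
    define m where "m = min g (r - g) - 2"
    define n where "n = max g (r - g) - 3"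
    have m: "min g (r - g) = m + 2" "max g (r - g) = n + 3" using g r by (auto simp: m_def n_def)
    have rmn: "r = m + n + 5" using m g by (auto simp: min_def max_def split: if_splits)
    have "B2_vec r f = E_vec r g" using 1 assms by (simp add: B2_vec_low g_def)
    hence B: "(\<lambda>k. 2 ^ ord_exp r f * B2_vec r f k) = vec3 (2 ^ n * (if odd g then 0 else 3 * 2 ^ m)) (2 ^ n * (if odd g then 2 ^ (m + 1) else - (2 ^ m))) g (2 ^ n * - 1)"
      using g by (simp only: E_vec_vec3 vec3_scale) (simp add: m)
    have "r - 1 = m + n + 4" using rmn by simp
    hence p: "(2::real) ^ r = 2 ^ m * 2 ^ n * 32" "(2::real) ^ (r - Suc 0) = 2 ^ m * 2 ^ n * 16"
      using rmn by (simp_all add: power_add)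
    have M: "max (Suc 0) (r - Suc 0) = r - Suc 0" "(2::real) ^ max g (r - g) = 8 * 2 ^ n" using r by (simp, simp add: m power_add)
    show ?thesis
    proof (cases "odd g")
      \<comment> \<open>The weight is 1 - g here, which is even for odd g.\<close>
      case True
      then obtain j where "g = 2 * j + 1" by (elim oddE)
      hence "(1 - real g) / 2 = of_int (- int j)" by simp
      hence par: "(1 - real g) / 2 \<in> \<int>" by (metis Ints_of_int)
      show ?thesis unfolding B
        by (rule principal_vec3[where A = 0 and B = 1 and G = "-1"])
          (use d[unfolded B] g r True par in \<open>auto simp: gam_vec3 M p power_add\<close>)
    next
      \<comment> \<open>For even g the values 3/4 and -1/2 at the levels 1 and 2 give the weight -2
        - g, again even, while 5B - 2A = -4 remains an integer. This accounts for the different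
        entries of \<open>E_vec\<close> in the two cases.\<close>
      case False
      then obtain j where "g = 2 * j" by (auto elim: evenE)
      hence "(- 2 - real g) / 2 = of_int (- 1 - int j)" by simp
      hence par: "(- 2 - real g) / 2 \<in> \<int>" by (metis Ints_of_int)
      show ?thesis unfolding B
        by (rule principal_vec3[where A = "3/4" and B = "-1/2" and G = "-1"])
          (use d[unfolded B] g r False par in \<open>auto simp: gam_vec3 M p power_add\<close>)
    qed
  next
    case 2
    show ?thesis
    proof (cases "even r")
      case True
      have B: "(\<lambda>k. 2 ^ ord_exp r f * B2_vec r f k) = vec3 (2 ^ (r - 4)) (- (2 ^ (r - 4))) r 0"
        using r True 2 by (simp add: B2_vec_penultimate vec3_scale ord_exp_last)
      show ?thesis unfolding B
        by (rule principal_vec3[where A = "1/2" and B = "-1" and G = "0"])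
          (use d[unfolded B] r in \<open>auto simp: gam_vec3 p4\<close>)
    next
      case False
      have B: "(\<lambda>k. 2 ^ ord_exp r f * B2_vec r f k) = vec3 (- (2 ^ (r - 5))) (- (2 ^ (r - 5))) r (2 ^ (r - 5) * 2)"
        using r False 2 by (simp add: B2_vec_penultimate vec3_scale ord_exp_last)
      obtain j where "r = 2 * j + 1" using False by (elim oddE)
      hence "(2 * real r + 2) / 4 = of_int (int j + 1)" by simp
      hence par: "(2 * real r + 2) / 4 \<in> \<int>" by (metis Ints_of_int)
      show ?thesis unfolding B
        by (rule principal_vec3[where A = "-1/4" and B = "-1/2" and G = "1/2"])
          (use d[unfolded B] r par in \<open>auto simp: gam_vec3 p5\<close>)
    qed
  next
    case 3
    show ?thesis
    proof (cases "even r")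
      case True
      have B: "(\<lambda>k. 2 ^ ord_exp r f * B2_vec r f k) = vec3 (2 ^ (r - 4)) 0 r (- (2 ^ (r - 4)))"
        using r True 3 by (simp add: B2_vec_last vec3_scale ord_exp_last)
      obtain j where "r = 2 * j" using True by (elim evenE)
      hence "(- 1 - (2 * real r + 2) / 2) / 2 = of_int (- 1 - int j)" by (simp add: field_simps)
      hence par: "(- 1 - (2 * real r + 2) / 2) / 2 \<in> \<int>" by (metis Ints_of_int)
      show ?thesis unfolding B
        by (rule principal_vec3[where A = "1/2" and B = "0" and G = "-1/2"])
          (use d[unfolded B] r par in \<open>auto simp: gam_vec3 p4\<close>)
    next
      case False
      have B: "(\<lambda>k. 2 ^ ord_exp r f * B2_vec r f k) = vec3 (2 ^ (r - 3)) 0 r (- (2 ^ (r - 3)))"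
        using r False 3 by (simp add: B2_vec_last vec3_scale ord_exp_last)
      have "(- 2 - (2 * real r + 2)) / 2 = of_int (- 2 - int r)" by simp
      hence par: "(- 2 - (2 * real r + 2)) / 2 \<in> \<int>" by (metis Ints_of_int)
      show ?thesis unfolding B
        by (rule principal_vec3[where A = "1" and B = "0" and G = "-1"])
          (use d[unfolded B] r par in \<open>auto simp: gam_vec3 p3\<close>)
    qed
  qed
qed

lemma dvd_if_quotient_Ints:
  assumes "real_of_int x / 2 ^ n \<in> \<int>"
  shows "2 ^ n dvd x"
proof -
  obtain k where "real_of_int x / 2 ^ n = of_int k" using assms by (rule Ints_cases)
  hence "real_of_int x = of_int (2 ^ n * k)" by (simp add: field_simps)
  thus ?thesis by (metis of_int_eq_iff dvd_triv_left)
qed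

lemma principal_sum:
  assumes "finite I" "\<And>i. i \<in> I \<Longrightarrow> cuspidal_divisor r (b i) \<in> principal_divisors (2 ^ r)"
  shows "cuspidal_divisor r (\<lambda>k. \<Sum>i\<in>I. b i k) \<in> principal_divisors (2 ^ r)"
  using assms
proof (induction I rule: finite_induct)
  case empty
  have "deg_zero r (\<lambda>_. 0)" by (simp add: deg_zero_def deg_cuspidal_divisor)
  thus ?case using cusp_class_eq_one_iff[of r "\<lambda>_. 0"] cusp_class_zero by simp
next
  case (insert i I)
  thus ?case using principal_add[of r "b i" "\<lambda>k. \<Sum>i\<in>I. b i k"] by simp
qed

lemma principal_B2_multiple:
  assumes "r \<ge> 5" "f \<in> {3..r}" "2 ^ ord_exp r f dvd c"
  shows "cuspidal_divisor r (\<lambda>k. c * B2_vec r f k) \<in> principal_divisors (2 ^ r)"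
proof -
  obtain d where "c = 2 ^ ord_exp r f * d" using assms(3) by (elim dvdE)
  hence "(\<lambda>k. c * B2_vec r f k) = (\<lambda>k. d * (2 ^ ord_exp r f * B2_vec r f k))" by (simp add: mult_ac)
  thus ?thesis using principal_scale[OF principal_B2[OF assms(1,2)], of d] by simp
qed

lemma vec3_combine: "(\<lambda>k. m * vec3 x y g z k + n * vec3 x' y' g z' k) = vec3 (m * x + n * x') (m * y + n * y') g (m * z + n * z')"
  by (rule ext) (simp add: vec3_def algebra_simps)

text \<open>For even r the condition at level \<open>2\<^sup>r\<close> bounds v, and the parity of
  the weight then bounds u. For odd r the conditions at the levels 2 and \<open>2\<^sup>r\<close>
  bound u, and v up to a factor 2, which the weight supplies.\<close>

lemma B2_last_two_independent:
  assumes r: "r \<ge> 5"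
    and P: "cuspidal_divisor r (\<lambda>k. u * B2_vec r (r - Suc 0) k + v * B2_vec r r k) \<in> principal_divisors (2 ^ r)"
  shows "2 ^ ord_exp r (r - Suc 0) dvd u" "2 ^ ord_exp r r dvd v"
proof -
  obtain l where l: "r = l + 5" using le_Suc_ex[OF r] by (metis add.commute)
  have pw: "r - 3 = l + 2" "r - 4 = l + 1" "r - 5 = l" "(2::real) ^ r = 32 * 2 ^ l" "(2::real) ^ (r - Suc 0) = 16 * 2 ^ l"
    "max (Suc 0) (r - Suc 0) = r - Suc 0"
    unfolding l by (simp_all add: power_add)
  have *: "2 ^ ord_exp r (r - Suc 0) dvd u \<and> 2 ^ ord_exp r r dvd v"
  proof (cases "even r")
    case True
    define b where "b = vec3 (u + v) (- u) r (- v)"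
    have "(\<lambda>k. u * B2_vec r (r - Suc 0) k + v * B2_vec r r k) = b"
      using r True by (simp add: B2_vec_penultimate B2_vec_last vec3_combine b_def)
    hence Pb: "cuspidal_divisor r b \<in> principal_divisors (2 ^ r)" using P by simp
    have d: "deg_zero r b" by (rule principal_deg_zero[OF Pb])
    have r1: "r \<ge> 1" using r by simp
    have e: "\<And>k. 1 \<le> k \<Longrightarrow> k \<le> r \<Longrightarrow> eta_exp r b k \<in> \<int>" and w: "weight_sum r b / 2 \<in> \<int>"
      using Pb principal_iff_eta_exp[OF d r1] by auto
    have z: "b 2 = 0" "b (r - 1) = 0" using r by (auto simp: b_def vec3_def)
    have "2 * gam r b r = - (of_int v / 2 ^ Suc l)" using r by (simp add: b_def gam_vec3 pw)
    hence "real_of_int v / 2 ^ Suc l \<in> \<int>" using gam_integral(3)[of r b, OF r e z] by simp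
    hence v: "2 ^ Suc l dvd v" by (rule dvd_if_quotient_Ints)
    then obtain v' where v': "v = 2 ^ Suc l * v'" by (elim dvdE)
    obtain m where "r = 2 * m" using True by (elim evenE)
    hence m: "real r = 2 * real m" by simp
    have "weight_sum r b = gam r b 1 - 2 * gam r b 0 + (2 * real r + 2) * gam r b r"
      using r by (subst weight_sum_vec3[OF _ _ b_def]) auto
    also have "\<dots> / 2 = - (of_int u / 2 ^ Suc l) - of_int ((int m + 1) * v')"
      using r by (simp add: b_def gam_vec3 pw v' m field_simps)
    finally have ws: "weight_sum r b / 2 = - (of_int u / 2 ^ Suc l) - of_int ((int m + 1) * v')" .
    have "weight_sum r b / 2 + of_int ((int m + 1) * v') = - (of_int u / 2 ^ Suc l)" unfolding ws by simp
    moreover have "weight_sum r b / 2 + of_int ((int m + 1) * v') \<in> \<int>" using w by (intro Ints_add Ints_of_int)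
    ultimately have "real_of_int u / 2 ^ Suc l \<in> \<int>" by simp
    hence "2 ^ Suc l dvd u" by (rule dvd_if_quotient_Ints)
    thus ?thesis using v r True by (simp add: ord_exp_last pw)
  next
    case False
    define b where "b = vec3 (v - u) (- u) r (2 * u - v)"
    have "(\<lambda>k. u * B2_vec r (r - Suc 0) k + v * B2_vec r r k) = b"
      using r False by (simp add: B2_vec_penultimate B2_vec_last vec3_combine b_def mult.commute)
    hence Pb: "cuspidal_divisor r b \<in> principal_divisors (2 ^ r)" using P by simp
    have d: "deg_zero r b" by (rule principal_deg_zero[OF Pb])
    have r1: "r \<ge> 1" using r by simp
    have e: "\<And>k. 1 \<le> k \<Longrightarrow> k \<le> r \<Longrightarrow> eta_exp r b k \<in> \<int>" and w: "weight_sum r b / 2 \<in> \<int>"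
      using Pb principal_iff_eta_exp[OF d r1] by auto
    have z: "b 2 = 0" "b (r - 1) = 0" using r by (auto simp: b_def vec3_def)
    have "2 * gam r b 1 = - (of_int u / 2 ^ l)" using r by (simp add: b_def gam_vec3 pw)
    hence "real_of_int u / 2 ^ l \<in> \<int>" using gam_integral(2)[of r b, OF r e z] by simp
    hence u: "2 ^ l dvd u" by (rule dvd_if_quotient_Ints)
    then obtain u' where u': "u = 2 ^ l * u'" by (elim dvdE)
    have "2 * gam r b r = of_int u' - of_int v / 2 ^ Suc l" using r by (simp add: b_def gam_vec3 pw u' field_simps)
    hence "of_int u' - 2 * gam r b r = of_int v / 2 ^ Suc l" by simp
    moreover have "of_int u' - 2 * gam r b r \<in> \<int>" using gam_integral(3)[of r b, OF r e z] by (intro Ints_diff Ints_of_int)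
    ultimately have "real_of_int v / 2 ^ Suc l \<in> \<int>" by simp
    hence "2 ^ Suc l dvd v" by (rule dvd_if_quotient_Ints)
    then obtain v' where v': "v = 2 ^ Suc l * v'" by (elim dvdE)
    obtain m where "r = 2 * m + 1" using False by (elim oddE)
    hence m: "real r = 2 * real m + 1" by simp
    have "weight_sum r b = gam r b 1 - 2 * gam r b 0 + (2 * real r + 2) * gam r b r"
      using r by (subst weight_sum_vec3[OF _ _ b_def]) auto
    also have "\<dots> / 2 = of_int ((int m + 1) * u' - (int m + 1) * v') - of_int v' / 2"
      using r by (simp add: b_def gam_vec3 pw u' v' m field_simps)
    finally have ws: "weight_sum r b / 2 = of_int ((int m + 1) * u' - (int m + 1) * v') - of_int v' / 2" .
    have "of_int ((int m + 1) * u' - (int m + 1) * v') - weight_sum r b / 2 = of_int v' / 2 ^ 1" unfolding ws by simp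
    moreover have "of_int ((int m + 1) * u' - (int m + 1) * v') - weight_sum r b / 2 \<in> \<int>" using w by (intro Ints_diff Ints_of_int)
    ultimately have "real_of_int v' / 2 ^ 1 \<in> \<int>" by (simp only:)
    hence "2 ^ 1 dvd v'" by (rule dvd_if_quotient_Ints)
    hence "2 ^ (l + 2) dvd v" unfolding v' by (auto simp: power_add)
    thus ?thesis using u r False by (simp add: ord_exp_last pw)
  qed
  show "2 ^ ord_exp r (r - Suc 0) dvd u" "2 ^ ord_exp r r dvd v" using * by auto
qed

lemma sum_split_last_two:
  fixes f :: "nat \<Rightarrow> int"
  assumes "r \<ge> 5"
  shows "sum f {3..r} = sum f {3..r - 2} + f (r - Suc 0) + f r"
proof -
  have "{3..r} = insert r (insert (r - Suc 0) {3..r - 2})" using assms by auto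
  moreover have "r \<notin> insert (r - Suc 0) {3..r - 2}" "r - Suc 0 \<notin> {3..r - 2}" using assms by auto
  ultimately show ?thesis by (simp add: add_ac)
qed

text \<open>At the pivot of f only the generator with index f is nonzero, so
  \<open>gam_integral\<close> gives the divisibility for f \<le> r - 2. These summands are then
  principal by themselves, and their removal leaves the last two generators.\<close>

lemma B2_independent:
  assumes r: "r \<ge> 5"
    and P: "cuspidal_divisor r (\<lambda>k. \<Sum>f\<in>{3..r}. x f * B2_vec r f k) \<in> principal_divisors (2 ^ r)"
    and f: "f \<in> {3..r}"
  shows "2 ^ ord_exp r f dvd x f"
proof -
  define a where "a = (\<lambda>k. \<Sum>f\<in>{3..r}. x f * B2_vec r f k)"
  have Pa: "cuspidal_divisor r a \<in> principal_divisors (2 ^ r)" using P by (simp add: a_def)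
  have d: "deg_zero r a" by (rule principal_deg_zero[OF Pa])
  have r1: "r \<ge> 1" using r by simp
  have e: "\<And>k. 1 \<le> k \<Longrightarrow> k \<le> r \<Longrightarrow> eta_exp r a k \<in> \<int>"
    using Pa principal_iff_eta_exp[OF d r1] by auto
  have z: "a 2 = 0" "a (r - 1) = 0" using r B2_combination_zero unfolding a_def by auto
  have low: "2 ^ ord_exp r g dvd x g" if g: "g \<in> {3..r - 2}" for g
  proof (rule dvd_if_quotient_Ints)
    have p: "3 \<le> piv r g" "piv r g \<le> r - 2" "ord_exp r g = max (piv r g) (r - piv r g) - 3" using g piv_props by auto
    hence "max (piv r g) (r - piv r g) = ord_exp r g + 3" by simp
    hence "gam r a (piv r g) = - (of_int (x g) / 2 ^ ord_exp r g)"
      using g B2_combination_piv[of g r x] unfolding a_def[symmetric] by (simp add: gam_def a_def power_add)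
    thus "real_of_int (x g) / 2 ^ ord_exp r g \<in> \<int>" using gam_integral(1)[of r a, OF r e z p(1,2)] by simp
  qed
  have "cuspidal_divisor r (\<lambda>k. - 1 * (\<Sum>g\<in>{3..r - 2}. x g * B2_vec r g k)) \<in> principal_divisors (2 ^ r)"
    by (intro principal_scale principal_sum principal_B2_multiple r low) auto
  from principal_add[OF Pa this]
  have "cuspidal_divisor r (\<lambda>k. x (r - Suc 0) * B2_vec r (r - Suc 0) k + x r * B2_vec r r k) \<in> principal_divisors (2 ^ r)"
    using r by (simp add: a_def sum_split_last_two)
  note last = B2_last_two_independent[OF r this]
  consider "f \<in> {3..r - 2}" | "f = r - Suc 0" | "f = r" using f by fastforce
  thus ?thesis using low last by cases auto
qed

text \<open>Elimination: \<open>triv1\<close> and \<open>triv2\<close> clear the levels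
  \<open>2\<^sup>2\<close> and \<open>2\<^sup>r\<^sup>-\<^sup>1\<close>, the pivots clear the levels
  between them, and what is left has entries at the levels 1, 2 and \<open>2\<^sup>r\<close>
  only.\<close>

lemma B2_generate:
  assumes r: "r \<ge> 5" and a: "deg_zero r a"
  shows "\<exists>x. cusp_class r a = cusp_class r (\<lambda>k. \<Sum>f\<in>{3..r}. x f * B2_vec r f k)"
proof -
  \<comment> \<open>The factor \<open>triv2 r 2\<close> compensates the sign of the pivot of
    \<open>triv2\<close>, its square being 1.\<close>
  define t where "t = (\<lambda>k. a (r - 1) * triv1 r k + a 2 * triv2 r 2 * triv2 r k)"
  have Pt: "cuspidal_divisor r t \<in> principal_divisors (2 ^ r)"
    unfolding t_def by (intro principal_add principal_scale principal_triv1 principal_triv2 r)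
  define b where "b = (\<lambda>k. a k - t k)"
  have b0: "b 2 = 0" "b (r - 1) = 0" using triv_values[OF r] by (simp_all add: b_def t_def mult.assoc)
  have db: "deg_zero r b"
    using deg_zero_add[OF a deg_zero_scale[OF principal_deg_zero[OF Pt], of "- 1"]] by (simp add: b_def)
  define c where "c = (\<lambda>k. b k + (\<Sum>f\<in>{3..r - 2}. b (piv r f) * B2_vec r f k))"
  have dc: "deg_zero r c" unfolding c_def
    by (intro deg_zero_add db deg_zero_sum deg_zero_B2 r) auto
  have c0: "c k = 0" if k: "2 \<le> k" "k \<le> r - 1" for k
  proof -
    define S where "S = (\<Sum>f\<in>{3..r - 2}. b (piv r f) * B2_vec r f k)"
    have S: "S = (\<Sum>f\<in>{3..r}. (if f \<le> r - 2 then b (piv r f) else 0) * B2_vec r f k)"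
    proof -
      have "\<not> r - Suc 0 \<le> r - 2" "\<not> r \<le> r - 2" using r by auto
      thus ?thesis unfolding S_def using r by (simp add: sum_split_last_two)
    qed
    consider "k \<in> {2, r - 1}" | "k \<in> {3..r - 2}" using k r by fastforce
    hence "b k + S = 0"
    proof cases
      case 1
      have "S = 0" unfolding S by (rule B2_combination_zero[OF 1 r])
      thus ?thesis using 1 b0 by auto
    next
      case 2
      hence "k \<in> piv r ` {3..r - 2}" by (simp only: piv_bij)
      then obtain g where g: "g \<in> {3..r - 2}" "k = piv r g" by blast
      have "S = - (if g \<le> r - 2 then b (piv r g) else 0)"
        unfolding S unfolding g(2) by (rule B2_combination_piv) (use g(1) in auto)
      thus ?thesis using g by simp
    qed
    thus ?thesis by (simp add: c_def S_def)
  qed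
  have c_vec: "c k = vec3 (c 0) (c 1) r (c r) k" if "k \<le> r" for k
  proof -
    consider "k = 0" | "k = 1" | "k = r" "k \<noteq> 0" "k \<noteq> 1" | "2 \<le> k" "k \<le> r - 1" using \<open>k \<le> r\<close> by linarith
    thus ?thesis using r c0 by cases (auto simp: vec3_def)
  qed
  have "deg_zero r (vec3 (c 0) (c 1) r (c r))"
    using dc cuspidal_divisor_cong[of r c, OF c_vec] by (simp add: deg_zero_def)
  hence sum0: "c 0 + c 1 + c r = 0" using r by (simp add: deg_zero_vec3 num_cusps_r)
  define u where "u = - c 1"
  \<comment> \<open>Entries at the levels 1, 2 and \<open>2\<^sup>r\<close> of total degree 0 form a
    group of rank 2 with the last two generators as a basis; u and v solve the equations at the
    levels 2 and \<open>2\<^sup>r\<close>, and the degree takes care of level 1.\<close>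
  define v where "v = (if even r then - c r else - 2 * c 1 - c r)"
  have c_comb: "c k = u * B2_vec r (r - Suc 0) k + v * B2_vec r r k" if "k \<le> r" for k
  proof (cases "even r")
    case True
    have "c 0 = u + v" using sum0 True by (simp add: u_def v_def)
    hence "vec3 (c 0) (c 1) r (c r) = (\<lambda>k. u * B2_vec r (r - Suc 0) k + v * B2_vec r r k)"
      using r True by (simp add: B2_vec_penultimate B2_vec_last vec3_combine) (simp add: u_def v_def)
    thus ?thesis using c_vec[OF that] by simp
  next
    case False
    have "c 0 = v - u" "c 1 = - u" "c r = u * 2 - v" using sum0 False by (simp_all add: u_def v_def)
    hence "vec3 (c 0) (c 1) r (c r) = (\<lambda>k. u * B2_vec r (r - Suc 0) k + v * B2_vec r r k)"
      using r False by (simp add: B2_vec_penultimate B2_vec_last vec3_combine)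
    thus ?thesis using c_vec[OF that] by simp
  qed
  define x where "x = (\<lambda>f. if f \<le> r - 2 then - b (piv r f) else if f = r then v else u)"
  have "cusp_class r a = cusp_class r (\<lambda>k. \<Sum>f\<in>{3..r}. x f * B2_vec r f k)"
  proof (rule cusp_class_eqI[OF _ Pt])
    show "deg_zero r (\<lambda>k. \<Sum>f\<in>{3..r}. x f * B2_vec r f k)" by (intro deg_zero_sum deg_zero_B2 r)
  next
    fix k assume k: "k \<le> r"
    have "\<not> r - Suc 0 \<le> r - 2" "\<not> r \<le> r - 2" "r - Suc 0 \<noteq> r" using r by auto
    hence "(\<Sum>f\<in>{3..r}. x f * B2_vec r f k) = - (\<Sum>f\<in>{3..r - 2}. b (piv r f) * B2_vec r f k) + c k"
      using r by (simp add: sum_split_last_two c_comb[OF k] x_def sum_negf[symmetric])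
    also have "\<dots> = a k - t k" by (simp add: c_def b_def)
    finally show "a k = (\<Sum>f\<in>{3..r}. x f * B2_vec r f k) + t k" by simp
  qed
  thus ?thesis by blast
qed

lemma cusp_class_B2_pow_eq_one_iff:
  assumes "r \<ge> 5" "f \<in> {3..r}"
  shows "cusp_class r (B2_vec r f) [^]\<^bsub>J0 (2 ^ r)\<^esub> (c :: int) = \<one>\<^bsub>J0 (2 ^ r)\<^esub> \<longleftrightarrow> 2 ^ ord_exp r f dvd c"
proof -
  note d = deg_zero_B2[OF assms]
  have "cusp_class r (B2_vec r f) [^]\<^bsub>J0 (2 ^ r)\<^esub> c = \<one>\<^bsub>J0 (2 ^ r)\<^esub> \<longleftrightarrow>
    cuspidal_divisor r (\<lambda>k. c * B2_vec r f k) \<in> principal_divisors (2 ^ r)"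
    unfolding cusp_class_scale[OF d, symmetric] by (rule cusp_class_eq_one_iff[OF deg_zero_scale[OF d]])
  also have "\<dots> \<longleftrightarrow> 2 ^ ord_exp r f dvd c"
  proof
    assume *: "cuspidal_divisor r (\<lambda>k. c * B2_vec r f k) \<in> principal_divisors (2 ^ r)"
    have "(\<lambda>k. \<Sum>g\<in>{3..r}. (if g = f then c else 0) * B2_vec r g k) = (\<lambda>k. c * B2_vec r f k)"
    proof (rule ext)
      fix k
      have "(\<Sum>g\<in>{3..r}. (if g = f then c else 0) * B2_vec r g k) = (\<Sum>g\<in>{3..r}. if g = f then c * B2_vec r f k else 0)"
        by (intro sum.cong) auto
      thus "(\<Sum>g\<in>{3..r}. (if g = f then c else 0) * B2_vec r g k) = c * B2_vec r f k" using assms(2) by simp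
    qed
    thus "2 ^ ord_exp r f dvd c" using B2_independent[of r "\<lambda>g. if g = f then c else 0" f] assms * by simp
  qed (rule principal_B2_multiple[OF assms])
  finally show ?thesis .
qed

theorem theorem6p21:
  fixes r :: nat
  shows "(r \<le> 4 \<longrightarrow> trivial_group (cuspidal_class_group r)) \<and>
    (r \<ge> 5 \<longrightarrow>
      cuspidal_class_group r \<cong>
        sum_group {3..r} (\<lambda>f. subgroup_generated (J0 (2 ^ r)) {divisor_class (2 ^ r) (B2 r f)}) \<and>
      (\<forall>f \<in> {3..r}. let j = (r + 1 - f) div 2 in
        group.ord (J0 (2 ^ r)) (divisor_class (2 ^ r) (B2 r f)) =
          (if f = r + 1 - gcd 2 r then 2 ^ (r - 3 - j) else 2 ^ (r - 4 - j))))"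
proof (intro conjI impI)
  interpret J: comm_group "J0 (2 ^ r)" by (rule comm_group_J0) simp
  assume r: "r \<le> 4"
  have "carrier (cuspidal_class_group r) \<subseteq> {\<one>\<^bsub>J0 (2 ^ r)\<^esub>}"
    unfolding carrier_cuspidal_class_group using principal_small[OF r] cusp_class_eq_one_iff by auto
  moreover have "group (cuspidal_class_group r)"
    unfolding cuspidal_class_group_def by (rule J.group_subgroup_generated)
  moreover have "\<one>\<^bsub>cuspidal_class_group r\<^esub> = \<one>\<^bsub>J0 (2 ^ r)\<^esub>" by (simp add: cuspidal_class_group_def)
  ultimately show "trivial_group (cuspidal_class_group r)"
    using group.is_monoid monoid.one_closed by (fastforce simp: trivial_group_def)
next
  interpret J: comm_group "J0 (2 ^ r)" by (rule comm_group_J0) simp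
  assume r: "5 \<le> r"
  have B: "divisor_class (2 ^ r) (B2 r f) = cusp_class r (B2_vec r f)" for f
    by (simp add: B2_def cusp_class_def)
  note d = deg_zero_B2[OF r]
  note cl = cusp_class_closed[OF d]
  have fp: "finprod (J0 (2 ^ r)) (\<lambda>f. cusp_class r (B2_vec r f) [^]\<^bsub>J0 (2 ^ r)\<^esub> x f) {3..r}
     = cusp_class r (\<lambda>k. \<Sum>f\<in>{3..r}. x f * B2_vec r f k)" for x :: "nat \<Rightarrow> int"
    by (rule cusp_class_finprod) (use d in auto)
  have "carrier (cuspidal_class_group r) =
    {finprod (J0 (2 ^ r)) (\<lambda>f. cusp_class r (B2_vec r f) [^]\<^bsub>J0 (2 ^ r)\<^esub> x f) {3..r} | x :: nat \<Rightarrow> int. True}"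
    unfolding fp carrier_cuspidal_class_group using B2_generate[OF r] deg_zero_sum[OF d, of "{3..r}"] by auto
  moreover have "\<forall>f\<in>{3..r}. cusp_class r (B2_vec r f) [^]\<^bsub>J0 (2 ^ r)\<^esub> x f = \<one>\<^bsub>J0 (2 ^ r)\<^esub>"
    if "finprod (J0 (2 ^ r)) (\<lambda>f. cusp_class r (B2_vec r f) [^]\<^bsub>J0 (2 ^ r)\<^esub> x f) {3..r} = \<one>\<^bsub>J0 (2 ^ r)\<^esub>"
    for x :: "nat \<Rightarrow> int"
  proof -
    have "deg_zero r (\<lambda>k. \<Sum>f\<in>{3..r}. x f * B2_vec r f k)" by (intro deg_zero_sum d)
    hence "cuspidal_divisor r (\<lambda>k. \<Sum>f\<in>{3..r}. x f * B2_vec r f k) \<in> principal_divisors (2 ^ r)"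
      using that unfolding fp by (simp add: cusp_class_eq_one_iff)
    thus ?thesis using B2_independent[OF r] cusp_class_B2_pow_eq_one_iff[OF r] by auto
  qed
  ultimately show "cuspidal_class_group r \<cong>
      sum_group {3..r} (\<lambda>f. subgroup_generated (J0 (2 ^ r)) {divisor_class (2 ^ r) (B2 r f)})"
    unfolding B cuspidal_class_group_def using cl by (intro J.direct_sum_of_cyclic) auto
  show "\<forall>f \<in> {3..r}. let j = (r + 1 - f) div 2 in
      group.ord (J0 (2 ^ r)) (divisor_class (2 ^ r) (B2 r f)) =
        (if f = r + 1 - gcd 2 r then 2 ^ (r - 3 - j) else 2 ^ (r - 4 - j))"
  proof
    fix f assume f: "f \<in> {3..r}"
    have "J.ord (cusp_class r (B2_vec r f)) = 2 ^ ord_exp r f"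
      unfolding J.ord_unique[OF cl[OF f]]
    proof
      fix n :: nat
      have "cusp_class r (B2_vec r f) [^]\<^bsub>J0 (2 ^ r)\<^esub> n = \<one>\<^bsub>J0 (2 ^ r)\<^esub> \<longleftrightarrow> (2 ^ ord_exp r f :: int) dvd int n"
        using cusp_class_B2_pow_eq_one_iff[OF r f, of "int n"] by (simp add: int_pow_int)
      also have "\<dots> \<longleftrightarrow> 2 ^ ord_exp r f dvd n" by (metis int_dvd_int_iff of_nat_numeral of_nat_power)
      finally show "cusp_class r (B2_vec r f) [^]\<^bsub>J0 (2 ^ r)\<^esub> n = \<one>\<^bsub>J0 (2 ^ r)\<^esub> \<longleftrightarrow> 2 ^ ord_exp r f dvd n" .
    qed
    thus "let j = (r + 1 - f) div 2 in
      group.ord (J0 (2 ^ r)) (divisor_class (2 ^ r) (B2 r f)) =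
        (if f = r + 1 - gcd 2 r then 2 ^ (r - 3 - j) else 2 ^ (r - 4 - j))"
      by (simp add: B Let_def ord_exp_def)
  qed
qed

end
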